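(* Let $(A,\Delta)$ be an algebraic quantum group with dual $\widehat A$, let $\psi$ be a fixed right integral on $A$, and let $\mathcal F:A\to\widehat A$ be the Fourier transform $\mathcal F(x)=\psi(S(\,\cdot\,)x)$. For all $x,x'\in A$ we have $$(\mathcal F\otimes\mathcal F)(\Delta(x)(1\otimes x'))=((S^{-1}\otimes\iota)\Delta(y'))(y\otimes1),$$ where $y=\mathcal F(x)$ and $y'=\mathcal F(x')$.
   Context: All algebras are associative algebras over $\mathbb C$, possibly non-unital, with non-degenerate product; $M(A)$ is the multiplier algebra of $A$; $\iota$ denotes identity maps. Regular multiplier Hopf algebra: an algebra $A$ with a homomorphism $\Delta:A\to M(A\otimes A)$ such that $\Delta(a)(1\otimes a')$, $(a\otimes 1)\Delta(a')$, $\Delta(a)(a'\otimes 1)$ and $(1\otimes a)\Delta(a')$ lie in $A\otimes A$ for all $a,a'$; $\Delta$ is coassociative, $(a\otimes1\otimes1)(\Delta\otimes\iota)(\Delta(c)(1\otimes a'))=((\iota\otimes\Delta)((a\otimes1)\Delta(c)))(1\otimes1\otimes a')$; and the maps $a\otimes a'\mapsto\Delta(a)(1\otimes a')$, $a\otimes a'\mapsto(a\otimes1)\Delta(a')$, and the same two maps for the flipped coproduct, are bijections of $A\otimes A$. It has a unique counit $\varepsilon:A\to\mathbb C$ (a homomorphism) and antipode $S:A\to A$ (a bijective anti-homomorphism), characterized by $(\varepsilon\otimes\iota)(\Delta(a)(1\otimes a'))=aa'$ and $m(S\otimes\iota)(\Delta(a)(1\otimes a'))=\varepsilon(a)a'$,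 with $m$ the multiplication. A left (right) integral is a non-zero linear functional $\varphi$ (resp. $\psi$) on $A$ with $(\iota\otimes\varphi)\Delta(a)=\varphi(a)1$ (resp. $(\psi\otimes\iota)\Delta(a)=\psi(a)1$) in $M(A)$ for all $a$. An algebraic quantum group is a regular multiplier Hopf algebra with integrals. Dual: $B=\widehat A=\{\varphi(\,\cdot\,c):c\in A\}$, with $\langle a,b\rangle=b(a)$. Its product is $\langle a,bb'\rangle=\langle\Delta(a),b\otimes b'\rangle$; its coproduct $\Delta:B\to M(B\otimes B)$ is determined by $\langle a\otimes a',(b'\otimes1)\Delta(b)\rangle=\langle\Delta(a)(1\otimes a'),b'\otimes b\rangle$ and $\langle a\otimes a',\Delta(b)(1\otimes b')\rangle=\langle(a\otimes1)\Delta(a'),b\otimes b'\rangle$. $(B,\Delta)$ is again an algebraic quantum group; $S$ also denotes its antipode, and $\langle S(a),b\rangle=\langle a,S(b)\rangle$. All functionals $\psi(S(\,\cdot\,)x)$ belong to $\widehat A$. For $y,y'\in\widehat A$, the expression $((S^{-1}\otimes\iota)\Delta(y'))(y\otimes1)$ is the element $(S^{-1}\otimes\iota)\big((S(y)\otimes1)\Delta(y')\big)$ of $\widehat A\otimes\widehat A$; in Sweedler notation it is $\sum_{(y')}S^{-1}(y'_{(1)})y\otimes y'_{(2)}$. *)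

theory Defs
  imports
    Complex_Main
    "HOL-Library.Poly_Mapping"
    "HOL-Library.Function_Algebras"
    "HOL-Library.Product_Plus"
begin

section \<open>Complex vector spaces\<close>

class complex_vector = ab_group_add +
  fixes scaleC :: "complex \<Rightarrow> 'a \<Rightarrow> 'a" (infixr "*\<^sub>C" 75)
  assumes scaleC_add_right: "c *\<^sub>C (x + y) = c *\<^sub>C x + c *\<^sub>C y"
    and scaleC_add_left: "(c + d) *\<^sub>C x = c *\<^sub>C x + d *\<^sub>C x"
    and scaleC_scaleC: "c *\<^sub>C d *\<^sub>C x = (c * d) *\<^sub>C x"
    and scaleC_one: "1 *\<^sub>C x = x"

interpretation cvs: vector_space "scaleC :: complex \<Rightarrow> 'a::complex_vector \<Rightarrow> 'a"
  by unfold_locales (simp_all add: scaleC_add_right scaleC_add_left scaleC_scaleC scaleC_one)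

interpretation cvs2: vector_space_pair
    "scaleC :: complex \<Rightarrow> 'a::complex_vector \<Rightarrow> 'a"
    "scaleC :: complex \<Rightarrow> 'b::complex_vector \<Rightarrow> 'b"
  by unfold_locales

instantiation complex :: complex_vector
begin
definition scaleC_complex_def: "c *\<^sub>C (x::complex) = c * x"
instance by intro_classes (simp_all add: scaleC_complex_def algebra_simps)
end

instantiation "fun" :: (type, complex_vector) complex_vector
begin
definition scaleC_fun_def: "c *\<^sub>C f = (\<lambda>x. c *\<^sub>C f x)"
instance
  by intro_classes
    (simp_all add: scaleC_fun_def fun_eq_iff scaleC_add_right scaleC_add_left scaleC_scaleC scaleC_one)
end

instantiation prod :: (complex_vector, complex_vector) complex_vector
begin
definition scaleC_prod_def: "c *\<^sub>C p = (c *\<^sub>C fst p, c *\<^sub>C snd p)"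
instance
  by intro_classes
    (simp_all add: scaleC_prod_def prod_eq_iff scaleC_add_right scaleC_add_left scaleC_scaleC scaleC_one)
end

instantiation poly_mapping :: (type, complex_vector) complex_vector
begin
definition scaleC_poly_mapping_def: "c *\<^sub>C p = Poly_Mapping.map ((*\<^sub>C) c) p"

lemma lookup_scaleC: "Poly_Mapping.lookup (c *\<^sub>C p) k = c *\<^sub>C Poly_Mapping.lookup p k"
  by (simp add: scaleC_poly_mapping_def Poly_Mapping.map.rep_eq when_def)

instance
  by intro_classes
    (simp_all add: poly_mapping_eq_iff fun_eq_iff lookup_scaleC lookup_add
      scaleC_add_right scaleC_add_left scaleC_scaleC scaleC_one)
end

definition linear_on :: "'v::complex_vector set \<Rightarrow> ('v \<Rightarrow> 'w::complex_vector) \<Rightarrow> bool" where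
  "linear_on V f \<longleftrightarrow>
     (\<forall>u\<in>V. \<forall>v\<in>V. f (u + v) = f u + f v) \<and> (\<forall>c. \<forall>v\<in>V. f (c *\<^sub>C v) = c *\<^sub>C f v)"

definition bilinear_on ::
  "'v::complex_vector set \<Rightarrow> 'w::complex_vector set \<Rightarrow> ('v \<Rightarrow> 'w \<Rightarrow> 'z::complex_vector) \<Rightarrow> bool" where
  "bilinear_on V W f \<longleftrightarrow>
     (\<forall>v\<in>V. linear_on W (f v)) \<and> (\<forall>w\<in>W. linear_on V (\<lambda>v. f v w))"

section \<open>Algebraic tensor products\<close>

text \<open>The type of tensors is the free vector space on pairs modulo the bilinearity relations.\<close>

definition tensor_null :: "('v::complex_vector \<times> 'w::complex_vector \<Rightarrow>\<^sub>0 complex) set" where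
  "tensor_null = cvs.span (
     {Poly_Mapping.single (v + v', w) 1 - Poly_Mapping.single (v, w) 1 - Poly_Mapping.single (v', w) 1
       | v v' w. True} \<union>
     {Poly_Mapping.single (v, w + w') 1 - Poly_Mapping.single (v, w) 1 - Poly_Mapping.single (v, w') 1
       | v w w'. True} \<union>
     {Poly_Mapping.single (c *\<^sub>C v, w) 1 - c *\<^sub>C Poly_Mapping.single (v, w) 1 | c v w. True} \<union>
     {Poly_Mapping.single (v, c *\<^sub>C w) 1 - c *\<^sub>C Poly_Mapping.single (v, w) 1 | c v w. True})"

definition tensor_rel ::
  "('v::complex_vector \<times> 'w::complex_vector \<Rightarrow>\<^sub>0 complex) \<Rightarrow> ('v \<times> 'w \<Rightarrow>\<^sub>0 complex) \<Rightarrow> bool" where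
  "tensor_rel p q \<longleftrightarrow> p - q \<in> tensor_null"

lemma subspace_tensor_null: "cvs.subspace tensor_null"
  by (simp add: tensor_null_def cvs.subspace_span)

lemma equivp_tensor_rel: "equivp tensor_rel"
proof (rule equivpI)
  note s = subspace_tensor_null
  show "reflp tensor_rel"
    using cvs.subspace_0[OF s] by (auto simp: reflp_def tensor_rel_def)
  show "symp tensor_rel"
    by (rule sympI, unfold tensor_rel_def) (drule cvs.subspace_neg[OF s], simp)
  show "transp tensor_rel"
    by (rule transpI, unfold tensor_rel_def) (drule (1) cvs.subspace_add[OF s], simp)
qed

quotient_type (overloaded) ('v, 'w) tensor =
  "'v::complex_vector \<times> 'w::complex_vector \<Rightarrow>\<^sub>0 complex" / tensor_rel
  by (rule equivp_tensor_rel)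

instantiation tensor :: (complex_vector, complex_vector) complex_vector
begin

lift_definition zero_tensor :: "('a, 'b) tensor" is 0 .

lift_definition plus_tensor :: "('a, 'b) tensor \<Rightarrow> ('a, 'b) tensor \<Rightarrow> ('a, 'b) tensor" is "(+)"
  unfolding tensor_rel_def
  by (drule (1) cvs.subspace_add[OF subspace_tensor_null]) (simp add: algebra_simps)

lift_definition uminus_tensor :: "('a, 'b) tensor \<Rightarrow> ('a, 'b) tensor" is uminus
  unfolding tensor_rel_def
  by (drule cvs.subspace_neg[OF subspace_tensor_null]) (simp add: algebra_simps)

lift_definition minus_tensor :: "('a, 'b) tensor \<Rightarrow> ('a, 'b) tensor \<Rightarrow> ('a, 'b) tensor" is "(-)"
  unfolding tensor_rel_def
  by (drule (1) cvs.subspace_diff[OF subspace_tensor_null]) (simp add: algebra_simps)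

lift_definition scaleC_tensor :: "complex \<Rightarrow> ('a, 'b) tensor \<Rightarrow> ('a, 'b) tensor" is scaleC
  unfolding tensor_rel_def
  by (drule cvs.subspace_scale[OF subspace_tensor_null]) (simp add: cvs.scale_right_diff_distrib)

lemma tensor_rel_refl: "tensor_rel p p"
  using cvs.subspace_0[OF subspace_tensor_null] by (simp add: tensor_rel_def)

instance
proof
  fix a b c :: "('a, 'b) tensor" and k l :: complex
  show "a + b + c = a + (b + c)"
    by transfer (simp add: add.assoc tensor_rel_refl)
  show "a + b = b + a"
    by transfer (simp add: add.commute tensor_rel_refl)
  show "0 + a = a"
    by transfer (simp add: tensor_rel_refl)
  show "- a + a = 0"
    by transfer (simp add: tensor_rel_refl)
  show "a - b = a + - b"
    by transfer (simp add: tensor_rel_refl)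
  show "k *\<^sub>C (a + b) = k *\<^sub>C a + k *\<^sub>C b"
    by transfer (simp add: scaleC_add_right tensor_rel_refl)
  show "(k + l) *\<^sub>C a = k *\<^sub>C a + l *\<^sub>C a"
    by transfer (simp add: scaleC_add_left tensor_rel_refl)
  show "k *\<^sub>C l *\<^sub>C a = (k * l) *\<^sub>C a"
    by transfer (simp add: scaleC_scaleC tensor_rel_refl)
  show "1 *\<^sub>C a = a"
    by transfer (simp add: scaleC_one tensor_rel_refl)
qed

end

lift_definition tens :: "'v::complex_vector \<Rightarrow> 'w::complex_vector \<Rightarrow> ('v, 'w) tensor" (infixr "\<otimes>\<^sub>t" 73)
  is "\<lambda>v w. Poly_Mapping.single (v, w) 1" .

lemma tens_add_left: "(v + v') \<otimes>\<^sub>t w = v \<otimes>\<^sub>t w + v' \<otimes>\<^sub>t w"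
  by transfer (unfold tensor_rel_def tensor_null_def diff_diff_eq[symmetric], rule cvs.span_base, blast)

lemma tens_add_right: "v \<otimes>\<^sub>t (w + w') = v \<otimes>\<^sub>t w + v \<otimes>\<^sub>t w'"
  by transfer (unfold tensor_rel_def tensor_null_def diff_diff_eq[symmetric], rule cvs.span_base, blast)

lemma tens_scale_left: "(c *\<^sub>C v) \<otimes>\<^sub>t w = c *\<^sub>C (v \<otimes>\<^sub>t w)"
  by transfer (unfold tensor_rel_def tensor_null_def, rule cvs.span_base, blast)

lemma tens_scale_right: "v \<otimes>\<^sub>t (c *\<^sub>C w) = c *\<^sub>C (v \<otimes>\<^sub>t w)"
  by transfer (unfold tensor_rel_def tensor_null_def, rule cvs.span_base, blast)

text \<open>For subspaces \<open>V\<close> and \<open>W\<close> the canonical map from their tensor product into the tensor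
  product of the ambient spaces is injective, so the former is realized as a span.\<close>

definition tensor_space ::
  "'v::complex_vector set \<Rightarrow> 'w::complex_vector set \<Rightarrow> ('v, 'w) tensor set" where
  "tensor_space V W = cvs.span {v \<otimes>\<^sub>t w | v w. v \<in> V \<and> w \<in> W}"

text \<open>The linear map on \<open>V \<otimes> W\<close> induced by a map that is bilinear on \<open>V \<times> W\<close>; existence and
  uniqueness are the lemmas \<open>tensor_lift\<close> and \<open>tensor_lift_unique\<close>.\<close>

definition tensor_lift ::
  "'v::complex_vector set \<Rightarrow> 'w::complex_vector set \<Rightarrow> ('v \<Rightarrow> 'w \<Rightarrow> 'z::complex_vector)
     \<Rightarrow> ('v, 'w) tensor \<Rightarrow> 'z" where
  "tensor_lift V W f =
     (SOME h. linear_on (tensor_space V W) h \<and> (\<forall>v\<in>V. \<forall>w\<in>W. h (v \<otimes>\<^sub>t w) = f v w))"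

definition free_lift :: "('k \<Rightarrow> 'z::complex_vector) \<Rightarrow> ('k \<Rightarrow>\<^sub>0 complex) \<Rightarrow> 'z" where
  "free_lift f p = (\<Sum>k\<in>Poly_Mapping.keys p. Poly_Mapping.lookup p k *\<^sub>C f k)"

lemma free_lift_superset:
  assumes "finite K" "Poly_Mapping.keys p \<subseteq> K"
  shows "free_lift f p = (\<Sum>k\<in>K. Poly_Mapping.lookup p k *\<^sub>C f k)"
  unfolding free_lift_def
  by (rule sum.mono_neutral_left) (use assms in \<open>auto simp: in_keys_iff\<close>)

lemma free_lift_add: "free_lift f (p + q) = free_lift f p + free_lift f q"
proof -
  let ?K = "Poly_Mapping.keys p \<union> Poly_Mapping.keys q"
  have "free_lift f (p + q) = (\<Sum>k\<in>?K. Poly_Mapping.lookup (p + q) k *\<^sub>C f k)"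
    by (rule free_lift_superset) (auto simp: in_keys_iff lookup_add)
  also have "\<dots> = (\<Sum>k\<in>?K. Poly_Mapping.lookup p k *\<^sub>C f k) + (\<Sum>k\<in>?K. Poly_Mapping.lookup q k *\<^sub>C f k)"
    by (simp add: lookup_add scaleC_add_left sum.distrib)
  also have "\<dots> = free_lift f p + free_lift f q"
    by (simp add: free_lift_superset[of ?K])
  finally show ?thesis .
qed

lemma free_lift_scale: "free_lift f (c *\<^sub>C p) = c *\<^sub>C free_lift f p"
proof -
  have "free_lift f (c *\<^sub>C p) = (\<Sum>k\<in>Poly_Mapping.keys p. Poly_Mapping.lookup (c *\<^sub>C p) k *\<^sub>C f k)"
    by (rule free_lift_superset) (auto simp: in_keys_iff lookup_scaleC)
  then show ?thesis
    by (simp add: lookup_scaleC free_lift_def cvs.scale_sum_right scaleC_scaleC scaleC_complex_def)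
qed

lemma free_lift_single: "free_lift f (Poly_Mapping.single k 1) = f k"
  by (simp add: free_lift_def scaleC_one)

lemma free_lift_linear: "Vector_Spaces.linear scaleC scaleC (free_lift f)"
  by unfold_locales (simp_all add: free_lift_add free_lift_scale)

lemma free_lift_null:
  assumes b: "bilinear_on UNIV UNIV f" and p: "p \<in> tensor_null"
  shows "free_lift (case_prod f) p = 0"
proof -
  note diff = cvs2.linear_diff[OF free_lift_linear]
  show ?thesis
    using p unfolding tensor_null_def
  proof (induction rule: cvs.span_induct)
    show "cvs.subspace {p. free_lift (case_prod f) p = 0}"
      by (rule cvs2.linear_subspace_kernel[OF free_lift_linear])
    fix p assume "p \<in> ({Poly_Mapping.single (v + v', w) 1 - Poly_Mapping.single (v, w) 1
          - Poly_Mapping.single (v', w) 1 | v v' w. True} \<union>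
        {Poly_Mapping.single (v, w + w') 1 - Poly_Mapping.single (v, w) 1
          - Poly_Mapping.single (v, w') 1 | v w w'. True} \<union>
        {Poly_Mapping.single (c *\<^sub>C v, w) 1 - c *\<^sub>C Poly_Mapping.single (v, w) 1 | c v w. True} \<union>
        {Poly_Mapping.single (v, c *\<^sub>C w) 1 - c *\<^sub>C Poly_Mapping.single (v, w) 1 | c v w. True}
        :: ('a \<times> 'b \<Rightarrow>\<^sub>0 complex) set)"
    then show "free_lift (case_prod f) p = 0"
      using b by (auto simp: diff free_lift_single free_lift_scale bilinear_on_def linear_on_def)
  qed
qed

lemma tensor_lift_UNIV_exists:
  assumes b: "bilinear_on UNIV UNIV f"
  shows "\<exists>h. linear_on UNIV h \<and> (\<forall>v w. h (v \<otimes>\<^sub>t w) = f v w)"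
proof -
  define g where "g = free_lift (case_prod f)"
  define h where "h = (\<lambda>t. g (rep_tensor t))"
  have gq: "g p = g q" if "tensor_rel p q" for p q
    using free_lift_null[OF b that[unfolded tensor_rel_def]]
    by (simp add: g_def cvs2.linear_diff[OF free_lift_linear])
  have h: "h (abs_tensor p) = g p" for p
    unfolding h_def by (rule gq) (rule Quotient3_rep_abs[OF Quotient3_tensor tensor_rel_refl])
  have "h (s + t) = h s + h t" for s t
    by (induction s rule: tensor.abs_induct, induction t rule: tensor.abs_induct)
      (simp add: plus_tensor.abs_eq h, simp add: g_def free_lift_add)
  moreover have "h (c *\<^sub>C s) = c *\<^sub>C h s" for c s
    by (induction s rule: tensor.abs_induct)
      (simp add: scaleC_tensor.abs_eq h, simp add: g_def free_lift_scale)
  moreover have "h (v \<otimes>\<^sub>t w) = f v w" for v w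
    by (simp add: tens.abs_eq h, simp add: g_def free_lift_single)
  ultimately show ?thesis
    by (auto simp: linear_on_def)
qed

lemma subspace_projection:
  assumes "cvs.subspace V"
  shows "\<exists>P. linear_on UNIV P \<and> (\<forall>v. P v \<in> V) \<and> (\<forall>v\<in>V. P v = v)"
proof -
  obtain P where "P ` UNIV \<subseteq> V" "Vector_Spaces.linear scaleC scaleC P" "\<forall>v\<in>V. P (id v) = v"
    using cvs2.linear_exists_left_inverse_on[OF cvs.linear_id assms inj_on_id] by metis
  then show ?thesis
    by (intro exI[of _ P]) (auto simp: linear_on_def cvs2.linear_add cvs2.linear_scale)
qed

lemma tensor_lift:
  assumes V: "cvs.subspace V" and W: "cvs.subspace W" and f: "bilinear_on V W f"
  shows "linear_on (tensor_space V W) (tensor_lift V W f)"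
    and "\<And>v w. v \<in> V \<Longrightarrow> w \<in> W \<Longrightarrow> tensor_lift V W f (v \<otimes>\<^sub>t w) = f v w"
proof -
  obtain P where P: "linear_on UNIV P" "\<forall>v. P v \<in> V" "\<forall>v\<in>V. P v = v"
    using subspace_projection[OF V] by blast
  obtain Q where Q: "linear_on UNIV Q" "\<forall>w. Q w \<in> W" "\<forall>w\<in>W. Q w = w"
    using subspace_projection[OF W] by blast
  have "bilinear_on UNIV UNIV (\<lambda>v w. f (P v) (Q w))"
    using P Q f by (simp add: bilinear_on_def linear_on_def)
  then obtain h where "linear_on UNIV h" "\<forall>v w. h (v \<otimes>\<^sub>t w) = f (P v) (Q w)"
    using tensor_lift_UNIV_exists[of "\<lambda>v w. f (P v) (Q w)"] by blast
  then have "\<exists>h. linear_on (tensor_space V W) h \<and> (\<forall>v\<in>V. \<forall>w\<in>W. h (v \<otimes>\<^sub>t w) = f v w)"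
    using P Q by (intro exI[of _ h]) (simp add: linear_on_def)
  then have "linear_on (tensor_space V W) (tensor_lift V W f) \<and>
      (\<forall>v\<in>V. \<forall>w\<in>W. tensor_lift V W f (v \<otimes>\<^sub>t w) = f v w)"
    unfolding tensor_lift_def by (rule someI_ex)
  then show "linear_on (tensor_space V W) (tensor_lift V W f)"
    and "\<And>v w. v \<in> V \<Longrightarrow> w \<in> W \<Longrightarrow> tensor_lift V W f (v \<otimes>\<^sub>t w) = f v w"
    by auto
qed

lemma tensor_lift_unique:
  assumes "linear_on (tensor_space V W) g" "linear_on (tensor_space V W) h"
    and "\<And>v w. v \<in> V \<Longrightarrow> w \<in> W \<Longrightarrow> g (v \<otimes>\<^sub>t w) = h (v \<otimes>\<^sub>t w)"
    and "t \<in> tensor_space V W"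
  shows "g t = h t"
proof -
  let ?G = "{v \<otimes>\<^sub>t w | v w. v \<in> V \<and> w \<in> W}"
  have g0: "g 0 = 0" if "linear_on (tensor_space V W) g" for g :: "('a, 'b) tensor \<Rightarrow> 'c"
  proof -
    have "g (0 *\<^sub>C 0) = 0 *\<^sub>C g 0"
      using that cvs.span_zero[of ?G] unfolding linear_on_def tensor_space_def by blast
    then show ?thesis by simp
  qed
  have "t \<in> cvs.span ?G \<and> g t = h t"
    using assms(4) unfolding tensor_space_def
  proof (induction rule: cvs.span_induct_alt)
    case base
    then show ?case using g0[OF assms(1)] g0[OF assms(2)] by (simp add: cvs.span_zero)
  next
    case (step c x y)
    then have "x \<in> cvs.span ?G" "g x = h x"
      using assms(3) by (auto intro!: cvs.span_base)
    then show ?case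
      using step assms(1,2) unfolding linear_on_def tensor_space_def[symmetric]
      by (simp add: tensor_space_def cvs.span_add cvs.span_scale)
  qed
  then show ?thesis by simp
qed

definition tensor_map ::
  "'v::complex_vector set \<Rightarrow> 'w::complex_vector set
     \<Rightarrow> ('v \<Rightarrow> 'x::complex_vector) \<Rightarrow> ('w \<Rightarrow> 'y::complex_vector)
     \<Rightarrow> ('v, 'w) tensor \<Rightarrow> ('x, 'y) tensor" where
  "tensor_map V W f g = tensor_lift V W (\<lambda>v w. f v \<otimes>\<^sub>t g w)"

definition tensor_assoc ::
  "'u::complex_vector set \<Rightarrow> 'v::complex_vector set \<Rightarrow> 'w::complex_vector set
     \<Rightarrow> (('u, 'v) tensor, 'w) tensor \<Rightarrow> ('u, ('v, 'w) tensor) tensor" where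
  "tensor_assoc U V W = tensor_lift (tensor_space U V) W
     (\<lambda>t w. tensor_lift U V (\<lambda>u v. u \<otimes>\<^sub>t (v \<otimes>\<^sub>t w)) t)"

section \<open>Algebras and multiplier algebras\<close>

text \<open>Algebras have an explicit carrier, a subspace of the ambient type, because the dual is a
  space of functionals that depends on the quantum group.\<close>

record 'v alg =
  carr :: "'v set"
  mul :: "'v \<Rightarrow> 'v \<Rightarrow> 'v" (infixl "\<cdot>\<index>" 70)

definition nondeg_algebra :: "'v::complex_vector alg \<Rightarrow> bool" where
  "nondeg_algebra A \<longleftrightarrow>
     cvs.subspace (carr A) \<and>
     (\<forall>a\<in>carr A. \<forall>b\<in>carr A. a \<cdot>\<^bsub>A\<^esub> b \<in> carr A) \<and>
     bilinear_on (carr A) (carr A) (mul A) \<and>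
     (\<forall>a\<in>carr A. \<forall>b\<in>carr A. \<forall>c\<in>carr A. (a \<cdot>\<^bsub>A\<^esub> b) \<cdot>\<^bsub>A\<^esub> c = a \<cdot>\<^bsub>A\<^esub> (b \<cdot>\<^bsub>A\<^esub> c)) \<and>
     (\<forall>a\<in>carr A. (\<forall>b\<in>carr A. a \<cdot>\<^bsub>A\<^esub> b = 0) \<longrightarrow> a = 0) \<and>
     (\<forall>a\<in>carr A. (\<forall>b\<in>carr A. b \<cdot>\<^bsub>A\<^esub> a = 0) \<longrightarrow> a = 0)"

definition complex_alg :: "complex alg" where
  "complex_alg = \<lparr>carr = UNIV, mul = (*)\<rparr>"

definition alg_hom :: "'v::complex_vector alg \<Rightarrow> 'w::complex_vector alg \<Rightarrow> ('v \<Rightarrow> 'w) \<Rightarrow> bool" where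
  "alg_hom A C f \<longleftrightarrow>
     linear_on (carr A) f \<and> (\<forall>a\<in>carr A. f a \<in> carr C) \<and>
     (\<forall>a\<in>carr A. \<forall>b\<in>carr A. f (a \<cdot>\<^bsub>A\<^esub> b) = f a \<cdot>\<^bsub>C\<^esub> f b)"

definition alg_tensor ::
  "'v::complex_vector alg \<Rightarrow> 'w::complex_vector alg \<Rightarrow> ('v, 'w) tensor alg" (infixr "\<otimes>\<^sub>a" 73) where
  "A \<otimes>\<^sub>a C = \<lparr>carr = tensor_space (carr A) (carr C),
     mul = (\<lambda>s t. tensor_lift (carr A) (carr C)
       (\<lambda>a c. tensor_lift (carr A) (carr C) (\<lambda>a' c'. (a \<cdot>\<^bsub>A\<^esub> a') \<otimes>\<^sub>t (c \<cdot>\<^bsub>C\<^esub> c')) t) s)\<rparr>"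

text \<open>A multiplier \<open>x\<close> is the pair of maps \<open>b \<mapsto> x b\<close> and \<open>b \<mapsto> b x\<close>, normalized to vanish
  outside the carrier so that equality of multipliers is equality of pairs.\<close>

type_synonym 'v multiplier = "('v \<Rightarrow> 'v) \<times> ('v \<Rightarrow> 'v)"

definition ext0 :: "'v set \<Rightarrow> ('v \<Rightarrow> 'w) \<Rightarrow> 'v \<Rightarrow> 'w::zero" where
  "ext0 V f = (\<lambda>v. if v \<in> V then f v else 0)"

definition multipliers :: "'v::complex_vector alg \<Rightarrow> 'v multiplier set" where
  "multipliers A = {(l, r).
     (\<forall>v. v \<notin> carr A \<longrightarrow> l v = 0 \<and> r v = 0) \<and>
     linear_on (carr A) l \<and> linear_on (carr A) r \<and>
     (\<forall>a\<in>carr A. l a \<in> carr A \<and> r a \<in> carr A) \<and>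
     (\<forall>a\<in>carr A. \<forall>b\<in>carr A.
        l (a \<cdot>\<^bsub>A\<^esub> b) = l a \<cdot>\<^bsub>A\<^esub> b \<and> r (a \<cdot>\<^bsub>A\<^esub> b) = a \<cdot>\<^bsub>A\<^esub> r b \<and> a \<cdot>\<^bsub>A\<^esub> l b = r a \<cdot>\<^bsub>A\<^esub> b)}"

definition mult_alg :: "'v::complex_vector alg \<Rightarrow> 'v multiplier alg" where
  "mult_alg A = \<lparr>carr = multipliers A, mul = (\<lambda>x y. (fst x \<circ> fst y, snd y \<circ> snd x))\<rparr>"

definition mult_one :: "'v::complex_vector alg \<Rightarrow> 'v multiplier" where
  "mult_one A = (ext0 (carr A) id, ext0 (carr A) id)"

definition embed :: "'v::complex_vector alg \<Rightarrow> 'v \<Rightarrow> 'v multiplier" where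
  "embed A a = (ext0 (carr A) (\<lambda>b. a \<cdot>\<^bsub>A\<^esub> b), ext0 (carr A) (\<lambda>b. b \<cdot>\<^bsub>A\<^esub> a))"

text \<open>\<open>unembed\<close> turns a multiplier lying in \<open>A\<close> into the corresponding element of \<open>A\<close>; since the
  product is non-degenerate, \<open>embed\<close> is injective on the carrier.\<close>

definition in_alg :: "'v::complex_vector alg \<Rightarrow> 'v multiplier \<Rightarrow> bool" where
  "in_alg A x \<longleftrightarrow> x \<in> embed A ` carr A"

definition unembed :: "'v::complex_vector alg \<Rightarrow> 'v multiplier \<Rightarrow> 'v" where
  "unembed A x = inv_into (carr A) (embed A) x"

definition mult_tensor ::
  "'v::complex_vector alg \<Rightarrow> 'w::complex_vector alg
     \<Rightarrow> 'v multiplier \<Rightarrow> 'w multiplier \<Rightarrow> ('v, 'w) tensor multiplier" where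
  "mult_tensor A C x y =
     (ext0 (carr (A \<otimes>\<^sub>a C)) (tensor_map (carr A) (carr C) (fst x) (fst y)),
      ext0 (carr (A \<otimes>\<^sub>a C)) (tensor_map (carr A) (carr C) (snd x) (snd y)))"

text \<open>\<open>leg1 A a\<close> is \<open>a \<otimes> 1\<close> and \<open>leg2 A a\<close> is \<open>1 \<otimes> a\<close> in \<open>M(A \<otimes> A)\<close>.\<close>

definition leg1 :: "'v::complex_vector alg \<Rightarrow> 'v \<Rightarrow> ('v, 'v) tensor multiplier" where
  "leg1 A a = mult_tensor A A (embed A a) (mult_one A)"

definition leg2 :: "'v::complex_vector alg \<Rightarrow> 'v \<Rightarrow> ('v, 'v) tensor multiplier" where
  "leg2 A a = mult_tensor A A (mult_one A) (embed A a)"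

abbreviation mult_alg2 :: "'v::complex_vector alg \<Rightarrow> ('v, 'v) tensor multiplier alg" where
  "mult_alg2 A \<equiv> mult_alg (A \<otimes>\<^sub>a A)"

section \<open>Regular multiplier Hopf algebras\<close>

type_synonym 'v comult = "'v \<Rightarrow> ('v, 'v) tensor multiplier"

text \<open>The elements \<open>\<Delta>(a)(1 \<otimes> a')\<close> and \<open>(a \<otimes> 1)\<Delta>(a')\<close> of \<open>A \<otimes> A\<close>.\<close>

definition comult_r :: "'v::complex_vector alg \<Rightarrow> 'v comult \<Rightarrow> 'v \<Rightarrow> 'v \<Rightarrow> ('v, 'v) tensor" where
  "comult_r A \<Delta> a a' = unembed (A \<otimes>\<^sub>a A) (\<Delta> a \<cdot>\<^bsub>mult_alg2 A\<^esub> leg2 A a')"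

definition comult_l :: "'v::complex_vector alg \<Rightarrow> 'v comult \<Rightarrow> 'v \<Rightarrow> 'v \<Rightarrow> ('v, 'v) tensor" where
  "comult_l A \<Delta> a a' = unembed (A \<otimes>\<^sub>a A) (leg1 A a \<cdot>\<^bsub>mult_alg2 A\<^esub> \<Delta> a')"

definition flip :: "'v::complex_vector alg \<Rightarrow> ('v, 'v) tensor \<Rightarrow> ('v, 'v) tensor" where
  "flip A = tensor_lift (carr A) (carr A) (\<lambda>a b. b \<otimes>\<^sub>t a)"

definition comult_flip :: "'v::complex_vector alg \<Rightarrow> 'v comult \<Rightarrow> 'v comult" where
  "comult_flip A \<Delta> a =
     (ext0 (carr (A \<otimes>\<^sub>a A)) (flip A \<circ> fst (\<Delta> a) \<circ> flip A),
      ext0 (carr (A \<otimes>\<^sub>a A)) (flip A \<circ> snd (\<Delta> a) \<circ> flip A))"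

text \<open>In \<open>coassociative\<close>, the two sides are computed by
  \<open>(a \<otimes> 1 \<otimes> 1)(\<Delta> \<otimes> \<iota>)(p \<otimes> q) = (a \<otimes> 1)\<Delta>(p) \<otimes> q\<close> and
  \<open>(\<iota> \<otimes> \<Delta>)(p \<otimes> q)(1 \<otimes> 1 \<otimes> a') = p \<otimes> \<Delta>(q)(1 \<otimes> a')\<close>.\<close>

definition coassociative :: "'v::complex_vector alg \<Rightarrow> 'v comult \<Rightarrow> bool" where
  "coassociative A \<Delta> \<longleftrightarrow>
     (\<forall>a\<in>carr A. \<forall>a'\<in>carr A. \<forall>c\<in>carr A.
        tensor_assoc (carr A) (carr A) (carr A)
          (tensor_map (carr A) (carr A) (\<lambda>p. comult_l A \<Delta> a p) id (comult_r A \<Delta> c a'))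
        = tensor_map (carr A) (carr A) id (\<lambda>q. comult_r A \<Delta> q a') (comult_l A \<Delta> a c))"

definition galois_bijective :: "'v::complex_vector alg \<Rightarrow> 'v comult \<Rightarrow> bool" where
  "galois_bijective A \<Delta> \<longleftrightarrow>
     bij_betw (tensor_lift (carr A) (carr A) (comult_r A \<Delta>)) (carr (A \<otimes>\<^sub>a A)) (carr (A \<otimes>\<^sub>a A)) \<and>
     bij_betw (tensor_lift (carr A) (carr A) (comult_l A \<Delta>)) (carr (A \<otimes>\<^sub>a A)) (carr (A \<otimes>\<^sub>a A))"

definition regular_multiplier_hopf_algebra :: "'v::complex_vector alg \<Rightarrow> 'v comult \<Rightarrow> bool" where
  "regular_multiplier_hopf_algebra A \<Delta> \<longleftrightarrow>
     nondeg_algebra A \<and>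
     alg_hom A (mult_alg2 A) \<Delta> \<and>
     (\<forall>a\<in>carr A. \<forall>a'\<in>carr A.
        in_alg (A \<otimes>\<^sub>a A) (\<Delta> a \<cdot>\<^bsub>mult_alg2 A\<^esub> leg2 A a') \<and>
        in_alg (A \<otimes>\<^sub>a A) (leg1 A a \<cdot>\<^bsub>mult_alg2 A\<^esub> \<Delta> a') \<and>
        in_alg (A \<otimes>\<^sub>a A) (\<Delta> a \<cdot>\<^bsub>mult_alg2 A\<^esub> leg1 A a') \<and>
        in_alg (A \<otimes>\<^sub>a A) (leg2 A a \<cdot>\<^bsub>mult_alg2 A\<^esub> \<Delta> a')) \<and>
     coassociative A \<Delta> \<and>
     galois_bijective A \<Delta> \<and>
     galois_bijective A (comult_flip A \<Delta>)"

definition is_counit :: "'v::complex_vector alg \<Rightarrow> 'v comult \<Rightarrow> ('v \<Rightarrow> complex) \<Rightarrow> bool" where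
  "is_counit A \<Delta> \<epsilon> \<longleftrightarrow>
     alg_hom A complex_alg \<epsilon> \<and>
     (\<forall>a\<in>carr A. \<forall>a'\<in>carr A.
        tensor_lift (carr A) (carr A) (\<lambda>p q. \<epsilon> p *\<^sub>C q) (comult_r A \<Delta> a a') = a \<cdot>\<^bsub>A\<^esub> a')"

definition is_antipode :: "'v::complex_vector alg \<Rightarrow> 'v comult \<Rightarrow> ('v \<Rightarrow> 'v) \<Rightarrow> bool" where
  "is_antipode A \<Delta> S \<longleftrightarrow>
     linear_on (carr A) S \<and> bij_betw S (carr A) (carr A) \<and>
     (\<forall>a\<in>carr A. \<forall>b\<in>carr A. S (a \<cdot>\<^bsub>A\<^esub> b) = S b \<cdot>\<^bsub>A\<^esub> S a) \<and>
     (\<exists>\<epsilon>. is_counit A \<Delta> \<epsilon> \<and>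
       (\<forall>a\<in>carr A. \<forall>a'\<in>carr A.
          tensor_lift (carr A) (carr A) (\<lambda>p q. S p \<cdot>\<^bsub>A\<^esub> q) (comult_r A \<Delta> a a') = \<epsilon> a *\<^sub>C a'))"

section \<open>Integrals\<close>

text \<open>Slices of a multiplier \<open>x\<close> of \<open>A \<otimes> A\<close>, as multipliers of \<open>A\<close>:
  \<open>((\<iota> \<otimes> \<phi>)x) b = (\<iota> \<otimes> \<phi>)(x(b \<otimes> 1))\<close> and \<open>b ((\<iota> \<otimes> \<phi>)x) = (\<iota> \<otimes> \<phi>)((b \<otimes> 1)x)\<close>, and
  similarly for the first leg.\<close>

definition slice2 ::
  "'v::complex_vector alg \<Rightarrow> ('v \<Rightarrow> complex) \<Rightarrow> ('v, 'v) tensor multiplier \<Rightarrow> 'v multiplier" where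
  "slice2 A \<phi> x =
    (let sl = tensor_lift (carr A) (carr A) (\<lambda>p q. \<phi> q *\<^sub>C p) in
     (ext0 (carr A) (\<lambda>b. sl (unembed (A \<otimes>\<^sub>a A) (x \<cdot>\<^bsub>mult_alg2 A\<^esub> leg1 A b))),
      ext0 (carr A) (\<lambda>b. sl (unembed (A \<otimes>\<^sub>a A) (leg1 A b \<cdot>\<^bsub>mult_alg2 A\<^esub> x)))))"

definition slice1 ::
  "'v::complex_vector alg \<Rightarrow> ('v \<Rightarrow> complex) \<Rightarrow> ('v, 'v) tensor multiplier \<Rightarrow> 'v multiplier" where
  "slice1 A \<psi> x =
    (let sl = tensor_lift (carr A) (carr A) (\<lambda>p q. \<psi> p *\<^sub>C q) in
     (ext0 (carr A) (\<lambda>b. sl (unembed (A \<otimes>\<^sub>a A) (x \<cdot>\<^bsub>mult_alg2 A\<^esub> leg2 A b))),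
      ext0 (carr A) (\<lambda>b. sl (unembed (A \<otimes>\<^sub>a A) (leg2 A b \<cdot>\<^bsub>mult_alg2 A\<^esub> x)))))"

definition left_integral :: "'v::complex_vector alg \<Rightarrow> 'v comult \<Rightarrow> ('v \<Rightarrow> complex) \<Rightarrow> bool" where
  "left_integral A \<Delta> \<phi> \<longleftrightarrow>
     linear_on (carr A) \<phi> \<and> (\<exists>a\<in>carr A. \<phi> a \<noteq> 0) \<and>
     (\<forall>a\<in>carr A. slice2 A \<phi> (\<Delta> a) = \<phi> a *\<^sub>C mult_one A)"

definition right_integral :: "'v::complex_vector alg \<Rightarrow> 'v comult \<Rightarrow> ('v \<Rightarrow> complex) \<Rightarrow> bool" where
  "right_integral A \<Delta> \<psi> \<longleftrightarrow>
     linear_on (carr A) \<psi> \<and> (\<exists>a\<in>carr A. \<psi> a \<noteq> 0) \<and>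
     (\<forall>a\<in>carr A. slice1 A \<psi> (\<Delta> a) = \<psi> a *\<^sub>C mult_one A)"

definition algebraic_quantum_group :: "'v::complex_vector alg \<Rightarrow> 'v comult \<Rightarrow> bool" where
  "algebraic_quantum_group A \<Delta> \<longleftrightarrow>
     regular_multiplier_hopf_algebra A \<Delta> \<and>
     (\<exists>\<phi>. left_integral A \<Delta> \<phi>) \<and> (\<exists>\<psi>. right_integral A \<Delta> \<psi>)"

section \<open>The dual\<close>

text \<open>Functionals on \<open>A\<close> are normalized to vanish outside the carrier.\<close>

definition translate :: "'v::complex_vector alg \<Rightarrow> ('v \<Rightarrow> complex) \<Rightarrow> 'v \<Rightarrow> 'v \<Rightarrow> complex" where
  "translate A \<phi> c = ext0 (carr A) (\<lambda>a. \<phi> (a \<cdot>\<^bsub>A\<^esub> c))"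

text \<open>For \<open>b = \<phi>(\<cdot> c)\<close> and \<open>b' = \<phi>(\<cdot> c')\<close>, the functional \<open>b \<otimes> b'\<close> on \<open>A \<otimes> A\<close> extends to
  \<open>M(A \<otimes> A)\<close> by \<open>x \<mapsto> (\<phi> \<otimes> \<phi>)(x (c \<otimes> c'))\<close>; this gives \<open>\<langle>\<Delta>(a), b \<otimes> b'\<rangle>\<close>.\<close>

definition dual_mul ::
  "'v::complex_vector alg \<Rightarrow> 'v comult \<Rightarrow> ('v \<Rightarrow> complex)
     \<Rightarrow> ('v \<Rightarrow> complex) \<Rightarrow> ('v \<Rightarrow> complex) \<Rightarrow> 'v \<Rightarrow> complex" where
  "dual_mul A \<Delta> \<phi> b b' =
    (let c = inv_into (carr A) (translate A \<phi>) b;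
         c' = inv_into (carr A) (translate A \<phi>) b'
     in ext0 (carr A)
          (\<lambda>a. tensor_lift (carr A) (carr A) (\<lambda>p q. \<phi> p * \<phi> q) (fst (\<Delta> a) (c \<otimes>\<^sub>t c'))))"

definition dual_alg ::
  "'v::complex_vector alg \<Rightarrow> 'v comult \<Rightarrow> ('v \<Rightarrow> complex) \<Rightarrow> ('v \<Rightarrow> complex) alg" where
  "dual_alg A \<Delta> \<phi> = \<lparr>carr = translate A \<phi> ` carr A, mul = dual_mul A \<Delta> \<phi>\<rparr>"

definition pair2 ::
  "'v::complex_vector alg \<Rightarrow> ('v \<Rightarrow> complex) alg
     \<Rightarrow> ('v, 'v) tensor \<Rightarrow> ('v \<Rightarrow> complex, 'v \<Rightarrow> complex) tensor \<Rightarrow> complex" where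
  "pair2 A B t s = tensor_lift (carr A) (carr A)
     (\<lambda>a a'. tensor_lift (carr B) (carr B) (\<lambda>b b'. b a * b' a') s) t"

definition is_dual_comult ::
  "'v::complex_vector alg \<Rightarrow> 'v comult \<Rightarrow> ('v \<Rightarrow> complex) alg \<Rightarrow> ('v \<Rightarrow> complex) comult \<Rightarrow> bool" where
  "is_dual_comult A \<Delta> B \<Delta>' \<longleftrightarrow>
     (\<forall>b\<in>carr B. \<Delta>' b \<in> carr (mult_alg2 B)) \<and>
     (\<forall>b\<in>carr B. \<forall>b'\<in>carr B.
        in_alg (B \<otimes>\<^sub>a B) (leg1 B b' \<cdot>\<^bsub>mult_alg2 B\<^esub> \<Delta>' b) \<and>
        in_alg (B \<otimes>\<^sub>a B) (\<Delta>' b \<cdot>\<^bsub>mult_alg2 B\<^esub> leg2 B b') \<and>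
        (\<forall>a\<in>carr A. \<forall>a'\<in>carr A.
           pair2 A B (a \<otimes>\<^sub>t a') (comult_l B \<Delta>' b' b) = pair2 A B (comult_r A \<Delta> a a') (b' \<otimes>\<^sub>t b) \<and>
           pair2 A B (a \<otimes>\<^sub>t a') (comult_r B \<Delta>' b b') = pair2 A B (comult_l A \<Delta> a a') (b \<otimes>\<^sub>t b')))"

definition fourier ::
  "'v::complex_vector alg \<Rightarrow> ('v \<Rightarrow> 'v) \<Rightarrow> ('v \<Rightarrow> complex) \<Rightarrow> 'v \<Rightarrow> 'v \<Rightarrow> complex" where
  "fourier A S \<psi> x = ext0 (carr A) (\<lambda>a. \<psi> (S a \<cdot>\<^bsub>A\<^esub> x))"

end

theory Submission
  imports Defs
begin

text \<open>Write \<open>\<Delta>(a) = a\<^sub>1 \<otimes> a\<^sub>2\<close> in Sweedler notation. The elements of the dual are functionals on \<open>A\<close>, so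
two elements of its tensor square agree as soon as they agree on all \<open>a \<otimes> a'\<close>. After \<open>S' \<otimes> \<iota>\<close> is
applied to both sides, the theorem becomes the scalar identity
  \<open>\<psi>(S\<^sup>2(a) x\<^sub>1) \<psi>(S(a') x\<^sub>2 x') = \<psi>(S\<^sup>2(a\<^sub>1) x) \<psi>(S(a\<^sub>2 a') x')\<close>,
which is \<open>fourier_pairing\<close>. The right integral satisfies \<open>\<psi>(z x\<^sub>1) x\<^sub>2 = \<psi>(z\<^sub>1 x) S\<^sup>-\<^sup>1(z\<^sub>2)\<close>
(\<open>right_integral_antipode\<close>). With \<open>z = S\<^sup>2(a)\<close> this turns the left-hand side into the value at
\<open>S\<^sup>2(a)\<close> of a product \<open>\<psi>(\<cdot> x) * w\<close> in the dual. The antipode \<open>S'\<close> of the dual is composition with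
\<open>S\<close> and reverses products, so that value is the value at \<open>a\<close> of
\<open>S'\<^sup>2(\<psi>(\<cdot> x)) * S'\<^sup>2(w)\<close>, which is the right-hand side. The formula for the coproduct of \<open>S(a)\<close> enters
only in this dual form, as the antimultiplicativity of \<open>S'\<close>.

Two facts about the dual support this argument. The first is \<open>S'(b) = b \<circ> S\<close>, although \<open>S'\<close> is
given only by its antipode equation (\<open>antipode_dual\<close>). Put \<open>G(c) = \<phi>(\<cdot> c)\<close>. Left invariance of
\<open>\<phi>\<close> shows that the Galois map of the dual sends \<open>(G \<otimes> G)(\<Delta>(r)(s \<otimes> 1))\<close> to \<open>G(s) \<otimes> G(r)\<close>
(\<open>dual_galois_R'\<close>). The counit and antipode equations of the dual therefore give
\<open>\<epsilon>'(G(s)) = \<phi>(s)\<close> and \<open>S'(G(s)) G(r) = \<phi>(r\<^sub>1 s) G(r\<^sub>2)\<close>, and the relation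
\<open>S(a\<^sub>1) \<phi>(a\<^sub>2 r) = r\<^sub>1 \<phi>(a r\<^sub>2)\<close> (\<open>left_integral_antipode\<close>) identifies \<open>S'(G(s))\<close>. The second fact
is that \<open>\<psi>(\<cdot> x)\<close> lies in the dual (\<open>translate_right_integral_in\<close>): apply \<open>\<psi> \<otimes> \<phi>\<close> to
\<open>\<Delta>(a) \<Delta>(x) (1 \<otimes> y)\<close> after writing \<open>\<Delta>(x)(1 \<otimes> y)\<close> as a sum of elements \<open>\<Delta>(p)(q \<otimes> 1)\<close>. Hence the
Fourier transform is \<open>x \<mapsto> S'(\<psi>(\<cdot> x))\<close>.

The Sweedler calculations in \<open>A\<close> have to be covered, because \<open>\<Delta>(a)\<close> is only a multiplier. They use the
elements \<open>R a b = \<Delta>(a)(1 \<otimes> b)\<close>, \<open>R' a b = \<Delta>(a)(b \<otimes> 1)\<close> and \<open>L a b = (a \<otimes> 1)\<Delta>(b)\<close> of \<open>A \<otimes> A\<close>.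
The two forms of coassociativity that the integrals need are proved after multiplication by an
element on each outer leg, which is then cancelled because the product is non-degenerate.\<close>

section \<open>Linear and bilinear maps on subspaces\<close>

lemma linear_onI:
  assumes "\<And>u v. u \<in> V \<Longrightarrow> v \<in> V \<Longrightarrow> f (u + v) = f u + f v"
    and "\<And>c v. v \<in> V \<Longrightarrow> f (c *\<^sub>C v) = c *\<^sub>C f v"
  shows "linear_on V f"
  using assms by (simp add: linear_on_def)

lemma linear_on_add: "linear_on V f \<Longrightarrow> u \<in> V \<Longrightarrow> v \<in> V \<Longrightarrow> f (u + v) = f u + f v"
  and linear_on_scale: "linear_on V f \<Longrightarrow> v \<in> V \<Longrightarrow> f (c *\<^sub>C v) = c *\<^sub>C f v"
  by (simp_all add: linear_on_def)

lemma linear_on_zero: "linear_on V f \<Longrightarrow> cvs.subspace V \<Longrightarrow> f 0 = 0"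
  using linear_on_scale[of V f 0 0] by (simp add: cvs.subspace_0)

lemma linear_on_diff:
  assumes "linear_on V f" "cvs.subspace V" "u \<in> V" "v \<in> V"
  shows "f (u - v) = f u - f v"
  using linear_on_add[OF assms(1) cvs.subspace_diff[OF assms(2-4)] assms(4)] by simp

lemma linear_on_sum:
  assumes "linear_on V f" "cvs.subspace V" "\<And>i. i \<in> I \<Longrightarrow> v i \<in> V"
  shows "f (\<Sum>i\<in>I. v i) = (\<Sum>i\<in>I. f (v i))"
  using assms(3)
proof (induction I rule: infinite_finite_induct)
  case (insert i I)
  then have "(\<Sum>i\<in>I. v i) \<in> V"
    by (intro cvs.subspace_sum[OF assms(2)]) auto
  with insert show ?case
    by (simp add: linear_on_add[OF assms(1)])
qed (simp_all add: linear_on_zero[OF assms(1,2)])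

lemma linear_on_cong:
  "linear_on V f \<Longrightarrow> cvs.subspace V \<Longrightarrow> (\<And>v. v \<in> V \<Longrightarrow> g v = f v) \<Longrightarrow> linear_on V g"
  by (simp add: linear_on_def cvs.subspace_add cvs.subspace_scale)

lemma linear_on_ident: "linear_on V (\<lambda>v. v)"
  by (simp add: linear_on_def)

lemma linear_on_compose:
  assumes "linear_on U g" "linear_on V f" "\<And>u. u \<in> U \<Longrightarrow> g u \<in> V"
  shows "linear_on U (\<lambda>u. f (g u))"
  using assms by (simp add: linear_on_def)

lemma linear_on_inv_into:
  assumes f: "linear_on V f" and V: "cvs.subspace V" and bij: "bij_betw f V V"
  shows "linear_on V (inv_into V f)"
proof -
  let ?g = "inv_into V f"
  have g: "?g v \<in> V" "f (?g v) = v" "?g (f v) = v" if "v \<in> V" for v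
    using that bij_betw_apply[OF bij_betw_inv_into[OF bij]] bij_betw_inv_into_right[OF bij]
      bij_betw_inv_into_left[OF bij] by auto
  show ?thesis
  proof (rule linear_onI)
    fix u v c assume uv: "u \<in> V" "v \<in> V"
    show "?g (u + v) = ?g u + ?g v"
      using uv g(3)[OF cvs.subspace_add[OF V g(1) g(1)], of u v] by (simp add: linear_on_add[OF f] g)
    show "?g (c *\<^sub>C v) = c *\<^sub>C ?g v"
      using uv g(3)[OF cvs.subspace_scale[OF V g(1)], of v c] by (simp add: linear_on_scale[OF f] g)
  qed
qed

lemma linear_on_mult_left: "linear_on U f \<Longrightarrow> linear_on U (\<lambda>u. f u * (c :: complex))"
  and linear_on_mult_right: "linear_on U f \<Longrightarrow> linear_on U (\<lambda>u. c * f u :: complex)"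
  by (simp_all add: linear_on_def scaleC_complex_def algebra_simps)

lemma linear_on_scaleC_left: "linear_on U f \<Longrightarrow> linear_on U (\<lambda>u. f u *\<^sub>C z)"
  and linear_on_scaleC_right: "linear_on U g \<Longrightarrow> linear_on U (\<lambda>u. c *\<^sub>C g u)"
  by (simp_all add: linear_on_def scaleC_complex_def scaleC_add_left scaleC_add_right scaleC_scaleC
      mult.commute)

lemma linear_on_tens_left: "linear_on U f \<Longrightarrow> linear_on U (\<lambda>u. f u \<otimes>\<^sub>t w)"
  and linear_on_tens_right: "linear_on U g \<Longrightarrow> linear_on U (\<lambda>u. v \<otimes>\<^sub>t g u)"
  by (simp_all add: linear_on_def tens_add_left tens_add_right tens_scale_left tens_scale_right)

lemma bilinear_onI:
  assumes "\<And>v. v \<in> V \<Longrightarrow> linear_on W (\<lambda>w. f v w)"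
    and "\<And>w. w \<in> W \<Longrightarrow> linear_on V (\<lambda>v. f v w)"
  shows "bilinear_on V W f"
  using assms by (simp add: bilinear_on_def)

lemma bilinear_on_left: "bilinear_on V W f \<Longrightarrow> w \<in> W \<Longrightarrow> linear_on V (\<lambda>v. f v w)"
  and bilinear_on_right: "bilinear_on V W f \<Longrightarrow> v \<in> V \<Longrightarrow> linear_on W (f v)"
  by (simp_all add: bilinear_on_def)

section \<open>Calculus of the universal property of the tensor product\<close>

lemma subspace_tensor_space: "cvs.subspace (tensor_space V W)"
  by (simp add: tensor_space_def cvs.subspace_span)

lemma tens_in: "v \<in> V \<Longrightarrow> w \<in> W \<Longrightarrow> v \<otimes>\<^sub>t w \<in> tensor_space V W"
  unfolding tensor_space_def by (rule cvs.span_base) blast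

lemma tensor_lift_cong:
  assumes "\<And>v w. v \<in> V \<Longrightarrow> w \<in> W \<Longrightarrow> f v w = g v w"
  shows "tensor_lift V W f t = tensor_lift V W g t"
  using assms by (simp add: tensor_lift_def)

lemma tensor_space_cases:
  assumes "t \<in> tensor_space V W" and V: "cvs.subspace V"
  obtains n :: nat and v w where "\<And>i. i < n \<Longrightarrow> v i \<in> V" "\<And>i. i < n \<Longrightarrow> w i \<in> W"
    "t = (\<Sum>i<n. v i \<otimes>\<^sub>t w i)"
proof -
  have "\<exists>n v w. (\<forall>i<n::nat. v i \<in> V \<and> w i \<in> W) \<and> t = (\<Sum>i<n. v i \<otimes>\<^sub>t w i)"
    using assms(1) unfolding tensor_space_def
  proof (induction rule: cvs.span_induct_alt)
    case base
    show ?case by (rule exI[of _ 0]) simp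
  next
    case (step c x y)
    then obtain n v w p q where "\<forall>i<n::nat. v i \<in> V \<and> w i \<in> W" "y = (\<Sum>i<n. v i \<otimes>\<^sub>t w i)"
      "p \<in> V" "q \<in> W" "x = p \<otimes>\<^sub>t q" by blast
    then show ?case
      by (intro exI[of _ "Suc n"] exI[of _ "v(n := c *\<^sub>C p)"] exI[of _ "w(n := q)"])
        (auto simp: less_Suc_eq tens_scale_left add.commute cvs.subspace_scale[OF V])
  qed
  then show thesis using that by blast
qed

lemma tensor_lift_in:
  assumes "cvs.subspace V" "cvs.subspace W" "cvs.subspace Z" "bilinear_on V W f"
    "\<And>v w. v \<in> V \<Longrightarrow> w \<in> W \<Longrightarrow> f v w \<in> Z" "t \<in> tensor_space V W"
  shows "tensor_lift V W f t \<in> Z"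
proof -
  obtain n :: nat and v w where t: "\<And>i. i < n \<Longrightarrow> v i \<in> V" "\<And>i. i < n \<Longrightarrow> w i \<in> W"
    "t = (\<Sum>i<n. v i \<otimes>\<^sub>t w i)" using tensor_space_cases[OF assms(6,1)] by blast
  have "tensor_lift V W f t = (\<Sum>i<n. f (v i) (w i))"
    unfolding t(3) using t(1,2)
    by (subst linear_on_sum[OF tensor_lift(1)[OF assms(1,2,4)] subspace_tensor_space])
      (auto simp: tens_in tensor_lift(2)[OF assms(1,2,4)])
  then show ?thesis
    using t assms(5) by (auto intro!: cvs.subspace_sum[OF assms(3)])
qed

text \<open>Functionals, multiplications and further tensor lifts are pulled through Sweedler sums with this
rule, in both directions.\<close>

lemma tensor_lift_out:
  assumes V: "cvs.subspace V" and W: "cvs.subspace W" and f: "bilinear_on V W f"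
    and L: "linear_on Z L" and fZ: "\<And>v w. v \<in> V \<Longrightarrow> w \<in> W \<Longrightarrow> f v w \<in> Z" and Z: "cvs.subspace Z"
    and t: "t \<in> tensor_space V W"
  shows "L (tensor_lift V W f t) = tensor_lift V W (\<lambda>v w. L (f v w)) t"
proof (rule tensor_lift_unique[OF _ _ _ t])
  have b: "bilinear_on V W (\<lambda>v w. L (f v w))"
    using f fZ by (intro bilinear_onI linear_on_compose[OF _ L])
      (auto simp: bilinear_on_left bilinear_on_right)
  show "linear_on (tensor_space V W) (tensor_lift V W (\<lambda>v w. L (f v w)))"
    by (rule tensor_lift(1)[OF V W b])
  show "linear_on (tensor_space V W) (\<lambda>t. L (tensor_lift V W f t))"
    by (rule linear_on_compose[OF tensor_lift(1)[OF V W f] L])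
      (rule tensor_lift_in[OF V W Z f fZ])
  show "L (tensor_lift V W f (v \<otimes>\<^sub>t w)) = tensor_lift V W (\<lambda>v w. L (f v w)) (v \<otimes>\<^sub>t w)"
    if "v \<in> V" "w \<in> W" for v w
    using that by (simp add: tensor_lift(2)[OF V W f] tensor_lift(2)[OF V W b])
qed

lemma tensor_lift_tens:
  assumes "cvs.subspace V" "cvs.subspace W" "t \<in> tensor_space V W"
  shows "tensor_lift V W (\<otimes>\<^sub>t) t = t"
proof (rule tensor_lift_unique[OF _ _ _ assms(3)])
  have b: "bilinear_on V W (\<otimes>\<^sub>t)"
    by (intro bilinear_onI linear_on_tens_left linear_on_tens_right linear_on_ident)
  show "linear_on (tensor_space V W) (tensor_lift V W (\<otimes>\<^sub>t))"
    by (rule tensor_lift(1)[OF assms(1,2) b])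
  show "tensor_lift V W (\<otimes>\<^sub>t) (v \<otimes>\<^sub>t w) = v \<otimes>\<^sub>t w" if "v \<in> V" "w \<in> W" for v w
    using that by (simp add: tensor_lift(2)[OF assms(1,2) b])
qed (rule linear_on_ident)

lemma linear_on_tensor_lift_map:
  assumes V: "cvs.subspace V" and W: "cvs.subspace W" and t: "t \<in> tensor_space V W"
    and f: "\<And>u. u \<in> U \<Longrightarrow> bilinear_on V W (f u)"
    and U: "cvs.subspace U" and l: "\<And>v w. v \<in> V \<Longrightarrow> w \<in> W \<Longrightarrow> linear_on U (\<lambda>u. f u v w)"
  shows "linear_on U (\<lambda>u. tensor_lift V W (f u) t)"
proof -
  obtain n :: nat and v w where t: "\<And>i. i < n \<Longrightarrow> v i \<in> V" "\<And>i. i < n \<Longrightarrow> w i \<in> W"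
    "t = (\<Sum>i<n. v i \<otimes>\<^sub>t w i)" using tensor_space_cases[OF t V] by blast
  have e: "tensor_lift V W (f u) t = (\<Sum>i<n. f u (v i) (w i))" if "u \<in> U" for u
    unfolding t(3) using t(1,2)
    by (subst linear_on_sum[OF tensor_lift(1)[OF V W f[OF that]] subspace_tensor_space])
      (auto simp: tens_in tensor_lift(2)[OF V W f[OF that]])
  have "linear_on U (\<lambda>u. \<Sum>i<n. f u (v i) (w i))"
    using l t(1,2) by (intro linear_onI)
      (simp_all add: linear_on_add[of U "\<lambda>u. f u _ _"] linear_on_scale[of U "\<lambda>u. f u _ _"]
        sum.distrib cvs.scale_sum_right)
  then show ?thesis
    by (rule linear_on_cong[OF _ U e])
qed

lemma linear_on_tensor_lift_arg:
  assumes "cvs.subspace V" "cvs.subspace W" "bilinear_on V W f" "linear_on U g"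
    "\<And>u. u \<in> U \<Longrightarrow> g u \<in> tensor_space V W"
  shows "linear_on U (\<lambda>u. tensor_lift V W f (g u))"
  using linear_on_compose[OF assms(4) tensor_lift(1)[OF assms(1-3)] assms(5)] .

lemma tensor_lift_swap:
  assumes V: "cvs.subspace V" and W: "cvs.subspace W" and V': "cvs.subspace V'" and W': "cvs.subspace W'"
    and t: "t \<in> tensor_space V W" and s: "s \<in> tensor_space V' W'"
    and f: "\<And>u v. u \<in> V \<Longrightarrow> v \<in> W \<Longrightarrow> bilinear_on V' W' (f u v)"
    and g: "\<And>p q. p \<in> V' \<Longrightarrow> q \<in> W' \<Longrightarrow> bilinear_on V W (\<lambda>u v. f u v p q)"
  shows "tensor_lift V W (\<lambda>u v. tensor_lift V' W' (f u v) s) t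
       = tensor_lift V' W' (\<lambda>p q. tensor_lift V W (\<lambda>u v. f u v p q) t) s"
proof (rule tensor_lift_unique[OF _ _ _ t])
  have b1: "bilinear_on V W (\<lambda>u v. tensor_lift V' W' (f u v) s)"
    by (intro bilinear_onI linear_on_tensor_lift_map[OF V' W' s] V W f
        bilinear_on_left[OF g] bilinear_on_right[OF g])
  show "linear_on (tensor_space V W) (tensor_lift V W (\<lambda>u v. tensor_lift V' W' (f u v) s))"
    by (rule tensor_lift(1)[OF V W b1])
  have b2: "bilinear_on V' W' (\<lambda>p q. tensor_lift V W (\<lambda>u v. f u v p q) t)" if "t \<in> tensor_space V W" for t
    by (intro bilinear_onI linear_on_tensor_lift_map[OF V W that] V' W' g
        bilinear_on_left[OF f] bilinear_on_right[OF f])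
  show "linear_on (tensor_space V W)
      (\<lambda>t. tensor_lift V' W' (\<lambda>p q. tensor_lift V W (\<lambda>u v. f u v p q) t) s)"
    by (intro linear_on_tensor_lift_map[OF V' W' s b2] subspace_tensor_space tensor_lift(1)[OF V W g])
  show "tensor_lift V W (\<lambda>u v. tensor_lift V' W' (f u v) s) (v \<otimes>\<^sub>t w)
      = tensor_lift V' W' (\<lambda>p q. tensor_lift V W (\<lambda>u v. f u v p q) (v \<otimes>\<^sub>t w)) s"
    if "v \<in> V" "w \<in> W" for v w
    using that by (simp add: tensor_lift(2)[OF V W b1] tensor_lift(2)[OF V W g] cong: tensor_lift_cong)
qed

section \<open>Functionals separate tensors\<close>

text \<open>Only finitely many basis vectors \<open>b\<close> occur in the second leg of \<open>t\<close>. Allowing every larger finite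
set \<open>K'\<close> makes the claim stable under sums, so that it follows by induction over the span of the
elementary tensors.\<close>

lemma tensor_coordinates:
  fixes t :: "('v::complex_vector, 'w::complex_vector) tensor"
  assumes V: "cvs.subspace V" and W: "cvs.subspace W" and t: "t \<in> tensor_space V W"
    and B: "cvs.independent B" "cvs.span B = UNIV"
  defines "coord b \<equiv> tensor_lift V W (\<lambda>v w. cvs.representation B w b *\<^sub>C v)"
  shows "\<exists>K. finite K \<and> (\<forall>K'. finite K' \<and> K \<subseteq> K' \<longrightarrow> t = (\<Sum>b\<in>K'. coord b t \<otimes>\<^sub>t b))"
proof -
  have bil: "bilinear_on V W (\<lambda>v w. cvs.representation B w b *\<^sub>C v)" for b
    using B by (intro bilinear_onI linear_on_scaleC_left linear_on_scaleC_right linear_on_ident linear_onI)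
      (simp_all add: cvs.representation_add cvs.representation_scale scaleC_complex_def)
  have lin: "linear_on (tensor_space V W) (coord b)" for b
    unfolding coord_def by (rule tensor_lift(1)[OF V W bil])
  have ct: "coord b (v \<otimes>\<^sub>t w) = cvs.representation B w b *\<^sub>C v" if "v \<in> V" "w \<in> W" for b v w
    unfolding coord_def using tensor_lift(2)[OF V W bil] that by blast
  have "t \<in> tensor_space V W \<and> ?thesis"
    using t unfolding tensor_space_def
  proof (induction rule: cvs.span_induct_alt)
    case base
    have "coord b 0 = 0" for b by (rule linear_on_zero[OF lin subspace_tensor_space])
    moreover have "0 \<otimes>\<^sub>t b = (0 :: ('v, 'w) tensor)" for b
      using tens_scale_left[of 0 0 b] by simp
    ultimately show ?case by (auto simp: cvs.span_zero)
  next
    case (step c x y)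
    from step(1) obtain v w where x: "x = v \<otimes>\<^sub>t w" "v \<in> V" "w \<in> W" by auto
    from step(2) have y: "y \<in> tensor_space V W" by (simp add: tensor_space_def)
    from step(2) obtain K where K: "finite K"
      "\<And>K'. finite K' \<Longrightarrow> K \<subseteq> K' \<Longrightarrow> y = (\<Sum>b\<in>K'. coord b y \<otimes>\<^sub>t b)"
      by metis
    let ?K = "K \<union> {b. cvs.representation B w b \<noteq> 0}"
    have xt: "x \<in> tensor_space V W" using x by (simp add: tens_in)
    then have cx: "c *\<^sub>C x \<in> tensor_space V W" by (rule cvs.subspace_scale[OF subspace_tensor_space])
    have "c *\<^sub>C x + y = (\<Sum>b\<in>K'. coord b (c *\<^sub>C x + y) \<otimes>\<^sub>t b)" if K': "finite K'" "?K \<subseteq> K'" for K'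
    proof -
      have "w = (\<Sum>b\<in>K'. cvs.representation B w b *\<^sub>C b)"
      proof -
        have "(\<Sum>b\<in>{b. cvs.representation B w b \<noteq> 0}. cvs.representation B w b *\<^sub>C b)
            = (\<Sum>b\<in>K'. cvs.representation B w b *\<^sub>C b)"
          using K' by (intro sum.mono_neutral_left) auto
        then show ?thesis
          using cvs.sum_nonzero_representation_eq[OF B(1), of w] B by simp
      qed
      then have "x = v \<otimes>\<^sub>t (\<Sum>b\<in>K'. cvs.representation B w b *\<^sub>C b)"
        using x by simp
      also have "\<dots> = (\<Sum>b\<in>K'. v \<otimes>\<^sub>t (cvs.representation B w b *\<^sub>C b))"
        using linear_on_sum[OF linear_on_tens_right[OF linear_on_ident[of UNIV]] cvs.subspace_UNIV] by simp
      also have "\<dots> = (\<Sum>b\<in>K'. coord b x \<otimes>\<^sub>t b)"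
        using x by (simp add: ct tens_scale_left tens_scale_right)
      finally have 1: "x = (\<Sum>b\<in>K'. coord b x \<otimes>\<^sub>t b)" .
      have 2: "y = (\<Sum>b\<in>K'. coord b y \<otimes>\<^sub>t b)" using K' by (intro K(2)) auto
      have "(\<Sum>b\<in>K'. coord b (c *\<^sub>C x + y) \<otimes>\<^sub>t b)
          = c *\<^sub>C (\<Sum>b\<in>K'. coord b x \<otimes>\<^sub>t b) + (\<Sum>b\<in>K'. coord b y \<otimes>\<^sub>t b)"
        by (simp add: linear_on_add[OF lin cx y] linear_on_scale[OF lin xt] tens_add_left
            tens_scale_left sum.distrib cvs.scale_sum_right)
      then show ?thesis using 1 2 by simp
    qed
    moreover have "finite ?K" using K(1) cvs.finite_representation by auto
    moreover have "c *\<^sub>C x + y \<in> tensor_space V W"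
      by (rule cvs.subspace_add[OF subspace_tensor_space cx y])
    ultimately show ?case unfolding tensor_space_def[symmetric] by (intro conjI exI[of _ ?K]) auto
  qed
  then show ?thesis by blast
qed

lemma tensor_eq_0_if_slices:
  assumes V: "cvs.subspace V" and W: "cvs.subspace W" and t: "t \<in> tensor_space V W"
    and 0: "\<And>\<omega>. linear_on W \<omega> \<Longrightarrow> tensor_lift V W (\<lambda>v w. \<omega> w *\<^sub>C v) t = 0"
  shows "t = 0"
proof -
  define B :: "'b set" where "B = cvs.extend_basis {}"
  have B: "cvs.independent B" "cvs.span B = UNIV"
    unfolding B_def by (auto simp: cvs.independent_extend_basis cvs.span_extend_basis cvs.independent_empty)
  have "linear_on W (\<lambda>w. cvs.representation B w b)" for b
    using B by (intro linear_onI)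
      (simp_all add: cvs.representation_add cvs.representation_scale scaleC_complex_def)
  then have c: "tensor_lift V W (\<lambda>v w. cvs.representation B w b *\<^sub>C v) t = 0" for b
    by (rule 0)
  have "0 \<otimes>\<^sub>t b = (0 :: ('a, 'b) tensor)" for b
    using tens_scale_left[of 0 0 b] by simp
  then show ?thesis
    using tensor_coordinates[OF V W t B] by (auto simp: c)
qed

lemma functionals_separate:
  fixes v :: "'v::complex_vector"
  assumes "\<And>\<omega> :: 'v \<Rightarrow> complex. linear_on UNIV \<omega> \<Longrightarrow> \<omega> v = 0"
  shows "v = 0"
proof -
  define B :: "'v set" where "B = cvs.extend_basis {}"
  have B: "cvs.independent B" "cvs.span B = UNIV"
    unfolding B_def by (auto simp: cvs.independent_extend_basis cvs.span_extend_basis cvs.independent_empty)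
  have "cvs.representation B v b = 0" for b
    using B by (intro assms[of "\<lambda>v. cvs.representation B v b"] linear_onI)
      (simp_all add: cvs.representation_add cvs.representation_scale scaleC_complex_def)
  then show ?thesis
    using cvs.sum_nonzero_representation_eq[OF B(1), of v] B by simp
qed

text \<open>Let \<open>\<alpha>\<close> be any functional on \<open>V\<close>. The slices of \<open>t\<close> by elements of \<open>\<B>\<close> are killed by \<open>\<A>\<close> and
vanish; so the slice of \<open>t\<close> by \<open>\<alpha>\<close> is killed by \<open>\<B>\<close> and vanishes as well. Since \<open>\<alpha>\<close> was arbitrary,
all slices of \<open>t\<close> are zero.\<close>

lemma tensor_eq_0_if_functionals:
  fixes t :: "('a::complex_vector, 'b::complex_vector) tensor"
  assumes V: "cvs.subspace V" and W: "cvs.subspace W" and t: "t \<in> tensor_space V W"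
    and \<A>: "\<And>\<alpha>. \<alpha> \<in> \<A> \<Longrightarrow> linear_on V \<alpha>" "\<And>v. v \<in> V \<Longrightarrow> (\<And>\<alpha>. \<alpha> \<in> \<A> \<Longrightarrow> \<alpha> v = (0::complex)) \<Longrightarrow> v = 0"
    and \<B>: "\<And>\<beta>. \<beta> \<in> \<B> \<Longrightarrow> linear_on W \<beta>" "\<And>w. w \<in> W \<Longrightarrow> (\<And>\<beta>. \<beta> \<in> \<B> \<Longrightarrow> \<beta> w = (0::complex)) \<Longrightarrow> w = 0"
    and 0: "\<And>\<alpha> \<beta>. \<alpha> \<in> \<A> \<Longrightarrow> \<beta> \<in> \<B> \<Longrightarrow> tensor_lift V W (\<lambda>v w. \<alpha> v * \<beta> w) t = 0"
  shows "t = 0"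
proof -
  have prod: "tensor_lift V W (\<lambda>v w. \<alpha> v * \<beta> w) t = \<alpha> (tensor_lift V W (\<lambda>v w. \<beta> w *\<^sub>C v) t)"
    "tensor_lift V W (\<lambda>v w. \<alpha> v * \<beta> w) t = \<beta> (tensor_lift V W (\<lambda>v w. \<alpha> v *\<^sub>C w) t)"
    and in_V: "tensor_lift V W (\<lambda>v w. \<beta> w *\<^sub>C v) t \<in> V"
    and in_W: "tensor_lift V W (\<lambda>v w. \<alpha> v *\<^sub>C w) t \<in> W"
    if ab: "linear_on V \<alpha>" "linear_on W \<beta>" for \<alpha> :: "'a \<Rightarrow> complex" and \<beta> :: "'b \<Rightarrow> complex"
  proof -
    have b: "bilinear_on V W (\<lambda>v w. \<beta> w *\<^sub>C v)" "bilinear_on V W (\<lambda>v w. \<alpha> v *\<^sub>C w)"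
      using ab by (auto intro!: bilinear_onI linear_on_scaleC_left linear_on_scaleC_right linear_on_ident)
    have "\<alpha> (tensor_lift V W (\<lambda>v w. \<beta> w *\<^sub>C v) t) = tensor_lift V W (\<lambda>v w. \<alpha> (\<beta> w *\<^sub>C v)) t"
      by (rule tensor_lift_out[OF V W b(1) ab(1) _ V t]) (simp add: cvs.subspace_scale[OF V])
    also have "\<dots> = tensor_lift V W (\<lambda>v w. \<alpha> v * \<beta> w) t"
      by (rule tensor_lift_cong) (simp add: linear_on_scale[OF ab(1)] scaleC_complex_def)
    finally show "tensor_lift V W (\<lambda>v w. \<alpha> v * \<beta> w) t = \<alpha> (tensor_lift V W (\<lambda>v w. \<beta> w *\<^sub>C v) t)" by simp
    have "\<beta> (tensor_lift V W (\<lambda>v w. \<alpha> v *\<^sub>C w) t) = tensor_lift V W (\<lambda>v w. \<beta> (\<alpha> v *\<^sub>C w)) t"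
      by (rule tensor_lift_out[OF V W b(2) ab(2) _ W t]) (simp add: cvs.subspace_scale[OF W])
    also have "\<dots> = tensor_lift V W (\<lambda>v w. \<alpha> v * \<beta> w) t"
      by (rule tensor_lift_cong) (simp add: linear_on_scale[OF ab(2)] scaleC_complex_def)
    finally show "tensor_lift V W (\<lambda>v w. \<alpha> v * \<beta> w) t = \<beta> (tensor_lift V W (\<lambda>v w. \<alpha> v *\<^sub>C w) t)" by simp
    show "tensor_lift V W (\<lambda>v w. \<beta> w *\<^sub>C v) t \<in> V"
      by (rule tensor_lift_in[OF V W V b(1) _ t]) (simp add: cvs.subspace_scale[OF V])
    show "tensor_lift V W (\<lambda>v w. \<alpha> v *\<^sub>C w) t \<in> W"
      by (rule tensor_lift_in[OF V W W b(2) _ t]) (simp add: cvs.subspace_scale[OF W])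
  qed
  have z: "linear_on V (\<lambda>_. 0 :: complex)" "linear_on W (\<lambda>_. 0 :: complex)"
    by (simp_all add: linear_on_def)
  have s1: "tensor_lift V W (\<lambda>v w. \<beta> w *\<^sub>C v) t = 0" if "\<beta> \<in> \<B>" for \<beta>
  proof (rule \<A>(2))
    show "tensor_lift V W (\<lambda>v w. \<beta> w *\<^sub>C v) t \<in> V" by (rule in_V[OF z(1) \<B>(1)[OF that]])
    show "\<alpha> (tensor_lift V W (\<lambda>v w. \<beta> w *\<^sub>C v) t) = 0" if a: "\<alpha> \<in> \<A>" for \<alpha>
      using prod(1)[OF \<A>(1)[OF a] \<B>(1)[OF \<open>\<beta> \<in> \<B>\<close>]] 0[OF a \<open>\<beta> \<in> \<B>\<close>] by simp
  qed
  have s2: "tensor_lift V W (\<lambda>v w. \<alpha> v *\<^sub>C w) t = 0" if a: "linear_on V \<alpha>" for \<alpha> :: "'a \<Rightarrow> complex"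
  proof (rule \<B>(2))
    show "tensor_lift V W (\<lambda>v w. \<alpha> v *\<^sub>C w) t \<in> W" by (rule in_W[OF a z(2)])
    fix \<beta> assume "\<beta> \<in> \<B>"
    then show "\<beta> (tensor_lift V W (\<lambda>v w. \<alpha> v *\<^sub>C w) t) = 0"
      using prod[OF a \<B>(1)] s1 linear_on_zero[OF a V] by simp
  qed
  show ?thesis
  proof (rule tensor_eq_0_if_slices[OF V W t])
    fix \<omega> :: "'b \<Rightarrow> complex" assume w: "linear_on W \<omega>"
    show "tensor_lift V W (\<lambda>v w. \<omega> w *\<^sub>C v) t = 0"
    proof (rule functionals_separate)
      fix \<alpha> :: "'a \<Rightarrow> complex" assume "linear_on UNIV \<alpha>"
      then have a: "linear_on V \<alpha>" by (simp add: linear_on_def)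
      show "\<alpha> (tensor_lift V W (\<lambda>v w. \<omega> w *\<^sub>C v) t) = 0"
        using prod[OF a w] s2[OF a] linear_on_zero[OF w W] by simp
    qed
  qed
qed

section \<open>The tensor square of a non-degenerate algebra\<close>

locale nondegenerate_algebra =
  fixes A :: "'a::complex_vector alg" (structure)
  assumes nondeg: "nondeg_algebra A"
begin

text \<open>Throughout, \<open>sw t f\<close> is to be read as the Sweedler sum of \<open>f t\<^sub>1 t\<^sub>2\<close>: for example,
\<open>sw t (\<lambda>u v. u \<cdot> v)\<close> multiplies the two legs of \<open>t\<close>.\<close>

abbreviation V where "V \<equiv> carr A"
abbreviation VV where "VV \<equiv> tensor_space V V"
abbreviation lin where "lin f \<equiv> linear_on V f"
abbreviation bil where "bil f \<equiv> bilinear_on V V f"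
abbreviation sw where "sw t f \<equiv> tensor_lift V V f t"

lemma subspace_carrier: "cvs.subspace V"
  and mul_in: "a \<in> V \<Longrightarrow> b \<in> V \<Longrightarrow> a \<cdot> b \<in> V"
  and mul_bilinear: "bil (\<lambda>a b. a \<cdot> b)"
  and mul_assoc: "a \<in> V \<Longrightarrow> b \<in> V \<Longrightarrow> c \<in> V \<Longrightarrow> a \<cdot> b \<cdot> c = a \<cdot> (b \<cdot> c)"
  using nondeg by (auto simp: nondeg_algebra_def)

lemma eq_0_if_right_mul_0: "a \<in> V \<Longrightarrow> (\<And>b. b \<in> V \<Longrightarrow> a \<cdot> b = 0) \<Longrightarrow> a = 0"
  and eq_0_if_left_mul_0: "a \<in> V \<Longrightarrow> (\<And>b. b \<in> V \<Longrightarrow> b \<cdot> a = 0) \<Longrightarrow> a = 0"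
  using nondeg unfolding nondeg_algebra_def by metis+

lemma lin_mul_left: "linear_on U f \<Longrightarrow> (\<And>u. u \<in> U \<Longrightarrow> f u \<in> V) \<Longrightarrow> c \<in> V \<Longrightarrow> linear_on U (\<lambda>u. f u \<cdot> c)"
  and lin_mul_right: "linear_on U f \<Longrightarrow> (\<And>u. u \<in> U \<Longrightarrow> f u \<in> V) \<Longrightarrow> c \<in> V \<Longrightarrow> linear_on U (\<lambda>u. c \<cdot> f u)"
  by (rule linear_on_compose[OF _ bilinear_on_left[OF mul_bilinear]]
      linear_on_compose[OF _ bilinear_on_right[OF mul_bilinear]]; assumption)+

lemma bil_compose_left:
  "bil f \<Longrightarrow> linear_on U g \<Longrightarrow> (\<And>u. u \<in> U \<Longrightarrow> g u \<in> V) \<Longrightarrow> v \<in> V \<Longrightarrow> linear_on U (\<lambda>u. f (g u) v)"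
  by (rule linear_on_compose[OF _ bilinear_on_left])

lemma bil_compose_right:
  "bil f \<Longrightarrow> linear_on U g \<Longrightarrow> (\<And>u. u \<in> U \<Longrightarrow> g u \<in> V) \<Longrightarrow> v \<in> V \<Longrightarrow> linear_on U (\<lambda>u. f v (g u))"
  by (rule linear_on_compose[OF _ bilinear_on_right])

lemmas lin_sw_arg = linear_on_tensor_lift_arg[OF subspace_carrier subspace_carrier]
lemmas lin_sw_map = linear_on_tensor_lift_map[OF subspace_carrier subspace_carrier]
lemmas sw_in_tensor = tensor_lift_in[OF subspace_carrier subspace_carrier subspace_tensor_space]
lemmas sw_in_carrier = tensor_lift_in[OF subspace_carrier subspace_carrier subspace_carrier]
lemmas sw_tens = tensor_lift(2)[OF subspace_carrier subspace_carrier]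
lemmas sw_linear = tensor_lift(1)[OF subspace_carrier subspace_carrier]
lemmas sw_ident = tensor_lift_tens[OF subspace_carrier subspace_carrier]
lemmas sw_out = tensor_lift_out[OF subspace_carrier subspace_carrier]
lemmas sw_swap = tensor_lift_swap[OF subspace_carrier subspace_carrier subspace_carrier subspace_carrier]
lemmas sw_cases = tensor_space_cases[OF _ subspace_carrier]

text \<open>Introduction rules that discharge the linearity and bilinearity conditions of the Sweedler rules.\<close>

lemmas multilinear = bilinear_onI linear_on_ident linear_on_tens_left linear_on_tens_right
  linear_on_scaleC_left linear_on_scaleC_right linear_on_mult_left linear_on_mult_right
  lin_mul_left lin_mul_right lin_sw_arg lin_sw_map subspace_carrier subspace_tensor_space
  mul_in tens_in

lemma sw_sw:
  assumes "bil g" "\<And>u v. u \<in> V \<Longrightarrow> v \<in> V \<Longrightarrow> g u v \<in> VV" "bil f" "t \<in> VV"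
  shows "sw (sw t g) f = sw t (\<lambda>u v. sw (g u v) f)"
  by (rule sw_out[OF assms(1) sw_linear[OF assms(3)] assms(2) subspace_tensor_space assms(4)])

text \<open>Right multiplication by \<open>p \<otimes> q\<close> in \<open>A \<otimes> A\<close>.\<close>

definition rmul where "rmul p q t = sw t (\<lambda>u v. (u \<cdot> p) \<otimes>\<^sub>t (v \<cdot> q))"

lemma rmul_bil: "p \<in> V \<Longrightarrow> q \<in> V \<Longrightarrow> bil (\<lambda>u v. (u \<cdot> p) \<otimes>\<^sub>t (v \<cdot> q))"
  by (intro multilinear)

lemma rmul_linear: "p \<in> V \<Longrightarrow> q \<in> V \<Longrightarrow> linear_on VV (rmul p q)"
  unfolding rmul_def by (intro multilinear)

lemma rmul_tens: "p \<in> V \<Longrightarrow> q \<in> V \<Longrightarrow> u \<in> V \<Longrightarrow> v \<in> V \<Longrightarrow> rmul p q (u \<otimes>\<^sub>t v) = (u \<cdot> p) \<otimes>\<^sub>t (v \<cdot> q)"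
  unfolding rmul_def by (simp add: sw_tens[OF rmul_bil])

text \<open>The functionals \<open>\<omega>(\<cdot> p)\<close> separate the points of \<open>A\<close> because its product is non-degenerate, and
products of separating families separate the points of \<open>A \<otimes> A\<close>.\<close>

lemma tensor_nondegenerate:
  assumes t: "t \<in> VV" and 0: "\<And>p q. p \<in> V \<Longrightarrow> q \<in> V \<Longrightarrow> rmul p q t = 0"
  shows "t = 0"
proof -
  let ?F = "{\<lambda>u. \<omega> (u \<cdot> p) | \<omega> p. linear_on UNIV \<omega> \<and> p \<in> V} :: ('a \<Rightarrow> complex) set"
  have lin: "linear_on V \<alpha>" if "\<alpha> \<in> ?F" for \<alpha>
  proof -
    from that obtain \<omega> p where "linear_on UNIV \<omega>" "p \<in> V" "\<alpha> = (\<lambda>u. \<omega> (u \<cdot> p))" by blast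
    then show ?thesis
      by (simp, intro linear_on_compose[of V _ UNIV \<omega>] lin_mul_left linear_on_ident UNIV_I)
  qed
  have sep: "v = 0" if v: "v \<in> V" and zero: "\<And>\<alpha>. \<alpha> \<in> ?F \<Longrightarrow> \<alpha> v = 0" for v
  proof (rule eq_0_if_right_mul_0[OF v])
    fix p assume "p \<in> V"
    then have "\<omega> (v \<cdot> p) = 0" if "linear_on UNIV \<omega>" for \<omega> :: "'a \<Rightarrow> complex"
      using zero[of "\<lambda>u. \<omega> (u \<cdot> p)"] that by blast
    then show "v \<cdot> p = 0"
      by (rule functionals_separate)
  qed
  have "sw t (\<lambda>v w. \<alpha> v * \<beta> w) = 0" if ab: "\<alpha> \<in> ?F" "\<beta> \<in> ?F" for \<alpha> \<beta>
  proof -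
    obtain \<omega> p \<omega>' q where *: "linear_on UNIV \<omega>" "linear_on UNIV \<omega>'" "p \<in> V" "q \<in> V"
      "\<alpha> = (\<lambda>u. \<omega> (u \<cdot> p))" "\<beta> = (\<lambda>u. \<omega>' (u \<cdot> q))"
      using ab by auto
    then have l: "lin \<omega>" "lin \<omega>'" by (auto simp: linear_on_def)
    then have b: "bil (\<lambda>x y. \<omega> x * \<omega>' y)" by (intro multilinear)
    have "sw (rmul p q t) (\<lambda>x y. \<omega> x * \<omega>' y) = sw t (\<lambda>u v. sw ((u \<cdot> p) \<otimes>\<^sub>t (v \<cdot> q)) (\<lambda>x y. \<omega> x * \<omega>' y))"
      unfolding rmul_def using *(3,4) by (intro sw_sw rmul_bil b t tens_in mul_in)
    also have "\<dots> = sw t (\<lambda>v w. \<alpha> v * \<beta> w)"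
      using * by (intro tensor_lift_cong) (simp add: sw_tens[OF b] mul_in)
    finally show ?thesis
      using 0[OF *(3,4)] linear_on_zero[OF sw_linear[OF b] subspace_tensor_space] by simp
  qed
  then show ?thesis
    by (intro tensor_eq_0_if_functionals[OF subspace_carrier subspace_carrier t lin sep lin sep]) blast+
qed

lemma tensor_eqI:
  assumes s: "s \<in> VV" and t: "t \<in> VV" and e: "\<And>p q. p \<in> V \<Longrightarrow> q \<in> V \<Longrightarrow> rmul p q s = rmul p q t"
  shows "s = t"
proof -
  have "s - t \<in> VV" by (rule cvs.subspace_diff[OF subspace_tensor_space s t])
  moreover have "rmul p q (s - t) = 0" if "p \<in> V" "q \<in> V" for p q
    using linear_on_diff[OF rmul_linear[OF that] subspace_tensor_space s t] e[OF that] by simp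
  ultimately show ?thesis using tensor_nondegenerate[of "s - t"] by simp
qed

lemma tensor_mul_tens:
  assumes "s \<in> VV" "p \<in> V" "q \<in> V"
  shows "s \<cdot>\<^bsub>A \<otimes>\<^sub>a A\<^esub> (p \<otimes>\<^sub>t q) = rmul p q s"
  unfolding alg_tensor_def rmul_def using assms
  by (simp, intro tensor_lift_cong sw_tens multilinear)

lemma carr_tensor: "carr (A \<otimes>\<^sub>a A) = VV"
  by (simp add: alg_tensor_def)

lemma tensor_mul_bil: "a \<in> V \<Longrightarrow> c \<in> V \<Longrightarrow> bil (\<lambda>a' c'. (a \<cdot> a') \<otimes>\<^sub>t (c \<cdot> c'))"
  by (intro multilinear)

lemma tensor_mul_bil': "t \<in> VV \<Longrightarrow> bil (\<lambda>a c. sw t (\<lambda>a' c'. (a \<cdot> a') \<otimes>\<^sub>t (c \<cdot> c')))"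
  by (intro multilinear)

lemma fst_embed_tens:
  "s \<in> VV \<Longrightarrow> p \<in> V \<Longrightarrow> q \<in> V \<Longrightarrow> fst (embed (A \<otimes>\<^sub>a A) s) (p \<otimes>\<^sub>t q) = rmul p q s"
  by (simp add: embed_def ext0_def carr_tensor tens_in tensor_mul_tens)

lemma inj_on_embed_tensor: "inj_on (embed (A \<otimes>\<^sub>a A)) VV"
  by (rule inj_onI, rule tensor_eqI) (auto simp: fst_embed_tens[symmetric])

lemma fst_leg:
  assumes "b \<in> V" "t \<in> VV"
  shows "fst (leg1 A b) t = sw t (\<lambda>u v. (b \<cdot> u) \<otimes>\<^sub>t v)"
    and "fst (leg2 A b) t = sw t (\<lambda>u v. u \<otimes>\<^sub>t (b \<cdot> v))"
    and "snd (leg1 A b) t = sw t (\<lambda>u v. (u \<cdot> b) \<otimes>\<^sub>t v)"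
    and "snd (leg2 A b) t = sw t (\<lambda>u v. u \<otimes>\<^sub>t (v \<cdot> b))"
  using assms
  by (auto simp: leg1_def leg2_def mult_tensor_def mult_one_def embed_def ext0_def carr_tensor
      tensor_map_def intro!: tensor_lift_cong)

end

section \<open>Covered coproducts\<close>

locale regular_mha =
  fixes A :: "'a::complex_vector alg" (structure) and \<Delta> :: "'a comult"
  assumes rmha: "regular_multiplier_hopf_algebra A \<Delta>"

sublocale regular_mha \<subseteq> nondegenerate_algebra A
  using rmha by unfold_locales (simp add: regular_multiplier_hopf_algebra_def)

context regular_mha
begin

abbreviation D where "D a \<equiv> fst (\<Delta> a)"
abbreviation R where "R a b \<equiv> comult_r A \<Delta> a b"
abbreviation L where "L a b \<equiv> comult_l A \<Delta> a b"
definition R' where "R' a b = unembed (A \<otimes>\<^sub>a A) (\<Delta> a \<cdot>\<^bsub>mult_alg2 A\<^esub> leg1 A b)"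

lemma comult_hom: "alg_hom A (mult_alg2 A) \<Delta>"
  using rmha by (simp add: regular_multiplier_hopf_algebra_def)

lemma unembed_in_alg:
  assumes "in_alg (A \<otimes>\<^sub>a A) x"
  shows "unembed (A \<otimes>\<^sub>a A) x \<in> VV" "embed (A \<otimes>\<^sub>a A) (unembed (A \<otimes>\<^sub>a A) x) = x"
  using assms unfolding in_alg_def unembed_def carr_tensor
  by (auto intro: inv_into_into f_inv_into_f)

lemma covered:
  assumes "a \<in> V" "b \<in> V"
  shows "in_alg (A \<otimes>\<^sub>a A) (\<Delta> a \<cdot>\<^bsub>mult_alg2 A\<^esub> leg2 A b)"
    and "in_alg (A \<otimes>\<^sub>a A) (leg1 A a \<cdot>\<^bsub>mult_alg2 A\<^esub> \<Delta> b)"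
    and "in_alg (A \<otimes>\<^sub>a A) (\<Delta> a \<cdot>\<^bsub>mult_alg2 A\<^esub> leg1 A b)"
  using rmha assms by (simp_all add: regular_multiplier_hopf_algebra_def)

lemma R_in: "a \<in> V \<Longrightarrow> b \<in> V \<Longrightarrow> R a b \<in> VV"
  and L_in: "a \<in> V \<Longrightarrow> b \<in> V \<Longrightarrow> L a b \<in> VV"
  and R'_in: "a \<in> V \<Longrightarrow> b \<in> V \<Longrightarrow> R' a b \<in> VV"
  unfolding comult_r_def comult_l_def R'_def
  by (rule unembed_in_alg(1)[OF covered(1)] unembed_in_alg(1)[OF covered(2)]
      unembed_in_alg(1)[OF covered(3)]; assumption)+

lemma D_multiplier:
  assumes "a \<in> V"
  shows "linear_on VV (D a)" "t \<in> VV \<Longrightarrow> D a t \<in> VV"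
    "s \<in> VV \<Longrightarrow> t \<in> VV \<Longrightarrow> D a (s \<cdot>\<^bsub>A \<otimes>\<^sub>a A\<^esub> t) = D a s \<cdot>\<^bsub>A \<otimes>\<^sub>a A\<^esub> t"
proof -
  have "\<Delta> a \<in> multipliers (A \<otimes>\<^sub>a A)"
    using comult_hom assms by (simp add: alg_hom_def mult_alg_def)
  then obtain l r where "\<Delta> a = (l, r)" "(l, r) \<in> multipliers (A \<otimes>\<^sub>a A)"
    by (cases "\<Delta> a") auto
  then show "linear_on VV (D a)" "t \<in> VV \<Longrightarrow> D a t \<in> VV"
    "s \<in> VV \<Longrightarrow> t \<in> VV \<Longrightarrow> D a (s \<cdot>\<^bsub>A \<otimes>\<^sub>a A\<^esub> t) = D a s \<cdot>\<^bsub>A \<otimes>\<^sub>a A\<^esub> t"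
    by (simp_all add: multipliers_def carr_tensor)
qed

lemmas D_in = D_multiplier(2)

lemma D_rmul:
  assumes "a \<in> V" "t \<in> VV" "p \<in> V" "q \<in> V"
  shows "D a (rmul p q t) = rmul p q (D a t)"
  using assms by (simp add: tensor_mul_tens[symmetric] D_in D_multiplier(3) tens_in)

lemma D_mul: "a \<in> V \<Longrightarrow> b \<in> V \<Longrightarrow> D (a \<cdot> b) t = D a (D b t)"
  using comult_hom by (simp add: alg_hom_def mult_alg_def)

lemma D_linear: "linear_on V (\<lambda>a. D a t)"
  using comult_hom by (simp add: alg_hom_def linear_on_def scaleC_prod_def scaleC_fun_def)

text \<open>Multiplication by \<open>p \<otimes> q\<close> expresses each covered coproduct by the left multiplier \<open>D a\<close>. Identities
between covered coproducts are reduced in this way to the multiplicativity of \<open>D\<close>; \<open>tensor_eqI\<close> then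
cancels \<open>p \<otimes> q\<close>.\<close>

lemma R_rmul: "a \<in> V \<Longrightarrow> b \<in> V \<Longrightarrow> p \<in> V \<Longrightarrow> q \<in> V \<Longrightarrow> rmul p q (R a b) = D a (p \<otimes>\<^sub>t (b \<cdot> q))"
  and R'_rmul: "a \<in> V \<Longrightarrow> b \<in> V \<Longrightarrow> p \<in> V \<Longrightarrow> q \<in> V \<Longrightarrow> rmul p q (R' a b) = D a ((b \<cdot> p) \<otimes>\<^sub>t q)"
  and L_rmul: "a \<in> V \<Longrightarrow> b \<in> V \<Longrightarrow> p \<in> V \<Longrightarrow> q \<in> V \<Longrightarrow>
    rmul p q (L a b) = sw (D b (p \<otimes>\<^sub>t q)) (\<lambda>u v. (a \<cdot> u) \<otimes>\<^sub>t v)"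
proof -
  have b1: "bil (\<lambda>u v. u \<otimes>\<^sub>t (b \<cdot> v))" "bil (\<lambda>u v. (b \<cdot> u) \<otimes>\<^sub>t v)" if "b \<in> V" for b
    by (intro multilinear that | assumption)+
  assume *: "a \<in> V" "b \<in> V" "p \<in> V" "q \<in> V"
  show "rmul p q (R a b) = D a (p \<otimes>\<^sub>t (b \<cdot> q))"
    unfolding fst_embed_tens[OF R_in[OF *(1,2)] *(3,4), symmetric] unfolding comult_r_def
      unfolding unembed_in_alg(2)[OF covered(1)[OF *(1,2)]]
    using * by (simp add: mult_alg_def fst_leg tens_in sw_tens[OF b1(1)])
  show "rmul p q (R' a b) = D a ((b \<cdot> p) \<otimes>\<^sub>t q)"
    unfolding fst_embed_tens[OF R'_in[OF *(1,2)] *(3,4), symmetric] unfolding R'_def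
      unfolding unembed_in_alg(2)[OF covered(3)[OF *(1,2)]]
    using * by (simp add: mult_alg_def fst_leg tens_in sw_tens[OF b1(2)])
  show "rmul p q (L a b) = sw (D b (p \<otimes>\<^sub>t q)) (\<lambda>u v. (a \<cdot> u) \<otimes>\<^sub>t v)"
    unfolding fst_embed_tens[OF L_in[OF *(1,2)] *(3,4), symmetric] unfolding comult_l_def
      unfolding unembed_in_alg(2)[OF covered(2)[OF *(1,2)]]
    using * by (simp add: mult_alg_def fst_leg D_in tens_in)
qed

lemma linear_on_tensorI:
  assumes U: "cvs.subspace U" and "\<And>u. u \<in> U \<Longrightarrow> f u \<in> VV"
    and l: "\<And>p q. p \<in> V \<Longrightarrow> q \<in> V \<Longrightarrow> linear_on U (\<lambda>u. rmul p q (f u))"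
  shows "linear_on U f"
proof (rule linear_onI)
  fix u v c assume u: "u \<in> U" and v: "v \<in> U"
  show "f (u + v) = f u + f v"
  proof (rule tensor_eqI)
    show "f (u + v) \<in> VV" by (intro assms(2) cvs.subspace_add[OF U] u v)
    show "f u + f v \<in> VV" by (intro assms(2) cvs.subspace_add[OF subspace_tensor_space] u v)
    show "rmul p q (f (u + v)) = rmul p q (f u + f v)" if "p \<in> V" "q \<in> V" for p q
      using linear_on_add[OF l[OF that] u v]
        linear_on_add[OF rmul_linear[OF that] assms(2)[OF u] assms(2)[OF v]] by simp
  qed
  show "f (c *\<^sub>C v) = c *\<^sub>C f v"
  proof (rule tensor_eqI)
    show "f (c *\<^sub>C v) \<in> VV" by (intro assms(2) cvs.subspace_scale[OF U] v)
    show "c *\<^sub>C f v \<in> VV" by (intro assms(2) cvs.subspace_scale[OF subspace_tensor_space] v)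
    show "rmul p q (f (c *\<^sub>C v)) = rmul p q (c *\<^sub>C f v)" if "p \<in> V" "q \<in> V" for p q
      using linear_on_scale[OF l[OF that] v] linear_on_scale[OF rmul_linear[OF that] assms(2)[OF v]]
      by simp
  qed
qed

lemma R_bilinear: "bil (\<lambda>a b. R a b)"
  and R'_bilinear: "bil (\<lambda>a b. R' a b)"
  and L_bilinear: "bil (\<lambda>a b. L a b)"
proof -
  have b: "bil (\<lambda>u v. (a \<cdot> u) \<otimes>\<^sub>t v)" if "a \<in> V" for a
    using that by (intro multilinear)
  have D: "linear_on U (\<lambda>u. D a (f u))" if "a \<in> V" "linear_on U f" "\<And>u. u \<in> U \<Longrightarrow> f u \<in> VV" for a U and f :: "'a \<Rightarrow> _"
    using linear_on_compose[OF that(2) D_multiplier(1)[OF that(1)] that(3)] .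
  show "bil (\<lambda>a b. R a b)"
  proof (rule bilinear_onI; rule linear_on_tensorI[OF subspace_carrier]; (rule R_in; assumption)?)
    show "linear_on V (\<lambda>u. rmul p q (R v u))" if "p \<in> V" "q \<in> V" "v \<in> V" for p q v
      by (rule linear_on_cong[OF D[OF that(3)] subspace_carrier R_rmul[OF that(3) _ that(1,2)]])
        (intro multilinear that | assumption)+
    show "linear_on V (\<lambda>u. rmul p q (R u v))" if "p \<in> V" "q \<in> V" "v \<in> V" for p q v
      by (rule linear_on_cong[OF D_linear subspace_carrier R_rmul[OF _ that(3,1,2)]])
  qed
  show "bil (\<lambda>a b. R' a b)"
  proof (rule bilinear_onI; rule linear_on_tensorI[OF subspace_carrier]; (rule R'_in; assumption)?)
    show "linear_on V (\<lambda>u. rmul p q (R' v u))" if "p \<in> V" "q \<in> V" "v \<in> V" for p q v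
      by (rule linear_on_cong[OF D[OF that(3)] subspace_carrier R'_rmul[OF that(3) _ that(1,2)]])
        (intro multilinear that | assumption)+
    show "linear_on V (\<lambda>u. rmul p q (R' u v))" if "p \<in> V" "q \<in> V" "v \<in> V" for p q v
      by (rule linear_on_cong[OF D_linear subspace_carrier R'_rmul[OF _ that(3,1,2)]])
  qed
  show "bil (\<lambda>a b. L a b)"
  proof (rule bilinear_onI; rule linear_on_tensorI[OF subspace_carrier]; (rule L_in; assumption)?)
    show "linear_on V (\<lambda>u. rmul p q (L v u))" if "p \<in> V" "q \<in> V" "v \<in> V" for p q v
      by (rule linear_on_cong[OF _ subspace_carrier L_rmul[OF that(3) _ that(1,2)]])
        (intro lin_sw_arg b that D_linear D_in tens_in)
    show "linear_on V (\<lambda>u. rmul p q (L u v))" if "p \<in> V" "q \<in> V" "v \<in> V" for p q v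
      by (rule linear_on_cong[OF _ subspace_carrier L_rmul[OF _ that(3,1,2)]])
        (intro lin_sw_map b that D_in multilinear)
  qed
qed

lemma lin_R_left: "linear_on U f \<Longrightarrow> (\<And>u. u \<in> U \<Longrightarrow> f u \<in> V) \<Longrightarrow> c \<in> V \<Longrightarrow> linear_on U (\<lambda>u. R (f u) c)"
  and lin_R_right: "linear_on U f \<Longrightarrow> (\<And>u. u \<in> U \<Longrightarrow> f u \<in> V) \<Longrightarrow> c \<in> V \<Longrightarrow> linear_on U (\<lambda>u. R c (f u))"
  and lin_R'_left: "linear_on U f \<Longrightarrow> (\<And>u. u \<in> U \<Longrightarrow> f u \<in> V) \<Longrightarrow> c \<in> V \<Longrightarrow> linear_on U (\<lambda>u. R' (f u) c)"
  and lin_R'_right: "linear_on U f \<Longrightarrow> (\<And>u. u \<in> U \<Longrightarrow> f u \<in> V) \<Longrightarrow> c \<in> V \<Longrightarrow> linear_on U (\<lambda>u. R' c (f u))"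
  and lin_L_left: "linear_on U f \<Longrightarrow> (\<And>u. u \<in> U \<Longrightarrow> f u \<in> V) \<Longrightarrow> c \<in> V \<Longrightarrow> linear_on U (\<lambda>u. L (f u) c)"
  and lin_L_right: "linear_on U f \<Longrightarrow> (\<And>u. u \<in> U \<Longrightarrow> f u \<in> V) \<Longrightarrow> c \<in> V \<Longrightarrow> linear_on U (\<lambda>u. L c (f u))"
  by (rule bil_compose_left[OF R_bilinear] bil_compose_right[OF R_bilinear]
      bil_compose_left[OF R'_bilinear] bil_compose_right[OF R'_bilinear]
      bil_compose_left[OF L_bilinear] bil_compose_right[OF L_bilinear]; assumption)+

lemmas multilin = bilinear_onI linear_on_ident linear_on_tens_left linear_on_tens_right
  linear_on_scaleC_left linear_on_scaleC_right linear_on_mult_left linear_on_mult_right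
  lin_mul_left lin_mul_right lin_R_left lin_R_right lin_R'_left lin_R'_right lin_L_left lin_L_right
  lin_sw_arg lin_sw_map subspace_carrier subspace_tensor_space
  mul_in tens_in R_in R'_in L_in

lemma rmul_sw:
  assumes "t \<in> VV" "bil f" "\<And>u v. u \<in> V \<Longrightarrow> v \<in> V \<Longrightarrow> f u v \<in> VV" "p \<in> V" "q \<in> V"
  shows "rmul p q (sw t f) = sw t (\<lambda>u v. rmul p q (f u v))"
  by (rule sw_out[OF assms(2) rmul_linear[OF assms(4,5)] assms(3) subspace_tensor_space assms(1)])

lemma rmul_mul_left:
  assumes "c \<in> V" "p \<in> V" "q \<in> V" "t \<in> VV"
  shows "rmul p q (sw t (\<lambda>u v. (c \<cdot> u) \<otimes>\<^sub>t v)) = sw (rmul p q t) (\<lambda>u v. (c \<cdot> u) \<otimes>\<^sub>t v)"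
proof -
  have b: "bil (\<lambda>u v. (c \<cdot> u) \<otimes>\<^sub>t v)"
    using assms by (intro multilin)
  have "rmul p q (sw t (\<lambda>u v. (c \<cdot> u) \<otimes>\<^sub>t v)) = sw t (\<lambda>u v. rmul p q ((c \<cdot> u) \<otimes>\<^sub>t v))"
    by (intro rmul_sw b tens_in mul_in assms)
  also have "\<dots> = sw t (\<lambda>u v. sw ((u \<cdot> p) \<otimes>\<^sub>t (v \<cdot> q)) (\<lambda>u v. (c \<cdot> u) \<otimes>\<^sub>t v))"
    using assms by (intro tensor_lift_cong) (simp add: rmul_tens sw_tens[OF b] mul_in mul_assoc)
  also have "\<dots> = sw (rmul p q t) (\<lambda>u v. (c \<cdot> u) \<otimes>\<^sub>t v)"
    unfolding rmul_def by (intro sw_sw[symmetric] b rmul_bil tens_in mul_in assms)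
  finally show ?thesis .
qed

lemma rmul_mul_right:
  assumes "c \<in> V" "d \<in> V" "p \<in> V" "q \<in> V" "t \<in> VV"
  shows "rmul p q (sw t (\<lambda>u v. (u \<cdot> c) \<otimes>\<^sub>t v)) = rmul (c \<cdot> p) q t"
    and "rmul p q (sw t (\<lambda>u v. u \<otimes>\<^sub>t (v \<cdot> d))) = rmul p (d \<cdot> q) t"
proof -
  have b: "bil (\<lambda>u v. (u \<cdot> c) \<otimes>\<^sub>t v)" "bil (\<lambda>u v. u \<otimes>\<^sub>t (v \<cdot> d))"
    by (intro multilin assms | assumption)+
  have "rmul p q (sw t (\<lambda>u v. (u \<cdot> c) \<otimes>\<^sub>t v)) = sw t (\<lambda>u v. rmul p q ((u \<cdot> c) \<otimes>\<^sub>t v))"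
    by (intro rmul_sw b tens_in mul_in assms)
  also have "\<dots> = rmul (c \<cdot> p) q t"
    unfolding rmul_def[of "c \<cdot> p"] using assms by (intro tensor_lift_cong) (simp add: rmul_tens mul_in mul_assoc)
  finally show "rmul p q (sw t (\<lambda>u v. (u \<cdot> c) \<otimes>\<^sub>t v)) = rmul (c \<cdot> p) q t" .
  have "rmul p q (sw t (\<lambda>u v. u \<otimes>\<^sub>t (v \<cdot> d))) = sw t (\<lambda>u v. rmul p q (u \<otimes>\<^sub>t (v \<cdot> d)))"
    by (intro rmul_sw b tens_in mul_in assms)
  also have "\<dots> = rmul p (d \<cdot> q) t"
    unfolding rmul_def[of p] using assms by (intro tensor_lift_cong) (simp add: rmul_tens[unfolded rmul_def] mul_in mul_assoc)
  finally show "rmul p q (sw t (\<lambda>u v. u \<otimes>\<^sub>t (v \<cdot> d))) = rmul p (d \<cdot> q) t" .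
qed

lemma mul_tens_bil:
  assumes "c \<in> V"
  shows "bil (\<lambda>u v. (u \<cdot> c) \<otimes>\<^sub>t v)" "bil (\<lambda>u v. u \<otimes>\<^sub>t (v \<cdot> c))" "bil (\<lambda>u v. (c \<cdot> u) \<otimes>\<^sub>t v)"
  by (intro multilin assms | assumption)+

text \<open>The element \<open>\<Delta>(a)(c \<otimes> d)\<close> can be covered on either leg. Comparing the two expressions allows
\<open>R\<close> and \<open>R'\<close> to be exchanged under a Sweedler sum.\<close>

lemma D_tens:
  assumes "a \<in> V" "c \<in> V" "d \<in> V"
  shows "D a (c \<otimes>\<^sub>t d) = sw (R a d) (\<lambda>u v. (u \<cdot> c) \<otimes>\<^sub>t v)"
    and "D a (c \<otimes>\<^sub>t d) = sw (R' a c) (\<lambda>u v. u \<otimes>\<^sub>t (v \<cdot> d))"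
  by (rule tensor_eqI, (intro sw_in_tensor mul_tens_bil D_in tens_in mul_in R_in R'_in assms | assumption)+,
      simp add: assms D_rmul[symmetric] rmul_mul_right rmul_tens R_rmul R'_rmul mul_in tens_in R_in R'_in)+

lemma R_mul_left: "a \<in> V \<Longrightarrow> b \<in> V \<Longrightarrow> c \<in> V \<Longrightarrow> R (a \<cdot> b) c = D a (R b c)"
  and R'_mul_left: "a \<in> V \<Longrightarrow> b \<in> V \<Longrightarrow> c \<in> V \<Longrightarrow> R' (a \<cdot> b) c = D a (R' b c)"
  by (rule tensor_eqI, (intro D_in R_in R'_in mul_in | assumption)+,
      simp add: D_rmul[symmetric] R_in R'_in R_rmul R'_rmul mul_in D_mul)+

lemma R_mul_right:
  assumes "a \<in> V" "b \<in> V" "c \<in> V"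
  shows "R a (b \<cdot> c) = sw (R a b) (\<lambda>u v. u \<otimes>\<^sub>t (v \<cdot> c))"
  by (rule tensor_eqI, (intro sw_in_tensor mul_tens_bil tens_in mul_in R_in assms | assumption)+,
      simp add: assms rmul_mul_right R_rmul mul_in R_in mul_assoc)

lemma R_eq_L:
  assumes "a \<in> V" "b \<in> V" "c \<in> V"
  shows "sw (R a b) (\<lambda>u v. (c \<cdot> u) \<otimes>\<^sub>t v) = sw (L c a) (\<lambda>u v. u \<otimes>\<^sub>t (v \<cdot> b))"
    and "sw (R' a b) (\<lambda>u v. (c \<cdot> u) \<otimes>\<^sub>t v) = sw (L c a) (\<lambda>u v. (u \<cdot> b) \<otimes>\<^sub>t v)"
  by (rule tensor_eqI, (intro sw_in_tensor mul_tens_bil tens_in mul_in R_in R'_in L_in assms | assumption)+,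
      simp add: assms rmul_mul_right rmul_mul_left R_rmul R'_rmul L_rmul mul_in R_in R'_in L_in)+

section \<open>Sweedler calculus\<close>

lemma sw_tensor_subst:
  assumes "bil f" "t \<in> VV" "bil (\<lambda>u v. g u v \<otimes>\<^sub>t h u v)"
    "\<And>u v. u \<in> V \<Longrightarrow> v \<in> V \<Longrightarrow> g u v \<in> V" "\<And>u v. u \<in> V \<Longrightarrow> v \<in> V \<Longrightarrow> h u v \<in> V"
  shows "sw (sw t (\<lambda>u v. g u v \<otimes>\<^sub>t h u v)) f = sw t (\<lambda>u v. f (g u v) (h u v))"
proof -
  have "sw (sw t (\<lambda>u v. g u v \<otimes>\<^sub>t h u v)) f = sw t (\<lambda>u v. sw (g u v \<otimes>\<^sub>t h u v) f)"
    by (intro sw_sw assms tens_in)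
  also have "\<dots> = sw t (\<lambda>u v. f (g u v) (h u v))"
    by (intro tensor_lift_cong sw_tens assms)
  finally show ?thesis .
qed

lemma sw_D:
  assumes "bil f" "a \<in> V" "c \<in> V" "d \<in> V"
  shows "sw (D a (c \<otimes>\<^sub>t d)) f = sw (R a d) (\<lambda>u v. f (u \<cdot> c) v)"
    and "sw (D a (c \<otimes>\<^sub>t d)) f = sw (R' a c) (\<lambda>u v. f u (v \<cdot> d))"
  unfolding D_tens(1)[OF assms(2-4)] unfolding D_tens(2)[OF assms(2-4), folded D_tens(1)[OF assms(2-4)]]
  subgoal by (rule sw_tensor_subst; (intro assms mul_tens_bil mul_in R_in R'_in | assumption)+)
  subgoal unfolding D_tens(1)[OF assms(2-4), symmetric] unfolding D_tens(2)[OF assms(2-4)]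
    by (rule sw_tensor_subst; (intro assms mul_tens_bil mul_in R_in R'_in | assumption)+)
  done

lemma sw_R_R':
  assumes "bil f" "a \<in> V" "c \<in> V" "d \<in> V"
  shows "sw (R a d) (\<lambda>u v. f (u \<cdot> c) v) = sw (R' a c) (\<lambda>u v. f u (v \<cdot> d))"
  using sw_D[OF assms] by simp

lemma sw_D_general:
  assumes "bil f" "a \<in> V" "t \<in> VV"
  shows "sw (D a t) f = sw t (\<lambda>g h. sw (R a h) (\<lambda>u v. f (u \<cdot> g) v))"
proof -
  have "sw (D a (sw t (\<otimes>\<^sub>t))) f = sw t (\<lambda>g h. sw (D a (g \<otimes>\<^sub>t h)) f)"
    by (rule sw_out[where Z = VV], (intro multilin linear_on_compose[OF D_multiplier(1)] sw_linear
      D_in assms | assumption)+)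
  also have "\<dots> = sw t (\<lambda>g h. sw (R a h) (\<lambda>u v. f (u \<cdot> g) v))"
    by (intro tensor_lift_cong sw_D assms)
  finally show ?thesis
    by (simp add: sw_ident assms)
qed

lemma sw_R_mul_left:
  assumes "bil f" "a \<in> V" "b \<in> V" "c \<in> V"
  shows "sw (R (a \<cdot> b) c) f = sw (R b c) (\<lambda>g h. sw (R a h) (\<lambda>u v. f (u \<cdot> g) v))"
    and "sw (R' (a \<cdot> b) c) f = sw (R' b c) (\<lambda>g h. sw (R a h) (\<lambda>u v. f (u \<cdot> g) v))"
  using assms by (simp_all add: R_mul_left R'_mul_left sw_D_general R_in R'_in)

lemma sw_R_mul_right:
  assumes "bil f" "a \<in> V" "b \<in> V" "c \<in> V"
  shows "sw (R a (b \<cdot> c)) f = sw (R a b) (\<lambda>u v. f u (v \<cdot> c))"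
  unfolding R_mul_right[OF assms(2-4)]
  by (rule sw_tensor_subst; (intro assms mul_tens_bil mul_in R_in R'_in | assumption)+)

lemma sw_R_L:
  assumes "bil f" "a \<in> V" "b \<in> V" "c \<in> V"
  shows "sw (R a b) (\<lambda>u v. f (c \<cdot> u) v) = sw (L c a) (\<lambda>u v. f u (v \<cdot> b))" (is "?l1 = ?r1")
    and "sw (R' a b) (\<lambda>u v. f (c \<cdot> u) v) = sw (L c a) (\<lambda>u v. f (u \<cdot> b) v)" (is "?l2 = ?r2")
proof -
  have "?l1 = sw (sw (R a b) (\<lambda>u v. (c \<cdot> u) \<otimes>\<^sub>t v)) f"
    by (rule sw_tensor_subst[symmetric]; (intro assms mul_tens_bil mul_in R_in | assumption)+)
  also have "\<dots> = ?r1"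
    unfolding R_eq_L(1)[OF assms(2-4)]
    by (rule sw_tensor_subst; (intro assms mul_tens_bil mul_in L_in | assumption)+)
  finally show "?l1 = ?r1" .
  have "?l2 = sw (sw (R' a b) (\<lambda>u v. (c \<cdot> u) \<otimes>\<^sub>t v)) f"
    by (rule sw_tensor_subst[symmetric]; (intro assms mul_tens_bil mul_in R'_in | assumption)+)
  also have "\<dots> = ?r2"
    unfolding R_eq_L(2)[OF assms(2-4)]
    by (rule sw_tensor_subst; (intro assms mul_tens_bil mul_in L_in | assumption)+)
  finally show "?l2 = ?r2" .
qed

definition trilinear :: "('a \<Rightarrow> 'a \<Rightarrow> 'a \<Rightarrow> 'z::complex_vector) \<Rightarrow> bool" where
  "trilinear f \<longleftrightarrow> (\<forall>v\<in>V. \<forall>w\<in>V. lin (\<lambda>u. f u v w)) \<and> (\<forall>u\<in>V. bil (f u))"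

lemma trilinearI:
  assumes "\<And>v w. v \<in> V \<Longrightarrow> w \<in> V \<Longrightarrow> lin (\<lambda>u. f u v w)" "\<And>u w. u \<in> V \<Longrightarrow> w \<in> V \<Longrightarrow> lin (\<lambda>v. f u v w)"
    "\<And>u v. u \<in> V \<Longrightarrow> v \<in> V \<Longrightarrow> lin (\<lambda>w. f u v w)"
  shows "trilinear f"
  using assms by (auto simp: trilinear_def intro: bilinear_onI)

lemma trilinear_bil: "trilinear f \<Longrightarrow> u \<in> V \<Longrightarrow> bil (f u)"
  by (simp add: trilinear_def)

lemma trilinear_1: "trilinear f \<Longrightarrow> linear_on U g \<Longrightarrow> (\<And>x. x \<in> U \<Longrightarrow> g x \<in> V) \<Longrightarrow> v \<in> V \<Longrightarrow> w \<in> V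
    \<Longrightarrow> linear_on U (\<lambda>x. f (g x) v w)"
  and trilinear_2: "trilinear f \<Longrightarrow> linear_on U g \<Longrightarrow> (\<And>x. x \<in> U \<Longrightarrow> g x \<in> V) \<Longrightarrow> u \<in> V \<Longrightarrow> w \<in> V
    \<Longrightarrow> linear_on U (\<lambda>x. f u (g x) w)"
  and trilinear_3: "trilinear f \<Longrightarrow> linear_on U g \<Longrightarrow> (\<And>x. x \<in> U \<Longrightarrow> g x \<in> V) \<Longrightarrow> u \<in> V \<Longrightarrow> v \<in> V
    \<Longrightarrow> linear_on U (\<lambda>x. f u v (g x))"
proof -
  assume f: "trilinear f" and g: "linear_on U g" "\<And>x. x \<in> U \<Longrightarrow> g x \<in> V"
  show "v \<in> V \<Longrightarrow> w \<in> V \<Longrightarrow> linear_on U (\<lambda>x. f (g x) v w)"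
    by (rule linear_on_compose[OF g(1) _ g(2)]) (use f in \<open>auto simp: trilinear_def\<close>)
  show "u \<in> V \<Longrightarrow> w \<in> V \<Longrightarrow> linear_on U (\<lambda>x. f u (g x) w)"
    by (rule bil_compose_left[OF trilinear_bil[OF f] g])
  show "u \<in> V \<Longrightarrow> v \<in> V \<Longrightarrow> linear_on U (\<lambda>x. f u v (g x))"
    by (rule bil_compose_right[OF trilinear_bil[OF f] g])
qed

text \<open>The value of a trilinear map on an element of \<open>A \<otimes> (A \<otimes> A)\<close>.\<close>

definition sw3 where "sw3 X f = tensor_lift V VV (\<lambda>p s. sw s (f p)) X"

lemma sw3_bil:
  assumes f: "trilinear f"
  shows "bilinear_on V VV (\<lambda>p s. sw s (f p))"
  by (intro bilinear_onI sw_linear lin_sw_map trilinear_1[OF f] trilinear_bil[OF f] subspace_carrier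
      linear_on_ident | assumption)+

lemma sw3_tens: "trilinear f \<Longrightarrow> p \<in> V \<Longrightarrow> s \<in> VV \<Longrightarrow> sw3 (p \<otimes>\<^sub>t s) f = sw s (f p)"
  unfolding sw3_def by (simp add: tensor_lift(2)[OF subspace_carrier subspace_tensor_space sw3_bil])

lemma sw3_linear: "trilinear f \<Longrightarrow> linear_on (tensor_space V VV) (\<lambda>X. sw3 X f)"
  unfolding sw3_def by (rule tensor_lift(1)[OF subspace_carrier subspace_tensor_space sw3_bil])

lemma sw3_sw:
  assumes "trilinear f" "bil h" "\<And>u v. u \<in> V \<Longrightarrow> v \<in> V \<Longrightarrow> h u v \<in> tensor_space V VV" "t \<in> VV"
  shows "sw3 (sw t h) f = sw t (\<lambda>u v. sw3 (h u v) f)"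
  by (rule sw_out[OF assms(2) sw3_linear[OF assms(1)] assms(3) subspace_tensor_space assms(4)])

lemma sw3_tens3: "trilinear f \<Longrightarrow> u \<in> V \<Longrightarrow> v \<in> V \<Longrightarrow> w \<in> V \<Longrightarrow> sw3 (u \<otimes>\<^sub>t v \<otimes>\<^sub>t w) f = f u v w"
  by (simp add: sw3_tens tens_in sw_tens[OF trilinear_bil])

text \<open>Evaluating coassociativity with an arbitrary trilinear map replaces triple tensor products by nested
Sweedler sums: both sides are \<open>f (a c\<^sub>1) c\<^sub>2 (c\<^sub>3 a')\<close>.\<close>

lemma sw_coassociative:
  assumes f: "trilinear f" and a: "a \<in> V" "c \<in> V" "a' \<in> V"
  shows "sw (R c a') (\<lambda>m w. sw (L a m) (\<lambda>u v. f u v w)) = sw (L a c) (\<lambda>p q. sw (R q a') (\<lambda>g k. f p g k))"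
proof -
  have "coassociative A \<Delta>"
    using rmha by (simp add: regular_multiplier_hopf_algebra_def)
  then have "tensor_assoc V V V (sw (R c a') (\<lambda>m w. L a m \<otimes>\<^sub>t w)) = sw (L a c) (\<lambda>p q. p \<otimes>\<^sub>t R q a')"
    using a unfolding coassociative_def tensor_map_def by simp
  moreover have "tensor_assoc V V V (sw (R c a') (\<lambda>m w. L a m \<otimes>\<^sub>t w))
      = sw (R c a') (\<lambda>m w. tensor_assoc V V V (L a m \<otimes>\<^sub>t w))"
    unfolding tensor_assoc_def
    by (rule sw_out[where Z = "tensor_space VV V"];
      (intro multilin tensor_lift(1)[OF subspace_tensor_space subspace_carrier] a | assumption)+)
  moreover have "tensor_assoc V V V (L a m \<otimes>\<^sub>t w) = sw (L a m) (\<lambda>u v. u \<otimes>\<^sub>t v \<otimes>\<^sub>t w)" if "m \<in> V" "w \<in> V" for m w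
    unfolding tensor_assoc_def
    by (rule tensor_lift(2)[OF subspace_tensor_space subspace_carrier]; (intro multilin a that | assumption)+)
  ultimately have e: "sw (R c a') (\<lambda>m w. sw (L a m) (\<lambda>u v. u \<otimes>\<^sub>t v \<otimes>\<^sub>t w)) = sw (L a c) (\<lambda>p q. p \<otimes>\<^sub>t R q a')"
    by (simp cong: tensor_lift_cong)
  have "sw3 (sw (R c a') (\<lambda>m w. sw (L a m) (\<lambda>u v. u \<otimes>\<^sub>t v \<otimes>\<^sub>t w))) f
      = sw (R c a') (\<lambda>m w. sw3 (sw (L a m) (\<lambda>u v. u \<otimes>\<^sub>t v \<otimes>\<^sub>t w)) f)"
    by (rule sw3_sw[OF f]; (intro multilin sw_in_tensor
      tensor_lift_in[OF subspace_carrier subspace_carrier subspace_tensor_space] a | assumption)+)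
  also have "\<dots> = sw (R c a') (\<lambda>m w. sw (L a m) (\<lambda>u v. sw3 (u \<otimes>\<^sub>t v \<otimes>\<^sub>t w) f))"
    by (rule tensor_lift_cong, rule sw3_sw[OF f]; (intro multilin a | assumption)+)
  also have "\<dots> = sw (R c a') (\<lambda>m w. sw (L a m) (\<lambda>u v. f u v w))"
    by (intro tensor_lift_cong sw3_tens3[OF f])
  finally have 1: "sw3 (sw (L a c) (\<lambda>p q. p \<otimes>\<^sub>t R q a')) f
      = sw (R c a') (\<lambda>m w. sw (L a m) (\<lambda>u v. f u v w))" unfolding e .
  have "sw3 (sw (L a c) (\<lambda>p q. p \<otimes>\<^sub>t R q a')) f = sw (L a c) (\<lambda>p q. sw3 (p \<otimes>\<^sub>t R q a') f)"
    by (rule sw3_sw[OF f]; (intro multilin a | assumption)+)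
  also have "\<dots> = sw (L a c) (\<lambda>p q. sw (R q a') (\<lambda>g k. f p g k))"
    by (intro tensor_lift_cong sw3_tens[OF f] R_in a)
  finally show ?thesis using 1 by simp
qed

lemma linear_on_functional: "linear_on UNIV \<omega> \<Longrightarrow> linear_on U g \<Longrightarrow> linear_on U (\<lambda>x. \<omega> (g x))"
  by (rule linear_on_compose[of U g UNIV]) auto

lemma sw_mult_const:
  assumes "bil f" "s \<in> VV"
  shows "sw s (\<lambda>g k. c * f g k) = (c * sw s f :: complex)"
proof -
  have "c * sw s f = sw s (\<lambda>g k. c * f g k)"
    by (rule sw_out[where Z = UNIV]) (auto intro: linear_on_mult_right linear_on_ident assms cvs.subspace_UNIV)
  then show ?thesis by simp
qed

text \<open>Coassociativity is available only with the outer legs covered, by \<open>d\<close> from the left and by \<open>t\<close> from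
the right. This lemma removes the covering: by non-degeneracy, functionals of the form \<open>\<alpha>(d \<cdot>)\<close> and
\<open>\<gamma>(\<cdot> t)\<close> separate the points of \<open>A\<close>.\<close>

lemma sw3_eqI:
  assumes X: "X \<in> tensor_space V VV" and Y: "Y \<in> tensor_space V VV"
    and e: "\<And>(f :: 'a \<Rightarrow> 'a \<Rightarrow> 'a \<Rightarrow> complex) d t. trilinear f \<Longrightarrow> d \<in> V \<Longrightarrow> t \<in> V \<Longrightarrow>
      sw3 X (\<lambda>p g k. f (d \<cdot> p) g (k \<cdot> t)) = sw3 Y (\<lambda>p g k. f (d \<cdot> p) g (k \<cdot> t))"
  shows "X = Y"
proof -
  let ?F = "{\<lambda>u. \<omega> (d \<cdot> u) | \<omega> d. linear_on UNIV \<omega> \<and> d \<in> V} :: ('a \<Rightarrow> complex) set"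
  let ?F' = "{\<lambda>u. \<omega> (u \<cdot> t) | \<omega> t. linear_on UNIV \<omega> \<and> t \<in> V} :: ('a \<Rightarrow> complex) set"
  let ?G = "{\<lambda>s. sw s (\<lambda>g k. \<beta> g * \<gamma> k) | \<beta> \<gamma>. linear_on UNIV \<beta> \<and> \<gamma> \<in> ?F'} :: (('a, 'a) tensor \<Rightarrow> complex) set"
  have F: "linear_on V \<alpha>" if "\<alpha> \<in> ?F" for \<alpha>
  proof -
    from that obtain \<omega> p where *: "linear_on UNIV \<omega>" "p \<in> V" "\<alpha> = (\<lambda>u. \<omega> (p \<cdot> u))" by blast
    show ?thesis unfolding *(3) by (intro linear_on_functional[OF *(1)] lin_mul_right linear_on_ident *(2))
  qed
  have F': "linear_on V \<alpha>" if "\<alpha> \<in> ?F'" for \<alpha>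
  proof -
    from that obtain \<omega> p where *: "linear_on UNIV \<omega>" "p \<in> V" "\<alpha> = (\<lambda>u. \<omega> (u \<cdot> p))" by blast
    show ?thesis unfolding *(3) by (intro linear_on_functional[OF *(1)] lin_mul_left linear_on_ident *(2))
  qed
  have U: "linear_on V \<beta>" if "linear_on UNIV \<beta>" for \<beta> :: "'a \<Rightarrow> complex"
    using linear_on_functional[OF that linear_on_ident] .
  have sepF: "v = 0" if v: "v \<in> V" and z: "\<And>\<alpha>. \<alpha> \<in> ?F \<Longrightarrow> \<alpha> v = 0" for v
  proof (rule eq_0_if_left_mul_0[OF v])
    fix p assume "p \<in> V"
    then have "\<omega> (p \<cdot> v) = 0" if "linear_on UNIV \<omega>" for \<omega> :: "'a \<Rightarrow> complex"
      using z[of "\<lambda>u. \<omega> (p \<cdot> u)"] that by blast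
    then show "p \<cdot> v = 0" by (rule functionals_separate)
  qed
  have sepF': "v = 0" if v: "v \<in> V" and z: "\<And>\<alpha>. \<alpha> \<in> ?F' \<Longrightarrow> \<alpha> v = 0" for v
  proof (rule eq_0_if_right_mul_0[OF v])
    fix p assume "p \<in> V"
    then have "\<omega> (v \<cdot> p) = 0" if "linear_on UNIV \<omega>" for \<omega> :: "'a \<Rightarrow> complex"
      using z[of "\<lambda>u. \<omega> (u \<cdot> p)"] that by blast
    then show "v \<cdot> p = 0" by (rule functionals_separate)
  qed
  have bG: "bil (\<lambda>g k. \<beta> g * \<gamma> k)" if "linear_on UNIV \<beta>" "\<gamma> \<in> ?F'" for \<beta> \<gamma> :: "'a \<Rightarrow> complex"
    by (intro bilinear_onI linear_on_mult_left linear_on_mult_right U F' that)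
  have G: "linear_on VV \<beta>" if "\<beta> \<in> ?G" for \<beta>
    using that sw_linear[OF bG] by auto
  have sepG: "s = 0" if s: "s \<in> VV" and z: "\<And>\<beta>. \<beta> \<in> ?G \<Longrightarrow> \<beta> s = 0" for s
  proof (rule tensor_eq_0_if_functionals[OF subspace_carrier subspace_carrier s _ _ F' sepF'])
    show "linear_on V \<alpha>" if "\<alpha> \<in> Collect (linear_on UNIV)" for \<alpha> :: "'a \<Rightarrow> complex"
      using that by (simp add: U)
    show "v = 0" if "\<And>\<alpha>. \<alpha> \<in> Collect (linear_on UNIV) \<Longrightarrow> \<alpha> v = (0::complex)" for v :: 'a
      by (rule functionals_separate, rule that, simp)
    show "sw s (\<lambda>v w. \<alpha> v * \<beta> w) = 0" if "\<alpha> \<in> Collect (linear_on UNIV)" "\<beta> \<in> ?F'" for \<alpha> \<beta>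
      by (rule z, rule CollectI, rule exI[of _ \<alpha>], rule exI[of _ \<beta>])
        (intro conjI refl that(2) that(1)[unfolded mem_Collect_eq])
  qed
  have 0: "tensor_lift V VV (\<lambda>v w. \<alpha> v * \<beta> w) (X - Y) = 0" if ab: "\<alpha> \<in> ?F" "\<beta> \<in> ?G" for \<alpha> \<beta>
  proof -
    from ab(1) obtain \<omega> d where a: "linear_on UNIV \<omega>" "d \<in> V" "\<alpha> = (\<lambda>u. \<omega> (d \<cdot> u))" by blast
    from ab(2) obtain \<omega>1 \<gamma> where b1: "linear_on UNIV \<omega>1" "\<gamma> \<in> ?F'" "\<beta> = (\<lambda>s. sw s (\<lambda>g k. \<omega>1 g * \<gamma> k))" by blast
    from b1(2) obtain \<omega>2 t where b2: "linear_on UNIV \<omega>2" "t \<in> V" "\<gamma> = (\<lambda>k. \<omega>2 (k \<cdot> t))" by blast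
    let ?f = "\<lambda>p g k. \<omega> p * (\<omega>1 g * \<omega>2 k)"
    have tri: "trilinear ?f"
      by (intro trilinearI linear_on_mult_left linear_on_mult_right U a b1 b2)
    have tri': "trilinear (\<lambda>p g k. ?f (d \<cdot> p) g (k \<cdot> t))"
      by (intro trilinearI linear_on_mult_left linear_on_mult_right linear_on_functional[OF a(1)] U b1 linear_on_functional[OF b2(1)]
        multilin a b2)
    have *: "tensor_lift V VV (\<lambda>v w. \<alpha> v * \<beta> w) Z = sw3 Z (\<lambda>p g k. ?f (d \<cdot> p) g (k \<cdot> t))" for Z
      unfolding sw3_def using sw_mult_const[OF bG[OF b1(1,2)]]
      by (intro tensor_lift_cong) (simp add: a(3) b1(3) b2(3))
    show ?thesis
      unfolding * using e[OF tri a(2) b2(2)] linear_on_diff[OF sw3_linear[OF tri'] subspace_tensor_space X Y]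
      by simp
  qed
  have "X - Y \<in> tensor_space V VV"
    by (rule cvs.subspace_diff[OF subspace_tensor_space X Y])
  then have "X - Y = 0"
    by (rule tensor_eq_0_if_functionals[OF subspace_carrier subspace_tensor_space _ F sepF G sepG 0])
  then show ?thesis by simp
qed

text \<open>Both sides are \<open>f (d a\<^sub>1) (a\<^sub>2 r\<^sub>1 s) (a\<^sub>3 r\<^sub>2 t)\<close>. Coassociativity is applied to \<open>a\<close>, once its first
leg has been covered by \<open>d\<close> and its last one by \<open>r\<^sub>2 t\<close>.\<close>

lemma coassoc_R_R'_covered:
  assumes f: "trilinear f" and a: "a \<in> V" "r \<in> V" "s \<in> V" "d \<in> V" "t \<in> V"
  shows "sw (R a r) (\<lambda>u v. sw (R' v s) (\<lambda>g k. f (d \<cdot> u) g (k \<cdot> t)))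
    = sw (R' r s) (\<lambda>g h. sw (R a h) (\<lambda>m v. sw (R m g) (\<lambda>p q. f (d \<cdot> p) q (v \<cdot> t))))"
proof -
  note fs = trilinear_1[OF f] trilinear_2[OF f] trilinear_3[OF f] multilin a
  have "sw (R' r s) (\<lambda>g h. sw (R a h) (\<lambda>m v. sw (R m g) (\<lambda>p q. f (d \<cdot> p) q (v \<cdot> t))))
      = sw (R' r s) (\<lambda>g h. sw (R a h) (\<lambda>m v. sw (L d m) (\<lambda>p q. f p (q \<cdot> g) (v \<cdot> t))))"
    by (intro tensor_lift_cong sw_R_L(1)[where f = "\<lambda>p q. f p q _"]) (intro fs | assumption)+
  also have "\<dots> = sw (R' r s) (\<lambda>g h. sw (R a (h \<cdot> t)) (\<lambda>m v. sw (L d m) (\<lambda>p q. f p (q \<cdot> g) v)))"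
    by (intro tensor_lift_cong sw_R_mul_right[symmetric]) (intro fs | assumption)+
  also have "\<dots> = sw (R' r s) (\<lambda>g h. sw (L d a) (\<lambda>p q. sw (R q (h \<cdot> t)) (\<lambda>x k. f p (x \<cdot> g) k)))"
    by (intro tensor_lift_cong sw_coassociative trilinearI) (intro fs | assumption)+
  also have "\<dots> = sw (L d a) (\<lambda>p q. sw (R' r s) (\<lambda>g h. sw (R q (h \<cdot> t)) (\<lambda>x k. f p (x \<cdot> g) k)))"
    by (rule sw_swap) (intro fs | assumption)+
  also have "\<dots> = sw (L d a) (\<lambda>p q. sw (R' r s) (\<lambda>g h. sw (R q h) (\<lambda>x k. f p (x \<cdot> g) (k \<cdot> t))))"
    by (intro tensor_lift_cong sw_R_mul_right) (intro fs | assumption)+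
  also have "\<dots> = sw (L d a) (\<lambda>p q. sw (R' (q \<cdot> r) s) (\<lambda>g k. f p g (k \<cdot> t)))"
    by (intro tensor_lift_cong sw_R_mul_left(2)[symmetric]) (intro fs | assumption)+
  also have "\<dots> = sw (R a r) (\<lambda>u v. sw (R' v s) (\<lambda>g k. f (d \<cdot> u) g (k \<cdot> t)))"
    by (rule sw_R_L(1)[symmetric, where f = "\<lambda>u v. sw (R' v s) (\<lambda>g k. f u g (k \<cdot> t))"]) (intro fs | assumption)+
  finally show ?thesis ..
qed

text \<open>Both sides are \<open>f (d z\<^sub>1 x\<^sub>1) (z\<^sub>2 x\<^sub>2 e) (z\<^sub>3 t)\<close>. The Sweedler sum over \<open>x\<close> is moved outwards until
coassociativity applies to \<open>z\<close>, covered by \<open>d\<close> and \<open>t\<close>.\<close>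

lemma coassoc_R'_R_covered:
  assumes f: "trilinear f" and a: "z \<in> V" "x \<in> V" "e \<in> V" "d \<in> V" "t \<in> V"
  shows "sw (R' z x) (\<lambda>u v. sw (R u e) (\<lambda>p q. f (d \<cdot> p) q (v \<cdot> t)))
    = sw (R x e) (\<lambda>g h. sw (R' z g) (\<lambda>u v. sw (R' v h) (\<lambda>p q. f (d \<cdot> u) p (q \<cdot> t))))"
proof -
  note fs = trilinear_1[OF f] trilinear_2[OF f] trilinear_3[OF f] multilin a
  have "sw (R' z x) (\<lambda>u v. sw (R u e) (\<lambda>p q. f (d \<cdot> p) q (v \<cdot> t)))
      = sw (R' z x) (\<lambda>u v. sw (L d u) (\<lambda>p q. f p (q \<cdot> e) (v \<cdot> t)))"
    by (intro tensor_lift_cong sw_R_L(1)[where f = "\<lambda>p q. f p q _"]) (intro fs | assumption)+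
  also have "\<dots> = sw (R z t) (\<lambda>u v. sw (L d (u \<cdot> x)) (\<lambda>p q. f p (q \<cdot> e) v))"
    by (rule sw_R_R'[symmetric, where f = "\<lambda>u v. sw (L d u) (\<lambda>p q. f p (q \<cdot> e) v)"]) (intro fs | assumption)+
  also have "\<dots> = sw (R z t) (\<lambda>u v. sw (R (u \<cdot> x) e) (\<lambda>p q. f (d \<cdot> p) q v))"
    by (intro tensor_lift_cong sw_R_L(1)[symmetric, where f = "\<lambda>p q. f p q _"]) (intro fs | assumption)+
  also have "\<dots> = sw (R z t) (\<lambda>u v. sw (R x e) (\<lambda>g h. sw (R u h) (\<lambda>p q. f (d \<cdot> (p \<cdot> g)) q v)))"
    by (intro tensor_lift_cong sw_R_mul_left(1)) (intro fs | assumption)+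
  also have "\<dots> = sw (R z t) (\<lambda>u v. sw (R x e) (\<lambda>g h. sw (R u h) (\<lambda>p q. f (d \<cdot> p \<cdot> g) q v)))"
    by (intro tensor_lift_cong) (simp add: mul_assoc a cong: tensor_lift_cong)
  also have "\<dots> = sw (R z t) (\<lambda>u v. sw (R x e) (\<lambda>g h. sw (L d u) (\<lambda>p q. f (p \<cdot> g) (q \<cdot> h) v)))"
    by (intro tensor_lift_cong sw_R_L(1)[where f = "\<lambda>p q. f (p \<cdot> _) q _"]) (intro fs | assumption)+
  also have "\<dots> = sw (R x e) (\<lambda>g h. sw (R z t) (\<lambda>u v. sw (L d u) (\<lambda>p q. f (p \<cdot> g) (q \<cdot> h) v)))"
    by (rule sw_swap) (intro fs | assumption)+
  also have "\<dots> = sw (R x e) (\<lambda>g h. sw (L d z) (\<lambda>p q. sw (R q t) (\<lambda>m k. f (p \<cdot> g) (m \<cdot> h) k)))"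
    by (intro tensor_lift_cong sw_coassociative trilinearI) (intro fs | assumption)+
  also have "\<dots> = sw (R x e) (\<lambda>g h. sw (R' z g) (\<lambda>u v. sw (R v t) (\<lambda>p q. f (d \<cdot> u) (p \<cdot> h) q)))"
    by (intro tensor_lift_cong sw_R_L(2)[symmetric, where f = "\<lambda>u v. sw (R v t) (\<lambda>p q. f u (p \<cdot> _) q)"]) (intro fs | assumption)+
  also have "\<dots> = sw (R x e) (\<lambda>g h. sw (R' z g) (\<lambda>u v. sw (R' v h) (\<lambda>p q. f (d \<cdot> u) p (q \<cdot> t))))"
    by (intro tensor_lift_cong sw_R_R'[where f = "\<lambda>p q. f (d \<cdot> _) p q"]) (intro fs | assumption)+
  finally show ?thesis .
qed

lemma tens3_in: "u \<in> V \<Longrightarrow> v \<in> V \<Longrightarrow> w \<in> V \<Longrightarrow> u \<otimes>\<^sub>t v \<otimes>\<^sub>t w \<in> tensor_space V VV"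
  by (intro tens_in)

lemma sw_in_tensor3:
  "bil f \<Longrightarrow> (\<And>v w. v \<in> V \<Longrightarrow> w \<in> V \<Longrightarrow> f v w \<in> tensor_space V VV) \<Longrightarrow> t \<in> VV \<Longrightarrow> sw t f \<in> tensor_space V VV"
  by (rule tensor_lift_in[OF subspace_carrier subspace_carrier subspace_tensor_space])

text \<open>The identity \<open>(\<iota> \<otimes> \<Delta>)\<Delta>(a) = (\<Delta> \<otimes> \<iota>)\<Delta>(a)\<close> multiplied on the right by \<open>1 \<otimes> \<Delta>(r)(s \<otimes> 1)\<close>.\<close>

lemma coassoc_R_R':
  assumes f: "trilinear f" and a: "a \<in> V" "r \<in> V" "s \<in> V"
  shows "sw (R a r) (\<lambda>u v. sw (R' v s) (\<lambda>g k. f u g k))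
    = sw (R' r s) (\<lambda>g h. sw (R a h) (\<lambda>m v. sw (R m g) (\<lambda>p q. f p q v)))"
proof -
  note ms = multilin a tens3_in sw_in_tensor3
  let ?X = "sw (R a r) (\<lambda>u v. sw (R' v s) (\<lambda>g k. u \<otimes>\<^sub>t g \<otimes>\<^sub>t k))"
  let ?Y = "sw (R' r s) (\<lambda>g h. sw (R a h) (\<lambda>m v. sw (R m g) (\<lambda>p q. p \<otimes>\<^sub>t q \<otimes>\<^sub>t v)))"
  have X: "sw3 ?X F = sw (R a r) (\<lambda>u v. sw (R' v s) (\<lambda>g k. F u g k))"
    if F: "trilinear F" for F :: "'a \<Rightarrow> 'a \<Rightarrow> 'a \<Rightarrow> 'z::complex_vector"
  proof -
    have "sw3 ?X F = sw (R a r) (\<lambda>u v. sw3 (sw (R' v s) (\<lambda>g k. u \<otimes>\<^sub>t g \<otimes>\<^sub>t k)) F)"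
      by (intro sw3_sw[OF F]) (intro ms | assumption)+
    also have "\<dots> = sw (R a r) (\<lambda>u v. sw (R' v s) (\<lambda>g k. sw3 (u \<otimes>\<^sub>t g \<otimes>\<^sub>t k) F))"
      by (intro tensor_lift_cong sw3_sw[OF F]) (intro ms | assumption)+
    also have "\<dots> = sw (R a r) (\<lambda>u v. sw (R' v s) (\<lambda>g k. F u g k))"
      by (intro tensor_lift_cong sw3_tens3[OF F])
    finally show ?thesis .
  qed
  have Y: "sw3 ?Y F = sw (R' r s) (\<lambda>g h. sw (R a h) (\<lambda>m v. sw (R m g) (\<lambda>p q. F p q v)))"
    if F: "trilinear F" for F :: "'a \<Rightarrow> 'a \<Rightarrow> 'a \<Rightarrow> 'z::complex_vector"
  proof -
    have "sw3 ?Y F = sw (R' r s) (\<lambda>g h. sw3 (sw (R a h) (\<lambda>m v. sw (R m g) (\<lambda>p q. p \<otimes>\<^sub>t q \<otimes>\<^sub>t v))) F)"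
      by (intro sw3_sw[OF F]) (intro ms | assumption)+
    also have "\<dots> = sw (R' r s) (\<lambda>g h. sw (R a h) (\<lambda>m v. sw3 (sw (R m g) (\<lambda>p q. p \<otimes>\<^sub>t q \<otimes>\<^sub>t v)) F))"
      by (intro tensor_lift_cong sw3_sw[OF F]) (intro ms | assumption)+
    also have "\<dots> = sw (R' r s) (\<lambda>g h. sw (R a h) (\<lambda>m v. sw (R m g) (\<lambda>p q. sw3 (p \<otimes>\<^sub>t q \<otimes>\<^sub>t v) F)))"
      by (intro tensor_lift_cong sw3_sw[OF F]) (intro ms | assumption)+
    also have "\<dots> = sw (R' r s) (\<lambda>g h. sw (R a h) (\<lambda>m v. sw (R m g) (\<lambda>p q. F p q v)))"
      by (intro tensor_lift_cong sw3_tens3[OF F])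
    finally show ?thesis .
  qed
  have "?X = ?Y"
  proof (rule sw3_eqI)
    show "?X \<in> tensor_space V VV" by (intro ms | assumption)+
    show "?Y \<in> tensor_space V VV" by (intro ms | assumption)+
    fix F :: "'a \<Rightarrow> 'a \<Rightarrow> 'a \<Rightarrow> complex" and d t
    assume F: "trilinear F" and d: "d \<in> V" "t \<in> V"
    have tri: "trilinear (\<lambda>p g k. F (d \<cdot> p) g (k \<cdot> t))"
      by (intro trilinearI trilinear_1[OF F] trilinear_2[OF F] trilinear_3[OF F] multilin d | assumption)+
    show "sw3 ?X (\<lambda>p g k. F (d \<cdot> p) g (k \<cdot> t)) = sw3 ?Y (\<lambda>p g k. F (d \<cdot> p) g (k \<cdot> t))"
      unfolding X[OF tri] Y[OF tri] by (rule coassoc_R_R'_covered[OF F a d])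
  qed
  then show ?thesis using X[OF f] Y[OF f] by simp
qed

text \<open>The identity \<open>(\<Delta> \<otimes> \<iota>)\<Delta>(z) = (\<iota> \<otimes> \<Delta>)\<Delta>(z)\<close> multiplied on the right by \<open>\<Delta>(x)(1 \<otimes> e) \<otimes> 1\<close>.\<close>

lemma coassoc_R'_R:
  assumes f: "trilinear f" and a: "z \<in> V" "x \<in> V" "e \<in> V"
  shows "sw (R' z x) (\<lambda>u v. sw (R u e) (\<lambda>p q. f p q v))
    = sw (R x e) (\<lambda>g h. sw (R' z g) (\<lambda>u v. sw (R' v h) (\<lambda>p q. f u p q)))"
proof -
  note ms = multilin a tens3_in sw_in_tensor3
  let ?X = "sw (R' z x) (\<lambda>u v. sw (R u e) (\<lambda>p q. p \<otimes>\<^sub>t q \<otimes>\<^sub>t v))"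
  let ?Y = "sw (R x e) (\<lambda>g h. sw (R' z g) (\<lambda>u v. sw (R' v h) (\<lambda>p q. u \<otimes>\<^sub>t p \<otimes>\<^sub>t q)))"
  have X: "sw3 ?X F = sw (R' z x) (\<lambda>u v. sw (R u e) (\<lambda>p q. F p q v))"
    if F: "trilinear F" for F :: "'a \<Rightarrow> 'a \<Rightarrow> 'a \<Rightarrow> 'z::complex_vector"
  proof -
    have "sw3 ?X F = sw (R' z x) (\<lambda>u v. sw3 (sw (R u e) (\<lambda>p q. p \<otimes>\<^sub>t q \<otimes>\<^sub>t v)) F)"
      by (intro sw3_sw[OF F]) (intro ms | assumption)+
    also have "\<dots> = sw (R' z x) (\<lambda>u v. sw (R u e) (\<lambda>p q. sw3 (p \<otimes>\<^sub>t q \<otimes>\<^sub>t v) F))"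
      by (intro tensor_lift_cong sw3_sw[OF F]) (intro ms | assumption)+
    also have "\<dots> = sw (R' z x) (\<lambda>u v. sw (R u e) (\<lambda>p q. F p q v))"
      by (intro tensor_lift_cong sw3_tens3[OF F])
    finally show ?thesis .
  qed
  have Y: "sw3 ?Y F = sw (R x e) (\<lambda>g h. sw (R' z g) (\<lambda>u v. sw (R' v h) (\<lambda>p q. F u p q)))"
    if F: "trilinear F" for F :: "'a \<Rightarrow> 'a \<Rightarrow> 'a \<Rightarrow> 'z::complex_vector"
  proof -
    have "sw3 ?Y F = sw (R x e) (\<lambda>g h. sw3 (sw (R' z g) (\<lambda>u v. sw (R' v h) (\<lambda>p q. u \<otimes>\<^sub>t p \<otimes>\<^sub>t q))) F)"
      by (intro sw3_sw[OF F]) (intro ms | assumption)+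
    also have "\<dots> = sw (R x e) (\<lambda>g h. sw (R' z g) (\<lambda>u v. sw3 (sw (R' v h) (\<lambda>p q. u \<otimes>\<^sub>t p \<otimes>\<^sub>t q)) F))"
      by (intro tensor_lift_cong sw3_sw[OF F]) (intro ms | assumption)+
    also have "\<dots> = sw (R x e) (\<lambda>g h. sw (R' z g) (\<lambda>u v. sw (R' v h) (\<lambda>p q. sw3 (u \<otimes>\<^sub>t p \<otimes>\<^sub>t q) F)))"
      by (intro tensor_lift_cong sw3_sw[OF F]) (intro ms | assumption)+
    also have "\<dots> = sw (R x e) (\<lambda>g h. sw (R' z g) (\<lambda>u v. sw (R' v h) (\<lambda>p q. F u p q)))"
      by (intro tensor_lift_cong sw3_tens3[OF F])
    finally show ?thesis .
  qed
  have "?X = ?Y"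
  proof (rule sw3_eqI)
    show "?X \<in> tensor_space V VV" by (intro ms | assumption)+
    show "?Y \<in> tensor_space V VV" by (intro ms | assumption)+
    fix F :: "'a \<Rightarrow> 'a \<Rightarrow> 'a \<Rightarrow> complex" and d t
    assume F: "trilinear F" and d: "d \<in> V" "t \<in> V"
    have tri: "trilinear (\<lambda>p g k. F (d \<cdot> p) g (k \<cdot> t))"
      by (intro trilinearI trilinear_1[OF F] trilinear_2[OF F] trilinear_3[OF F] multilin d | assumption)+
    show "sw3 ?X (\<lambda>p g k. F (d \<cdot> p) g (k \<cdot> t)) = sw3 ?Y (\<lambda>p g k. F (d \<cdot> p) g (k \<cdot> t))"
      unfolding X[OF tri] Y[OF tri] by (rule coassoc_R'_R_covered[OF F a d])
  qed
  then show ?thesis using X[OF f] Y[OF f] by simp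
qed

section \<open>Surjectivity of the Galois maps\<close>

lemma R_onto:
  assumes "t \<in> VV"
  obtains s where "s \<in> VV" "t = sw s (\<lambda>a b. R a b)"
proof -
  have "galois_bijective A \<Delta>"
    using rmha by (simp add: regular_multiplier_hopf_algebra_def)
  then have "(\<lambda>s. sw s (\<lambda>a b. R a b)) ` VV = VV"
    by (simp add: galois_bijective_def carr_tensor bij_betw_def)
  then show thesis using assms that by blast
qed

text \<open>The Galois map is onto, so the elements \<open>R a b\<close> span \<open>A \<otimes> A\<close>.\<close>

lemma eq_if_eq_on_R:
  assumes "bil f" "bil g" "\<And>a b. a \<in> V \<Longrightarrow> b \<in> V \<Longrightarrow> sw (R a b) f = sw (R a b) g" "u \<in> V" "v \<in> V"
  shows "f u v = g u v"
proof -
  obtain s where s: "s \<in> VV" "u \<otimes>\<^sub>t v = sw s (\<lambda>a b. R a b)"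
    using R_onto[of "u \<otimes>\<^sub>t v"] assms(4,5) tens_in by blast
  have *: "sw (u \<otimes>\<^sub>t v) f = sw s (\<lambda>a b. sw (R a b) f)" if "bil f" for f :: "'a \<Rightarrow> 'a \<Rightarrow> 'b"
    unfolding s(2) by (intro sw_sw that R_bilinear R_in s(1))
  have "sw (u \<otimes>\<^sub>t v) f = sw (u \<otimes>\<^sub>t v) g"
    unfolding *[OF assms(1)] *[OF assms(2)] by (intro tensor_lift_cong assms(3))
  then show ?thesis
    using assms by (simp add: sw_tens)
qed

lemma flip_in: "t \<in> VV \<Longrightarrow> flip A t \<in> VV"
  unfolding flip_def by (intro sw_in_tensor) (intro multilin | assumption)+

lemma flip_linear: "linear_on VV (flip A)"
  unfolding flip_def by (intro sw_linear) (intro multilin | assumption)+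

lemma sw_flip:
  assumes "bil f" "t \<in> VV"
  shows "sw (flip A t) f = sw t (\<lambda>u v. f v u)"
  unfolding flip_def using assms
  by (rule sw_tensor_subst) (intro multilin | assumption)+

lemma flip_flip: "t \<in> VV \<Longrightarrow> flip A (flip A t) = t"
  using sw_flip[of "\<lambda>u v. v \<otimes>\<^sub>t u" t] sw_ident[of t]
  by (simp add: flip_def[symmetric]) (subst flip_def, subst sw_flip; (intro multilin | assumption | simp)+)

lemma flip_mul:
  assumes "s \<in> VV" "t \<in> VV"
  shows "flip A (s \<cdot>\<^bsub>A \<otimes>\<^sub>a A\<^esub> t) = flip A s \<cdot>\<^bsub>A \<otimes>\<^sub>a A\<^esub> flip A t"
proof -
  have "flip A (s \<cdot>\<^bsub>A \<otimes>\<^sub>a A\<^esub> t) = sw s (\<lambda>a c. flip A (sw t (\<lambda>a' c'. (a \<cdot> a') \<otimes>\<^sub>t (c \<cdot> c'))))"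
    unfolding alg_tensor_def alg.simps
    by (rule sw_out[OF tensor_mul_bil'[OF assms(2)] flip_linear _ subspace_tensor_space assms(1)])
      (intro sw_in_tensor tensor_mul_bil tens_in mul_in assms | assumption)+
  also have "\<dots> = sw s (\<lambda>a c. sw t (\<lambda>a' c'. (c \<cdot> c') \<otimes>\<^sub>t (a \<cdot> a')))"
    unfolding flip_def
    by (intro tensor_lift_cong sw_tensor_subst) (intro multilin assms | assumption)+
  also have "\<dots> = flip A s \<cdot>\<^bsub>A \<otimes>\<^sub>a A\<^esub> flip A t"
    unfolding alg_tensor_def alg.simps
    by (subst sw_flip[OF tensor_mul_bil' assms(1)], rule flip_in, rule assms,
      intro tensor_lift_cong sw_flip[symmetric]) (intro multilin assms | assumption)+
  finally show ?thesis .
qed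

text \<open>The flip is an automorphism of the algebra \<open>A \<otimes> A\<close>, so it carries the multiplier
\<open>\<Delta>(a)(b \<otimes> 1)\<close>, on both sides, to the product of the flipped coproduct of \<open>a\<close> with \<open>1 \<otimes> b\<close>.\<close>

lemma flip_R':
  assumes a: "a \<in> V" "b \<in> V"
  shows "comult_r A (comult_flip A \<Delta>) a b = flip A (R' a b)"
proof -
  have m: "D a t \<in> VV" "snd (\<Delta> a) t \<in> VV" if "t \<in> VV" for t
  proof -
    have "\<Delta> a \<in> multipliers (A \<otimes>\<^sub>a A)"
      using comult_hom a by (simp add: alg_hom_def mult_alg_def)
    then show "D a t \<in> VV" "snd (\<Delta> a) t \<in> VV"
      using that by (auto simp: multipliers_def carr_tensor)
  qed
  have leg: "fst (leg2 A b) t = flip A (fst (leg1 A b) (flip A t))"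
    "snd (leg2 A b) t = flip A (snd (leg1 A b) (flip A t))"
    "fst (leg2 A b) t \<in> VV" "snd (leg2 A b) t \<in> VV" "fst (leg1 A b) t \<in> VV" "snd (leg1 A b) t \<in> VV"
    if t: "t \<in> VV" for t
  proof -
    have *: "flip A (sw (flip A t) (\<lambda>u v. g u \<otimes>\<^sub>t v)) = sw t (\<lambda>u v. u \<otimes>\<^sub>t g v)"
      if g: "linear_on V g" "\<And>u. u \<in> V \<Longrightarrow> g u \<in> V" for g
    proof -
      have b: "bil (\<lambda>u v. g u \<otimes>\<^sub>t v)" "bil (\<lambda>u v. u \<otimes>\<^sub>t g v)"
        by (intro bilinear_onI linear_on_tens_left linear_on_tens_right linear_on_ident g(1))+
      have "flip A (sw (flip A t) (\<lambda>u v. g u \<otimes>\<^sub>t v)) = flip A (sw t (\<lambda>u v. g v \<otimes>\<^sub>t u))"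
        by (simp add: sw_flip b t)
      also have "\<dots> = sw t (\<lambda>u v. u \<otimes>\<^sub>t g v)"
        unfolding flip_def
        by (rule sw_tensor_subst) (intro bilinear_onI linear_on_tens_left linear_on_tens_right linear_on_ident g t | assumption)+
      finally show ?thesis .
    qed
    show "fst (leg2 A b) t = flip A (fst (leg1 A b) (flip A t))"
      by (subst fst_leg(2)[OF a(2) t], subst fst_leg(1)[OF a(2) flip_in[OF t]], rule *[symmetric]) (intro multilin a | assumption)+
    show "snd (leg2 A b) t = flip A (snd (leg1 A b) (flip A t))"
      by (subst fst_leg(4)[OF a(2) t], subst fst_leg(3)[OF a(2) flip_in[OF t]], rule *[symmetric]) (intro multilin a | assumption)+
    show "fst (leg2 A b) t \<in> VV" "snd (leg2 A b) t \<in> VV" "fst (leg1 A b) t \<in> VV" "snd (leg1 A b) t \<in> VV"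
      unfolding fst_leg[OF a(2) t] by (intro sw_in_tensor multilin a t | assumption)+
  qed
  have out: "fst (leg2 A b) t = 0" "snd (leg2 A b) t = 0" if "t \<notin> VV" for t
    using that by (simp_all add: leg2_def mult_tensor_def ext0_def carr_tensor)
  have e: "embed (A \<otimes>\<^sub>a A) (R' a b) = \<Delta> a \<cdot>\<^bsub>mult_alg2 A\<^esub> leg1 A b"
    unfolding R'_def by (rule unembed_in_alg(2)[OF covered(3)[OF a]])
  have e1: "D a (fst (leg1 A b) t) = R' a b \<cdot>\<^bsub>A \<otimes>\<^sub>a A\<^esub> t" "snd (leg1 A b) (snd (\<Delta> a) t) = t \<cdot>\<^bsub>A \<otimes>\<^sub>a A\<^esub> R' a b"
    if "t \<in> VV" for t
    using that fun_cong[OF arg_cong[OF e, of fst], of t] fun_cong[OF arg_cong[OF e, of snd], of t]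
    by (simp_all add: mult_alg_def embed_def ext0_def carr_tensor)
  have z: "flip A 0 = 0"
    by (rule linear_on_zero[OF flip_linear subspace_tensor_space])
  have "fst (comult_flip A \<Delta> a \<cdot>\<^bsub>mult_alg2 A\<^esub> leg2 A b) t = fst (embed (A \<otimes>\<^sub>a A) (flip A (R' a b))) t" for t
  proof (cases "t \<in> VV")
    case True
    then have "fst (comult_flip A \<Delta> a \<cdot>\<^bsub>mult_alg2 A\<^esub> leg2 A b) t = flip A (D a (fst (leg1 A b) (flip A t)))"
      by (simp add: mult_alg_def comult_flip_def ext0_def carr_tensor leg flip_in flip_flip)
    also have "\<dots> = flip A (R' a b) \<cdot>\<^bsub>A \<otimes>\<^sub>a A\<^esub> t"
      using True by (simp add: e1 flip_in flip_mul R'_in a flip_flip)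
    finally show ?thesis using True by (simp add: embed_def ext0_def carr_tensor)
  next
    case False
    have "D a 0 = 0" by (rule linear_on_zero[OF D_multiplier(1)[OF a(1)] subspace_tensor_space])
    with False show ?thesis
      by (simp add: mult_alg_def comult_flip_def ext0_def carr_tensor out z embed_def)
  qed
  moreover have "snd (comult_flip A \<Delta> a \<cdot>\<^bsub>mult_alg2 A\<^esub> leg2 A b) t = snd (embed (A \<otimes>\<^sub>a A) (flip A (R' a b))) t" for t
  proof (cases "t \<in> VV")
    case True
    then have "snd (comult_flip A \<Delta> a \<cdot>\<^bsub>mult_alg2 A\<^esub> leg2 A b) t = flip A (snd (leg1 A b) (snd (\<Delta> a) (flip A t)))"
      by (simp add: mult_alg_def comult_flip_def ext0_def carr_tensor leg flip_in flip_flip m)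
    also have "\<dots> = t \<cdot>\<^bsub>A \<otimes>\<^sub>a A\<^esub> flip A (R' a b)"
      using True by (simp add: e1 flip_in flip_mul R'_in a flip_flip)
    finally show ?thesis using True by (simp add: embed_def ext0_def carr_tensor)
  next
    case False
    have "snd (leg2 A b) 0 = 0"
      using leg(2)[OF cvs.subspace_0[OF subspace_tensor_space]] fst_leg(4)[OF a(2) cvs.subspace_0[OF subspace_tensor_space]]
        linear_on_zero[OF sw_linear[OF mul_tens_bil(2)[OF a(2)]] subspace_tensor_space] by simp
    with False show ?thesis
      by (simp add: mult_alg_def comult_flip_def ext0_def carr_tensor embed_def)
  qed
  ultimately have "comult_flip A \<Delta> a \<cdot>\<^bsub>mult_alg2 A\<^esub> leg2 A b = embed (A \<otimes>\<^sub>a A) (flip A (R' a b))"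
    by (auto simp: prod_eq_iff fun_eq_iff)
  then show ?thesis
    unfolding comult_r_def unembed_def carr_tensor
    by (simp add: inv_into_f_f[OF inj_on_embed_tensor flip_in[OF R'_in[OF a]]])
qed

lemma R'_onto:
  assumes "t \<in> VV"
  obtains s where "s \<in> VV" "t = sw s (\<lambda>a b. R' a b)"
proof -
  have "galois_bijective A (comult_flip A \<Delta>)"
    using rmha by (simp add: regular_multiplier_hopf_algebra_def)
  then have "(\<lambda>s. sw s (comult_r A (comult_flip A \<Delta>))) ` VV = VV"
    by (simp add: galois_bijective_def carr_tensor bij_betw_def)
  then obtain s where s: "s \<in> VV" "flip A t = sw s (comult_r A (comult_flip A \<Delta>))"
    using flip_in[OF assms] by blast
  have "flip A t = sw s (\<lambda>a b. flip A (R' a b))"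
    unfolding s(2) by (intro tensor_lift_cong flip_R')
  also have "\<dots> = flip A (sw s (\<lambda>a b. R' a b))"
    by (rule sw_out[symmetric, OF R'_bilinear flip_linear R'_in subspace_tensor_space s(1)])
  finally have "flip A (flip A t) = flip A (flip A (sw s (\<lambda>a b. R' a b)))"
    by (rule arg_cong)
  moreover have "sw s (\<lambda>a b. R' a b) \<in> VV"
    by (rule sw_in_tensor[OF R'_bilinear _ s(1)]) (rule R'_in)
  ultimately have "t = sw s (\<lambda>a b. R' a b)"
    by (simp only: flip_flip assms)
  with s(1) show thesis by (rule that)
qed

section \<open>Counit, antipode and integrals\<close>

lemma left_invariant:
  assumes "left_integral A \<Delta> \<phi>" "a \<in> V" "c \<in> V"
  shows "sw (R' a c) (\<lambda>u v. \<phi> v *\<^sub>C u) = \<phi> a *\<^sub>C c"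
proof -
  have "fst (slice2 A \<phi> (\<Delta> a)) c = fst (\<phi> a *\<^sub>C mult_one A) c"
    using assms by (simp add: left_integral_def)
  then show ?thesis
    using assms by (simp add: slice2_def Let_def R'_def ext0_def mult_one_def scaleC_prod_def scaleC_fun_def)
qed

lemma right_invariant:
  assumes "right_integral A \<Delta> \<psi>" "a \<in> V" "c \<in> V"
  shows "sw (R a c) (\<lambda>u v. \<psi> u *\<^sub>C v) = \<psi> a *\<^sub>C c"
proof -
  have "fst (slice1 A \<psi> (\<Delta> a)) c = fst (\<psi> a *\<^sub>C mult_one A) c"
    using assms by (simp add: right_integral_def)
  then show ?thesis
    using assms by (simp add: slice1_def Let_def comult_r_def ext0_def mult_one_def scaleC_prod_def scaleC_fun_def)
qed

lemma mul_sw_right: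
  assumes "bil f" "\<And>u v. u \<in> V \<Longrightarrow> v \<in> V \<Longrightarrow> f u v \<in> V" "t \<in> VV" "c \<in> V"
  shows "sw t f \<cdot> c = sw t (\<lambda>u v. f u v \<cdot> c)"
  by (rule sw_out[where L = "\<lambda>x. x \<cdot> c" and Z = V]) (intro assms multilin | assumption)+

lemma mul_sw_left:
  assumes "bil f" "\<And>u v. u \<in> V \<Longrightarrow> v \<in> V \<Longrightarrow> f u v \<in> V" "t \<in> VV" "c \<in> V"
  shows "c \<cdot> sw t f = sw t (\<lambda>u v. c \<cdot> f u v)"
  by (rule sw_out[where L = "\<lambda>x. c \<cdot> x" and Z = V]) (intro assms multilin | assumption)+

lemma scale_in: "a \<in> V \<Longrightarrow> z *\<^sub>C a \<in> V"
  by (rule cvs.subspace_scale[OF subspace_carrier])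

lemma mul_scale: "a \<in> V \<Longrightarrow> b \<in> V \<Longrightarrow> (z *\<^sub>C a) \<cdot> b = z *\<^sub>C (a \<cdot> b)"
  "a \<in> V \<Longrightarrow> b \<in> V \<Longrightarrow> a \<cdot> (z *\<^sub>C b) = z *\<^sub>C (a \<cdot> b)"
  by (rule linear_on_scale[OF bilinear_on_left[OF mul_bilinear]]
      linear_on_scale[OF bilinear_on_right[OF mul_bilinear]]; assumption)+

lemma mul_diff: "a \<in> V \<Longrightarrow> b \<in> V \<Longrightarrow> c \<in> V \<Longrightarrow> (a - b) \<cdot> c = a \<cdot> c - b \<cdot> c"
  "a \<in> V \<Longrightarrow> b \<in> V \<Longrightarrow> c \<in> V \<Longrightarrow> c \<cdot> (a - b) = c \<cdot> a - c \<cdot> b"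
  by (rule linear_on_diff[OF bilinear_on_left[OF mul_bilinear] subspace_carrier]
      linear_on_diff[OF bilinear_on_right[OF mul_bilinear] subspace_carrier]; assumption)+

lemma eq_if_right_mul_eq: "a \<in> V \<Longrightarrow> b \<in> V \<Longrightarrow> (\<And>c. c \<in> V \<Longrightarrow> a \<cdot> c = b \<cdot> c) \<Longrightarrow> a = b"
  using eq_0_if_right_mul_0[of "a - b"] cvs.subspace_diff[OF subspace_carrier, of a b]
  by (simp add: mul_diff)

lemma eq_if_left_mul_eq: "a \<in> V \<Longrightarrow> b \<in> V \<Longrightarrow> (\<And>c. c \<in> V \<Longrightarrow> c \<cdot> a = c \<cdot> b) \<Longrightarrow> a = b"
  using eq_0_if_left_mul_0[of "a - b"] cvs.subspace_diff[OF subspace_carrier, of a b]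
  by (simp add: mul_diff)

end

locale multiplier_hopf = regular_mha +
  fixes S :: "'a \<Rightarrow> 'a" and \<epsilon> :: "'a \<Rightarrow> complex"
  assumes S_linear: "lin S" and S_bij: "bij_betw S V V"
    and S_mul: "a \<in> V \<Longrightarrow> b \<in> V \<Longrightarrow> S (a \<cdot> b) = S b \<cdot> S a"
    and counit: "is_counit A \<Delta> \<epsilon>"
    and S_R: "a \<in> V \<Longrightarrow> b \<in> V \<Longrightarrow> sw (R a b) (\<lambda>p q. S p \<cdot> q) = \<epsilon> a *\<^sub>C b"
begin

definition T where "T = inv_into V S"

lemma S_in: "a \<in> V \<Longrightarrow> S a \<in> V"
  using S_bij by (auto simp: bij_betw_def)

lemma T_in: "a \<in> V \<Longrightarrow> T a \<in> V"
  unfolding T_def using S_bij by (metis bij_betw_imp_surj_on inv_into_into)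

lemma T_S: "a \<in> V \<Longrightarrow> T (S a) = a"
  unfolding T_def using S_bij by (simp add: bij_betw_inv_into_left)

lemma S_T: "a \<in> V \<Longrightarrow> S (T a) = a"
  unfolding T_def using S_bij by (simp add: bij_betw_inv_into_right)

lemma T_linear: "lin T"
  unfolding T_def by (rule linear_on_inv_into[OF S_linear subspace_carrier S_bij])

lemma T_mul: "a \<in> V \<Longrightarrow> b \<in> V \<Longrightarrow> T (a \<cdot> b) = T b \<cdot> T a"
  using S_mul[of "T b" "T a"] T_S[of "T b \<cdot> T a"] by (simp add: T_in S_T mul_in)

lemma \<epsilon>_linear: "lin \<epsilon>"
  using counit by (simp add: is_counit_def alg_hom_def)

lemma counit_R: "a \<in> V \<Longrightarrow> b \<in> V \<Longrightarrow> sw (R a b) (\<lambda>p q. \<epsilon> p *\<^sub>C q) = a \<cdot> b"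
  using counit by (simp add: is_counit_def)

lemma lin_S: "linear_on U g \<Longrightarrow> (\<And>x. x \<in> U \<Longrightarrow> g x \<in> V) \<Longrightarrow> linear_on U (\<lambda>x. S (g x))"
  and lin_T: "linear_on U g \<Longrightarrow> (\<And>x. x \<in> U \<Longrightarrow> g x \<in> V) \<Longrightarrow> linear_on U (\<lambda>x. T (g x))"
  and lin_\<epsilon>: "linear_on U g \<Longrightarrow> (\<And>x. x \<in> U \<Longrightarrow> g x \<in> V) \<Longrightarrow> linear_on U (\<lambda>x. \<epsilon> (g x))"
  by (rule linear_on_compose[OF _ S_linear] linear_on_compose[OF _ T_linear]
      linear_on_compose[OF _ \<epsilon>_linear]; assumption)+

lemmas mlin = multilin lin_S lin_T lin_\<epsilon> scale_in S_in T_in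

text \<open>The counit is defined by its action on the first leg. Applying it to the middle leg of
coassociativity computes \<open>a u\<^sub>1 \<epsilon>(u\<^sub>2) v\<close> for those \<open>u \<otimes> v\<close> that have the form \<open>R b c\<close>; these span
\<open>A \<otimes> A\<close>.\<close>

lemma counit_L:
  assumes a: "a \<in> V" "u \<in> V"
  shows "sw (L a u) (\<lambda>p q. \<epsilon> q *\<^sub>C p) = a \<cdot> u"
proof (rule eq_if_right_mul_eq)
  show "sw (L a u) (\<lambda>p q. \<epsilon> q *\<^sub>C p) \<in> V"
    by (intro sw_in_carrier mlin a | assumption)+
  fix v assume v: "v \<in> V"
  show "sw (L a u) (\<lambda>p q. \<epsilon> q *\<^sub>C p) \<cdot> v = a \<cdot> u \<cdot> v"
  proof (rule eq_if_eq_on_R[where f = "\<lambda>u v. sw (L a u) (\<lambda>p q. \<epsilon> q *\<^sub>C p) \<cdot> v" and g = "\<lambda>u v. a \<cdot> u \<cdot> v"])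
    show "bil (\<lambda>u v. sw (L a u) (\<lambda>p q. \<epsilon> q *\<^sub>C p) \<cdot> v)"
      by (intro mlin sw_in_carrier a | assumption)+
    show "bil (\<lambda>u v. a \<cdot> u \<cdot> v)"
      by (intro mlin a | assumption)+
    fix b c assume b: "b \<in> V" "c \<in> V"
    have "sw (R b c) (\<lambda>u v. sw (L a u) (\<lambda>p q. \<epsilon> q *\<^sub>C p) \<cdot> v)
        = sw (R b c) (\<lambda>u v. sw (L a u) (\<lambda>p q. (\<epsilon> q *\<^sub>C p) \<cdot> v))"
      by (intro tensor_lift_cong mul_sw_right) (intro mlin a | assumption)+
    also have "\<dots> = sw (L a b) (\<lambda>p q. sw (R q c) (\<lambda>g k. (\<epsilon> g *\<^sub>C p) \<cdot> k))"
      by (rule sw_coassociative[where f = "\<lambda>p q v. (\<epsilon> q *\<^sub>C p) \<cdot> v"]) (intro trilinearI mlin a b | assumption)+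
    also have "\<dots> = sw (L a b) (\<lambda>p q. sw (R q c) (\<lambda>g k. p \<cdot> (\<epsilon> g *\<^sub>C k)))"
      by (intro tensor_lift_cong) (simp add: mul_scale)
    also have "\<dots> = sw (L a b) (\<lambda>p q. p \<cdot> sw (R q c) (\<lambda>g k. \<epsilon> g *\<^sub>C k))"
      by (intro tensor_lift_cong mul_sw_left[symmetric]) (intro mlin b | assumption)+
    also have "\<dots> = sw (L a b) (\<lambda>p q. p \<cdot> (q \<cdot> c))"
      by (intro tensor_lift_cong) (simp add: counit_R b)
    also have "\<dots> = sw (R b c) (\<lambda>u v. a \<cdot> u \<cdot> v)"
      by (rule sw_R_L(1)[symmetric, where f = "\<lambda>u v. u \<cdot> v"]) (intro mlin a b | assumption)+
    finally show "sw (R b c) (\<lambda>u v. sw (L a u) (\<lambda>p q. \<epsilon> q *\<^sub>C p) \<cdot> v) = sw (R b c) (\<lambda>u v. a \<cdot> u \<cdot> v)" .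
  qed (use a v in auto)
qed (intro mul_in a)

lemma counit_R':
  assumes a: "z \<in> V" "g \<in> V"
  shows "sw (R' z g) (\<lambda>u v. \<epsilon> v *\<^sub>C u) = z \<cdot> g"
proof (rule eq_if_left_mul_eq)
  show "sw (R' z g) (\<lambda>u v. \<epsilon> v *\<^sub>C u) \<in> V"
    by (intro sw_in_carrier mlin a | assumption)+
  fix d assume d: "d \<in> V"
  have "d \<cdot> sw (R' z g) (\<lambda>u v. \<epsilon> v *\<^sub>C u) = sw (R' z g) (\<lambda>u v. d \<cdot> (\<epsilon> v *\<^sub>C u))"
    by (intro mul_sw_left) (intro mlin a d | assumption)+
  also have "\<dots> = sw (R' z g) (\<lambda>u v. \<epsilon> v *\<^sub>C (d \<cdot> u))"
    by (intro tensor_lift_cong) (simp add: mul_scale d)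
  also have "\<dots> = sw (L d z) (\<lambda>u v. \<epsilon> v *\<^sub>C (u \<cdot> g))"
    by (rule sw_R_L(2)[where f = "\<lambda>u v. \<epsilon> v *\<^sub>C u"]) (intro mlin a d | assumption)+
  also have "\<dots> = sw (L d z) (\<lambda>u v. (\<epsilon> v *\<^sub>C u) \<cdot> g)"
    by (intro tensor_lift_cong) (simp add: mul_scale a)
  also have "\<dots> = sw (L d z) (\<lambda>u v. \<epsilon> v *\<^sub>C u) \<cdot> g"
    by (intro mul_sw_right[symmetric]) (intro mlin a d | assumption)+
  also have "\<dots> = d \<cdot> (z \<cdot> g)"
    by (simp add: counit_L mul_assoc a d)
  finally show "d \<cdot> sw (R' z g) (\<lambda>u v. \<epsilon> v *\<^sub>C u) = d \<cdot> (z \<cdot> g)" .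
qed (intro mul_in a)

text \<open>In Sweedler notation, \<open>S(a\<^sub>1) \<phi>(a\<^sub>2 r) = S(a\<^sub>1) a\<^sub>2 r\<^sub>1 \<phi>(a\<^sub>3 r\<^sub>2) = r\<^sub>1 \<phi>(a r\<^sub>2)\<close>: left invariance inserts
the coproduct of \<open>a\<^sub>2 r\<close>, and the antipode equation then cancels \<open>S(a\<^sub>1) a\<^sub>2\<close>.\<close>

lemma left_integral_antipode:
  assumes \<phi>: "left_integral A \<Delta> \<phi>" and a: "a \<in> V" "r \<in> V" "s \<in> V"
  shows "sw (R a r) (\<lambda>u v. \<phi> v *\<^sub>C (S u \<cdot> s)) = sw (R' r s) (\<lambda>u v. \<phi> (a \<cdot> v) *\<^sub>C u)"
proof -
  have l: "lin \<phi>" using \<phi> by (simp add: left_integral_def)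
  note ms = mlin a linear_on_compose[OF _ l]
  have "sw (R a r) (\<lambda>u v. \<phi> v *\<^sub>C (S u \<cdot> s)) = sw (R a r) (\<lambda>u v. S u \<cdot> sw (R' v s) (\<lambda>g k. \<phi> k *\<^sub>C g))"
    by (intro tensor_lift_cong) (simp add: left_invariant[OF \<phi>] a mul_scale S_in)
  also have "\<dots> = sw (R a r) (\<lambda>u v. sw (R' v s) (\<lambda>g k. S u \<cdot> (\<phi> k *\<^sub>C g)))"
    by (intro tensor_lift_cong mul_sw_left) (intro ms | assumption)+
  also have "\<dots> = sw (R' r s) (\<lambda>g h. sw (R a h) (\<lambda>m v. sw (R m g) (\<lambda>p q. S p \<cdot> (\<phi> v *\<^sub>C q))))"
    by (rule coassoc_R_R'[where f = "\<lambda>u g k. S u \<cdot> (\<phi> k *\<^sub>C g)"]) (intro trilinearI ms | assumption)+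
  also have "\<dots> = sw (R' r s) (\<lambda>g h. sw (R a h) (\<lambda>m v. sw (R m g) (\<lambda>p q. \<phi> v *\<^sub>C (S p \<cdot> q))))"
    by (intro tensor_lift_cong) (simp add: mul_scale S_in)
  also have "\<dots> = sw (R' r s) (\<lambda>g h. sw (R a h) (\<lambda>m v. \<phi> v *\<^sub>C sw (R m g) (\<lambda>p q. S p \<cdot> q)))"
    by (intro tensor_lift_cong sw_out[symmetric, where L = "\<lambda>x. _ *\<^sub>C x" and Z = V])
      (intro ms | assumption)+
  also have "\<dots> = sw (R' r s) (\<lambda>g h. sw (R a h) (\<lambda>m v. \<phi> (\<epsilon> m *\<^sub>C v) *\<^sub>C g))"
    by (intro tensor_lift_cong) (simp add: S_R linear_on_scale[OF l] scaleC_scaleC scaleC_complex_def mult.commute)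
  also have "\<dots> = sw (R' r s) (\<lambda>g h. \<phi> (sw (R a h) (\<lambda>m v. \<epsilon> m *\<^sub>C v)) *\<^sub>C g)"
    by (intro tensor_lift_cong sw_out[symmetric, where L = "\<lambda>x. \<phi> x *\<^sub>C _" and Z = V]) (intro ms | assumption)+
  also have "\<dots> = sw (R' r s) (\<lambda>u v. \<phi> (a \<cdot> v) *\<^sub>C u)"
    by (intro tensor_lift_cong) (simp add: counit_R a)
  finally show ?thesis .
qed

text \<open>In Sweedler notation, \<open>S\<^sup>-\<^sup>1(z\<^sub>2) \<psi>(z\<^sub>1 x) = S\<^sup>-\<^sup>1(z\<^sub>3) z\<^sub>2 x\<^sub>2 \<psi>(z\<^sub>1 x\<^sub>1) = \<psi>(z x\<^sub>1) x\<^sub>2\<close>: right invariance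
inserts the coproduct of \<open>z\<^sub>1 x\<close>, and \<open>S\<^sup>-\<^sup>1(z\<^sub>3) z\<^sub>2\<close> cancels because it is \<open>S\<^sup>-\<^sup>1\<close> of \<open>S(z\<^sub>2) z\<^sub>3\<close>.\<close>

lemma right_integral_antipode:
  assumes \<psi>: "right_integral A \<Delta> \<psi>" and a: "z \<in> V" "x \<in> V" "d \<in> V"
  shows "sw (R x d) (\<lambda>u v. \<psi> (z \<cdot> u) *\<^sub>C v) = T (sw (R' z x) (\<lambda>u v. \<psi> u *\<^sub>C v)) \<cdot> d"
    (is "?l = T ?W \<cdot> d")
proof (rule eq_if_left_mul_eq)
  have l: "lin \<psi>" using \<psi> by (simp add: right_integral_def)
  note ms = mlin a linear_on_compose[OF _ l]
  have W: "?W \<in> V" by (intro sw_in_carrier ms | assumption)+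
  then show "T ?W \<cdot> d \<in> V" by (intro mlin a)
  show "?l \<in> V" by (intro sw_in_carrier ms | assumption)+
  fix e assume "e \<in> V"
  \<comment> \<open>The left factor is taken of the form \<open>S\<^sup>-\<^sup>1(c)\<close>, so that \<open>c\<close> covers the last leg of \<open>z\<close>.\<close>
  define c where "c = S e"
  have c: "c \<in> V" "T c = e" using \<open>e \<in> V\<close> by (simp_all add: c_def S_in T_S)
  have "T c \<cdot> (T ?W \<cdot> d) = T (?W \<cdot> c) \<cdot> d"
    using c(1) W a by (simp add: T_mul T_in mul_assoc)
  also have "\<dots> = T (sw (R' z x) (\<lambda>u v. (\<psi> u *\<^sub>C v) \<cdot> c)) \<cdot> d"
    by (intro arg_cong[where f = "\<lambda>y. T y \<cdot> d"] mul_sw_right) (intro ms c(1) | assumption)+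
  also have "\<dots> = sw (R' z x) (\<lambda>u v. T ((\<psi> u *\<^sub>C v) \<cdot> c) \<cdot> d)"
    by (rule sw_out[where L = "\<lambda>y. T y \<cdot> d" and Z = V]) (intro ms c(1) | assumption)+
  also have "\<dots> = sw (R' z x) (\<lambda>u v. T (v \<cdot> c) \<cdot> sw (R u d) (\<lambda>p q. \<psi> p *\<^sub>C q))"
    using c(1) by (intro tensor_lift_cong)
      (simp add: right_invariant[OF \<psi>] a mul_scale linear_on_scale[OF T_linear] mul_in T_in)
  also have "\<dots> = sw (R' z x) (\<lambda>u v. sw (R u d) (\<lambda>p q. T (v \<cdot> c) \<cdot> (\<psi> p *\<^sub>C q)))"
    by (intro tensor_lift_cong mul_sw_left) (intro ms c(1) | assumption)+
  also have "\<dots> = sw (R x d) (\<lambda>g h. sw (R' z g) (\<lambda>u v. sw (R' v h) (\<lambda>p q. T (q \<cdot> c) \<cdot> (\<psi> u *\<^sub>C p))))"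
    by (rule coassoc_R'_R[where f = "\<lambda>p q v. T (v \<cdot> c) \<cdot> (\<psi> p *\<^sub>C q)"]) (intro trilinearI ms c(1) | assumption)+
  also have "\<dots> = sw (R x d) (\<lambda>g h. sw (R' z g) (\<lambda>u v. sw (R v c) (\<lambda>p q. T q \<cdot> (\<psi> u *\<^sub>C (p \<cdot> h)))))"
    by (intro tensor_lift_cong sw_R_R'[symmetric, where f = "\<lambda>p q. T q \<cdot> (\<psi> _ *\<^sub>C p)"])
      (intro ms c(1) | assumption)+
  also have "\<dots> = sw (R x d) (\<lambda>g h. sw (R' z g) (\<lambda>u v. sw (R v c) (\<lambda>p q. \<psi> u *\<^sub>C (T (S p \<cdot> q) \<cdot> h))))"
    by (intro tensor_lift_cong) (simp add: mul_scale T_in S_in T_mul T_S mul_in mul_assoc)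
  also have "\<dots> = sw (R x d) (\<lambda>g h. sw (R' z g) (\<lambda>u v. \<psi> u *\<^sub>C (T (sw (R v c) (\<lambda>p q. S p \<cdot> q)) \<cdot> h)))"
    by (intro tensor_lift_cong sw_out[symmetric, where L = "\<lambda>y. \<psi> _ *\<^sub>C (T y \<cdot> _)" and Z = V])
      (intro ms c(1) | assumption)+
  also have "\<dots> = sw (R x d) (\<lambda>g h. sw (R' z g) (\<lambda>u v. \<psi> (\<epsilon> v *\<^sub>C u) *\<^sub>C (T c \<cdot> h)))"
    using c(1) by (intro tensor_lift_cong) (simp add: S_R linear_on_scale[OF l] linear_on_scale[OF T_linear]
      mul_scale T_in scaleC_scaleC scaleC_complex_def mult.commute)
  also have "\<dots> = sw (R x d) (\<lambda>g h. \<psi> (sw (R' z g) (\<lambda>u v. \<epsilon> v *\<^sub>C u)) *\<^sub>C (T c \<cdot> h))"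
    by (intro tensor_lift_cong sw_out[symmetric, where L = "\<lambda>y. \<psi> y *\<^sub>C (T c \<cdot> _)" and Z = V])
      (intro ms c(1) | assumption)+
  also have "\<dots> = sw (R x d) (\<lambda>g h. T c \<cdot> (\<psi> (z \<cdot> g) *\<^sub>C h))"
    using c(1) by (intro tensor_lift_cong) (simp add: counit_R' a mul_scale T_in)
  also have "\<dots> = T c \<cdot> ?l"
    by (intro mul_sw_left[symmetric]) (intro ms c(1) | assumption)+
  finally show "e \<cdot> ?l = e \<cdot> (T ?W \<cdot> d)" by (simp add: c(2))
qed

end

section \<open>The dual\<close>

lemma scaleC_apply: "(c *\<^sub>C f) a = c *\<^sub>C f a"
  by (simp add: scaleC_fun_def)

locale dual_quantum_group = multiplier_hopf +
  fixes \<phi> :: "'a \<Rightarrow> complex" and B :: "('a \<Rightarrow> complex) alg" and \<Delta>' :: "('a \<Rightarrow> complex) comult"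
    and S' :: "('a \<Rightarrow> complex) \<Rightarrow> 'a \<Rightarrow> complex" and \<epsilon>' :: "('a \<Rightarrow> complex) \<Rightarrow> complex"
  assumes \<phi>: "left_integral A \<Delta> \<phi>"
    and B_def: "B = dual_alg A \<Delta> \<phi>"
    and dual_comult: "is_dual_comult A \<Delta> B \<Delta>'"
    and S'_linear: "linear_on (carr B) S'" and S'_bij: "bij_betw S' (carr B) (carr B)"
    and S'_mul: "b \<in> carr B \<Longrightarrow> c \<in> carr B \<Longrightarrow> S' (b \<cdot>\<^bsub>B\<^esub> c) = S' c \<cdot>\<^bsub>B\<^esub> S' b"
    and counit': "is_counit B \<Delta>' \<epsilon>'"
    and S'_R: "b \<in> carr B \<Longrightarrow> c \<in> carr B \<Longrightarrow>
      tensor_lift (carr B) (carr B) (\<lambda>p q. S' p \<cdot>\<^bsub>B\<^esub> q) (comult_r B \<Delta>' b c) = \<epsilon>' b *\<^sub>C c"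
begin

abbreviation G where "G \<equiv> translate A \<phi>"
abbreviation W where "W \<equiv> carr B"
abbreviation WW where "WW \<equiv> tensor_space W W"
abbreviation swB where "swB s f \<equiv> tensor_lift W W f s"
abbreviation RB where "RB b c \<equiv> comult_r B \<Delta>' b c"
abbreviation LB where "LB b c \<equiv> comult_l B \<Delta>' b c"

lemma \<phi>_linear: "lin \<phi>"
  using \<phi> by (simp add: left_integral_def)

lemma lin_\<phi>: "linear_on U g \<Longrightarrow> (\<And>x. x \<in> U \<Longrightarrow> g x \<in> V) \<Longrightarrow> linear_on U (\<lambda>x. \<phi> (g x))"
  by (rule linear_on_compose[OF _ \<phi>_linear])

lemma translate_apply: "a \<in> V \<Longrightarrow> translate A \<omega> c a = \<omega> (a \<cdot> c)"
  by (simp add: translate_def ext0_def)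

lemmas G_apply = translate_apply[where \<omega> = \<phi>]

lemma W_eq: "W = G ` V"
  by (simp add: B_def dual_alg_def)

lemma G_in: "c \<in> V \<Longrightarrow> G c \<in> W"
  by (simp add: W_eq)

lemma W_cases: assumes "b \<in> W" obtains c where "c \<in> V" "b = G c"
  using assms W_eq by auto

lemma G_linear: "linear_on V G"
proof (rule linear_onI)
  fix u v c assume *: "u \<in> V" "v \<in> V"
  have l: "lin (\<lambda>c. \<phi> (a \<cdot> c))" if "a \<in> V" for a
    by (intro lin_\<phi> mlin that | assumption)+
  show "G (u + v) = G u + G v"
    using linear_on_add[OF l *] by (auto simp: fun_eq_iff translate_def ext0_def)
  show "G (c *\<^sub>C v) = c *\<^sub>C G v"
    using linear_on_scale[OF l *(2)] by (auto simp: fun_eq_iff translate_def ext0_def scaleC_fun_def)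
qed

lemma subspace_W: "cvs.subspace W"
  unfolding W_eq
proof (rule cvs.subspaceI)
  show "0 \<in> G ` V"
    using linear_on_zero[OF G_linear subspace_carrier] cvs.subspace_0[OF subspace_carrier]
    by (metis image_eqI)
  show "x + y \<in> G ` V" if xy: "x \<in> G ` V" "y \<in> G ` V" for x y
  proof -
    obtain u v where "u \<in> V" "v \<in> V" "x = G u" "y = G v" using xy by blast
    then show ?thesis
      using linear_on_add[OF G_linear, of u v] cvs.subspace_add[OF subspace_carrier, of u v]
      by (metis image_eqI)
  qed
  show "c *\<^sub>C x \<in> G ` V" if xy: "x \<in> G ` V" for c x
  proof -
    obtain u where "u \<in> V" "x = G u" using xy by blast
    then show ?thesis
      using linear_on_scale[OF G_linear, of u c] scale_in[of u c] by (metis image_eqI)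
  qed
qed

lemma W_linear: "b \<in> W \<Longrightarrow> lin b"
proof (erule W_cases)
  fix c assume c: "c \<in> V" and b: "b = G c"
  have "lin (\<lambda>a. \<phi> (a \<cdot> c))"
    by (intro lin_\<phi> mlin c | assumption)+
  then show "lin b"
    by (rule linear_on_cong[OF _ subspace_carrier]) (simp add: b G_apply)
qed

lemma lin_W: "b \<in> W \<Longrightarrow> linear_on U g \<Longrightarrow> (\<And>x. x \<in> U \<Longrightarrow> g x \<in> V) \<Longrightarrow> linear_on U (\<lambda>x. b (g x))"
  by (rule linear_on_compose[OF _ W_linear])

lemma W_outside: "b \<in> W \<Longrightarrow> a \<notin> V \<Longrightarrow> b a = 0"
  by (auto elim!: W_cases simp: translate_def ext0_def)

lemma W_eqI: "b \<in> W \<Longrightarrow> c \<in> W \<Longrightarrow> (\<And>a. a \<in> V \<Longrightarrow> b a = c a) \<Longrightarrow> b = c"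
  using W_outside by (metis ext)

lemma eval_linear: "linear_on U (\<lambda>f. f a)"
  by (simp add: linear_on_def scaleC_fun_def)

lemma pair_bil: "bilinear_on W W (\<lambda>b b'. b a * b' a')"
  by (intro bilinear_onI linear_on_mult_left linear_on_mult_right eval_linear)

text \<open>Evaluations at the points of \<open>A\<close> separate the points of the dual, hence their products separate the
points of its tensor square.\<close>

lemma dual_tensor_eqI:
  assumes s: "s \<in> WW" and t: "t \<in> WW"
    and e: "\<And>a a'. a \<in> V \<Longrightarrow> a' \<in> V \<Longrightarrow> swB s (\<lambda>b b'. b a * b' a') = swB t (\<lambda>b b'. b a * b' a')"
  shows "s = t"
proof -
  let ?F = "(\<lambda>a b. b a) ` V :: (('a \<Rightarrow> complex) \<Rightarrow> complex) set"
  have l: "linear_on W \<alpha>" if "\<alpha> \<in> ?F" for \<alpha>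
    using that by (auto intro: eval_linear)
  have z: "b = 0" if "b \<in> W" "\<And>\<alpha>. \<alpha> \<in> ?F \<Longrightarrow> \<alpha> b = 0" for b
    using that by (intro W_eqI[OF _ cvs.subspace_0[OF subspace_W]]) auto
  have "s - t = 0"
  proof (rule tensor_eq_0_if_functionals[OF subspace_W subspace_W _ l z l z])
    show "s - t \<in> WW" by (rule cvs.subspace_diff[OF subspace_tensor_space s t])
    show "tensor_lift W W (\<lambda>v w. \<alpha> v * \<beta> w) (s - t) = 0" if ab: "\<alpha> \<in> ?F" "\<beta> \<in> ?F" for \<alpha> \<beta>
    proof -
      obtain a a' where *: "a \<in> V" "a' \<in> V" "\<alpha> = (\<lambda>b. b a)" "\<beta> = (\<lambda>b. b a')"
        using ab by blast
      show ?thesis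
        using e[OF *(1,2)]
          linear_on_diff[OF tensor_lift(1)[OF subspace_W subspace_W pair_bil] subspace_tensor_space s t]
        by (simp add: *(3,4))
    qed
  qed
  then show ?thesis by simp
qed

subsection \<open>The product of the dual\<close>

text \<open>The product of the dual is defined with chosen preimages under \<open>G\<close>. Covering the coproduct on one leg
or the other shows that its value depends only on the functionals, and gives a formula in each of the
two cases in which one factor has a known preimage.\<close>

lemma
  assumes "c \<in> V" "b \<in> W" "a \<in> V"
  shows mul_G_left: "(G c \<cdot>\<^bsub>B\<^esub> b) a = sw (R' a c) (\<lambda>u v. \<phi> u * b v)"
    and mul_G_right: "(b \<cdot>\<^bsub>B\<^esub> G c) a = sw (R a c) (\<lambda>u v. b u * \<phi> v)"
proof -
  have rep: "inv_into V G (G x) \<in> V" "G (inv_into V G (G x)) = G x" if "x \<in> V" for x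
    using that by (auto intro: inv_into_into f_inv_into_f)
  have main: "(G x \<cdot>\<^bsub>B\<^esub> G y) a = sw (D a (x0 \<otimes>\<^sub>t y0)) (\<lambda>p q. \<phi> p * \<phi> q)"
    if "x \<in> V" "y \<in> V" "x0 \<in> V" "y0 \<in> V" "G x0 = G x" "G y0 = G y" for x y x0 y0
  proof -
    let ?x = "inv_into V G (G x)" and ?y = "inv_into V G (G y)"
    note r = rep[OF that(1)] rep[OF that(2)]
    have x: "\<phi> (u \<cdot> ?x) = \<phi> (u \<cdot> x0)" if "u \<in> V" for u
      by (simp only: G_apply[OF that, symmetric] r(2) \<open>G x0 = G x\<close>)
    have y: "\<phi> (u \<cdot> ?y) = \<phi> (u \<cdot> y0)" if "u \<in> V" for u
      by (simp only: G_apply[OF that, symmetric] r(4) \<open>G y0 = G y\<close>)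
    have b: "bil (\<lambda>p q. \<phi> p * \<phi> q)"
      by (intro multilin lin_\<phi> | assumption)+
    have "(G x \<cdot>\<^bsub>B\<^esub> G y) a = sw (D a (?x \<otimes>\<^sub>t ?y)) (\<lambda>p q. \<phi> p * \<phi> q)"
      using assms(3) by (simp add: B_def dual_alg_def dual_mul_def Let_def ext0_def)
    also have "\<dots> = sw (R a ?y) (\<lambda>u v. \<phi> (u \<cdot> ?x) * \<phi> v)"
      by (rule sw_D(1)[OF b assms(3) r(1,3)])
    also have "\<dots> = sw (R a ?y) (\<lambda>u v. \<phi> (u \<cdot> x0) * \<phi> v)"
      by (intro tensor_lift_cong) (simp add: x)
    also have "\<dots> = sw (R' a x0) (\<lambda>u v. \<phi> u * \<phi> (v \<cdot> ?y))"
      by (rule sw_R_R'[OF b assms(3) that(3) r(3)])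
    also have "\<dots> = sw (R' a x0) (\<lambda>u v. \<phi> u * \<phi> (v \<cdot> y0))"
      by (intro tensor_lift_cong) (simp add: y)
    also have "\<dots> = sw (D a (x0 \<otimes>\<^sub>t y0)) (\<lambda>p q. \<phi> p * \<phi> q)"
      by (rule sw_D(2)[OF b assms(3) that(3,4), symmetric])
    finally show ?thesis .
  qed
  have b: "bil (\<lambda>p q. \<phi> p * \<phi> q)"
    by (intro multilin lin_\<phi> | assumption)+
  obtain d where d: "d \<in> V" "b = G d" using assms(2) by (rule W_cases)
  show "(G c \<cdot>\<^bsub>B\<^esub> b) a = sw (R' a c) (\<lambda>u v. \<phi> u * b v)"
    unfolding d(2) main[OF assms(1) d(1) assms(1) d(1) refl refl] sw_D(2)[OF b assms(3,1) d(1)]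
    by (intro tensor_lift_cong) (simp add: G_apply)
  show "(b \<cdot>\<^bsub>B\<^esub> G c) a = sw (R a c) (\<lambda>u v. b u * \<phi> v)"
    unfolding d(2) main[OF d(1) assms(1) d(1) assms(1) refl refl] sw_D(1)[OF b assms(3) d(1) assms(1)]
    by (intro tensor_lift_cong) (simp add: G_apply)
qed

lemma dual_mul_outside: "a \<notin> V \<Longrightarrow> (b \<cdot>\<^bsub>B\<^esub> c) a = 0"
  by (simp add: B_def dual_alg_def dual_mul_def Let_def ext0_def)

lemma dual_mul_bilinear: "bilinear_on W W (\<lambda>b c. b \<cdot>\<^bsub>B\<^esub> c)"
proof -
  have ext: "linear_on W f" if "\<And>a. a \<in> V \<Longrightarrow> linear_on W (\<lambda>x. f x a)" "\<And>x a. a \<notin> V \<Longrightarrow> f x a = 0"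
    for f :: "('a \<Rightarrow> complex) \<Rightarrow> 'a \<Rightarrow> complex"
  proof (rule linear_onI)
    fix u v c assume uv: "u \<in> W" "v \<in> W"
    show "f (u + v) = f u + f v"
    proof
      fix a show "f (u + v) a = (f u + f v) a"
        by (cases "a \<in> V") (simp_all add: linear_on_add[OF that(1) uv] that(2))
    qed
    show "f (c *\<^sub>C v) = c *\<^sub>C f v"
    proof
      fix a show "f (c *\<^sub>C v) a = (c *\<^sub>C f v) a"
        by (cases "a \<in> V") (simp_all add: linear_on_scale[OF that(1) uv(2)] that(2) scaleC_apply)
    qed
  qed
  show ?thesis
  proof (intro bilinear_onI ext dual_mul_outside)
    fix b a assume b: "b \<in> W" and a: "a \<in> V"
    obtain c where c: "c \<in> V" "b = G c" using b by (rule W_cases)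
    have "linear_on W (\<lambda>x. sw (R' a c) (\<lambda>u v. \<phi> u * x v))"
      by (intro multilin lin_\<phi> lin_W eval_linear a c subspace_W | assumption)+
    then show "linear_on W (\<lambda>x. (b \<cdot>\<^bsub>B\<^esub> x) a)"
      by (rule linear_on_cong[OF _ subspace_W]) (simp add: c mul_G_left a)
    have "linear_on W (\<lambda>x. sw (R a c) (\<lambda>u v. x u * \<phi> v))"
      by (intro multilin lin_\<phi> lin_W eval_linear a c subspace_W | assumption)+
    then show "linear_on W (\<lambda>x. (x \<cdot>\<^bsub>B\<^esub> b) a)"
      by (rule linear_on_cong[OF _ subspace_W]) (simp add: c mul_G_right a)
  qed assumption+
qed

lemma RB_in: "b \<in> W \<Longrightarrow> c \<in> W \<Longrightarrow> RB b c \<in> WW"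
  and LB_in: "b \<in> W \<Longrightarrow> c \<in> W \<Longrightarrow> LB b c \<in> WW"
proof -
  assume "b \<in> W" "c \<in> W"
  then have "in_alg (B \<otimes>\<^sub>a B) (\<Delta>' b \<cdot>\<^bsub>mult_alg2 B\<^esub> leg2 B c)" "in_alg (B \<otimes>\<^sub>a B) (leg1 B b \<cdot>\<^bsub>mult_alg2 B\<^esub> \<Delta>' c)"
    using dual_comult by (simp_all add: is_dual_comult_def)
  then show "RB b c \<in> WW" "LB b c \<in> WW"
    unfolding comult_r_def comult_l_def unembed_def in_alg_def
    using inv_into_into[of _ "embed (B \<otimes>\<^sub>a B)" "carr (B \<otimes>\<^sub>a B)"] by (simp_all add: alg_tensor_def)
qed

lemma pair2_tens_left:
  assumes "s \<in> WW" "a \<in> V" "a' \<in> V"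
  shows "pair2 A B (a \<otimes>\<^sub>t a') s = swB s (\<lambda>b b'. b a * b' a')"
  unfolding pair2_def
  by (rule sw_tens[where f = "\<lambda>a a'. swB s (\<lambda>b b'. b a * b' a')"])
    (intro bilinear_onI linear_on_tensor_lift_map[OF subspace_W subspace_W assms(1)] pair_bil
      linear_on_mult_left linear_on_mult_right W_linear subspace_carrier assms
    | assumption)+

lemma pair2_tens_right:
  assumes "b \<in> W" "b' \<in> W"
  shows "pair2 A B t (b \<otimes>\<^sub>t b') = sw t (\<lambda>u v. b u * b' v)"
  unfolding pair2_def
  by (intro tensor_lift_cong tensor_lift(2)[OF subspace_W subspace_W pair_bil] assms)

lemma RB_pairing:
  assumes "b \<in> W" "b' \<in> W" "a \<in> V" "a' \<in> V"
  shows "swB (RB b b') (\<lambda>p q. p a * q a') = sw (L a a') (\<lambda>u v. b u * b' v)"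
  using dual_comult assms
  by (simp add: is_dual_comult_def pair2_tens_left[symmetric] RB_in pair2_tens_right[symmetric])

lemma LB_pairing:
  assumes "b \<in> W" "b' \<in> W" "a \<in> V" "a' \<in> V"
  shows "swB (LB b' b) (\<lambda>p q. p a * q a') = sw (R a a') (\<lambda>u v. b' u * b v)"
  using dual_comult assms
  by (simp add: is_dual_comult_def pair2_tens_left[symmetric] LB_in pair2_tens_right[symmetric])

subsection \<open>The first Galois map of the dual\<close>

lemma \<phi>_nonzero: obtains c where "c \<in> V" "\<phi> c \<noteq> 0"
  using \<phi> by (auto simp: left_integral_def)

lemma functional_of_slice:
  assumes "lin \<alpha>" "lin \<beta>" "t \<in> VV"
  shows "\<alpha> (sw t (\<lambda>u v. \<beta> v *\<^sub>C u)) = sw t (\<lambda>u v. \<alpha> u * \<beta> v :: complex)"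
    and "\<beta> (sw t (\<lambda>u v. \<alpha> u *\<^sub>C v)) = sw t (\<lambda>u v. \<alpha> u * \<beta> v :: complex)"
proof -
  have "\<alpha> (sw t (\<lambda>u v. \<beta> v *\<^sub>C u)) = sw t (\<lambda>u v. \<alpha> (\<beta> v *\<^sub>C u))"
    by (rule sw_out[where Z = V]) (intro multilin scale_in assms | assumption)+
  then show "\<alpha> (sw t (\<lambda>u v. \<beta> v *\<^sub>C u)) = sw t (\<lambda>u v. \<alpha> u * \<beta> v :: complex)"
    by (simp add: linear_on_scale[OF assms(1)] scaleC_complex_def mult.commute cong: tensor_lift_cong)
  have "\<beta> (sw t (\<lambda>u v. \<alpha> u *\<^sub>C v)) = sw t (\<lambda>u v. \<beta> (\<alpha> u *\<^sub>C v))"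
    by (rule sw_out[where Z = V]) (intro multilin scale_in assms | assumption)+
  then show "\<beta> (sw t (\<lambda>u v. \<alpha> u *\<^sub>C v)) = sw t (\<lambda>u v. \<alpha> u * \<beta> v :: complex)"
    by (simp add: linear_on_scale[OF assms(2)] scaleC_complex_def cong: tensor_lift_cong)
qed

lemma sw_sum:
  assumes "bil f" "\<And>i. i < n \<Longrightarrow> c i \<in> V" "\<And>i. i < n \<Longrightarrow> c' i \<in> V"
  shows "sw (\<Sum>i<n::nat. c i \<otimes>\<^sub>t c' i) f = (\<Sum>i<n. f (c i) (c' i))"
  using assms by (subst linear_on_sum[OF sw_linear[OF assms(1)] subspace_tensor_space])
    (auto simp: tens_in sw_tens)

text \<open>Left invariance under a functional on the first leg.\<close>

lemma integral_R':
  assumes "lin \<alpha>" "a \<in> V" "s \<in> V"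
  shows "sw (R' a s) (\<lambda>u v. \<alpha> u * \<phi> v) = \<phi> a * \<alpha> s"
  using functional_of_slice(1)[OF assms(1) \<phi>_linear R'_in[OF assms(2,3)]] left_invariant[OF \<phi> assms(2,3)]
  by (simp add: linear_on_scale[OF assms(1) assms(3)] scaleC_complex_def)

text \<open>The nested sum is \<open>\<alpha> \<otimes> \<phi>\<close> applied to \<open>\<Delta>(a) \<Delta>(r) (s \<otimes> 1) = \<Delta>(a r)(s \<otimes> 1)\<close>.\<close>

lemma sw_R'_R'_integral:
  assumes "lin \<alpha>" "a \<in> V" "r \<in> V" "s \<in> V"
  shows "sw (R' r s) (\<lambda>c c'. sw (R' a c) (\<lambda>u v. \<alpha> u * \<phi> (v \<cdot> c'))) = \<phi> (a \<cdot> r) * \<alpha> s"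
proof -
  have b: "bil (\<lambda>u v. \<alpha> u * \<phi> v)"
    by (intro multilin \<phi>_linear assms(1))
  have "sw (R' r s) (\<lambda>c c'. sw (R' a c) (\<lambda>u v. \<alpha> u * \<phi> (v \<cdot> c')))
      = sw (R' r s) (\<lambda>c c'. sw (R a c') (\<lambda>u v. \<alpha> (u \<cdot> c) * \<phi> v))"
    by (intro tensor_lift_cong sw_R_R'[symmetric, OF b] assms)
  also have "\<dots> = sw (R' (a \<cdot> r) s) (\<lambda>u v. \<alpha> u * \<phi> v)"
    by (rule sw_R_mul_left(2)[symmetric, OF b assms(2-4)])
  finally show ?thesis
    by (simp add: integral_R' assms mul_in)
qed

text \<open>At \<open>a \<otimes> a'\<close> the left-hand side is \<open>\<phi> \<otimes> \<phi>\<close> applied to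
\<open>(a \<otimes> 1) \<Delta>(a') \<Delta>(r) (s \<otimes> 1) = (a \<otimes> 1) \<Delta>(a' r) (s \<otimes> 1)\<close>, and left invariance evaluates it. The
sum is indexed by a decomposition of \<open>R' r s\<close> because the linearity of \<open>RB\<close> in its arguments is not
part of the definition of a dual coproduct.\<close>

lemma dual_galois_R':
  assumes rs: "r \<in> V" "s \<in> V" and c: "\<And>i. i < n \<Longrightarrow> c i \<in> V" "\<And>i. i < n \<Longrightarrow> c' i \<in> V"
    and R: "R' r s = (\<Sum>i<n::nat. c i \<otimes>\<^sub>t c' i)"
  shows "(\<Sum>i<n. RB (G (c i)) (G (c' i))) = G s \<otimes>\<^sub>t G r"
proof (rule dual_tensor_eqI)
  have in_WW: "RB (G (c i)) (G (c' i)) \<in> WW" if "i < n" for i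
    using that c by (intro RB_in G_in)
  then show "(\<Sum>i<n. RB (G (c i)) (G (c' i))) \<in> WW"
    by (intro cvs.subspace_sum[OF subspace_tensor_space]) auto
  show "G s \<otimes>\<^sub>t G r \<in> WW" by (intro tens_in G_in rs)
  fix a a' assume a: "a \<in> V" "a' \<in> V"
  have l: "lin (\<lambda>u. \<phi> (a \<cdot> u))" by (intro lin_\<phi> multilin a | assumption)+
  have b: "bil (\<lambda>c c'. sw (L a a') (\<lambda>u v. \<phi> (u \<cdot> c) * \<phi> (v \<cdot> c')))"
    by (intro lin_\<phi> multilin a | assumption)+
  have "swB (\<Sum>i<n. RB (G (c i)) (G (c' i))) (\<lambda>p q. p a * q a') = (\<Sum>i<n. swB (RB (G (c i)) (G (c' i))) (\<lambda>p q. p a * q a'))"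
    using in_WW by (intro linear_on_sum[OF tensor_lift(1)[OF subspace_W subspace_W pair_bil] subspace_tensor_space]) auto
  also have "\<dots> = (\<Sum>i<n. sw (L a a') (\<lambda>u v. \<phi> (u \<cdot> c i) * \<phi> (v \<cdot> c' i)))"
    using c by (intro sum.cong refl) (simp add: RB_pairing G_in a G_apply cong: tensor_lift_cong)
  also have "\<dots> = sw (R' r s) (\<lambda>c c'. sw (L a a') (\<lambda>u v. \<phi> (u \<cdot> c) * \<phi> (v \<cdot> c')))"
    unfolding R by (rule sw_sum[symmetric, OF b c])
  also have "\<dots> = sw (R' r s) (\<lambda>c c'. sw (R' a' c) (\<lambda>u v. \<phi> (a \<cdot> u) * \<phi> (v \<cdot> c')))"
    by (intro tensor_lift_cong sw_R_L(2)[symmetric, where f = "\<lambda>u v. \<phi> u * \<phi> (v \<cdot> _)"])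
      (intro lin_\<phi> multilin a | assumption)+
  also have "\<dots> = \<phi> (a' \<cdot> r) * \<phi> (a \<cdot> s)"
    by (rule sw_R'_R'_integral[OF l a(2) rs])
  also have "\<dots> = swB (G s \<otimes>\<^sub>t G r) (\<lambda>p q. p a * q a')"
    using a by (simp add: tensor_lift(2)[OF subspace_W subspace_W pair_bil] G_in rs G_apply)
  finally show "swB (\<Sum>i<n. RB (G (c i)) (G (c' i))) (\<lambda>p q. p a * q a') = swB (G s \<otimes>\<^sub>t G r) (\<lambda>p q. p a * q a')" .
qed

lemma dual_galois_R'_lift:
  assumes rs: "r \<in> V" "s \<in> V" and c: "\<And>i. i < n \<Longrightarrow> c i \<in> V" "\<And>i. i < n \<Longrightarrow> c' i \<in> V"
    and R: "R' r s = (\<Sum>i<n::nat. c i \<otimes>\<^sub>t c' i)" and f: "bilinear_on W W f"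
  shows "(\<Sum>i<n. swB (RB (G (c i)) (G (c' i))) f) = f (G s) (G r)"
proof -
  have "swB (\<Sum>i<n. RB (G (c i)) (G (c' i))) f = (\<Sum>i<n. swB (RB (G (c i)) (G (c' i))) f)"
    using c by (intro linear_on_sum[OF tensor_lift(1)[OF subspace_W subspace_W f] subspace_tensor_space] RB_in G_in) auto
  moreover have "(\<Sum>i<n. RB (G (c i)) (G (c' i))) = G s \<otimes>\<^sub>t G r"
    by (rule dual_galois_R'[OF rs c R])
  ultimately show ?thesis
    by (simp add: tensor_lift(2)[OF subspace_W subspace_W f] G_in rs)
qed

lemma sw_zero: "t \<in> VV \<Longrightarrow> sw t (\<lambda>u v. 0) = 0"
  using sw_out[of "(\<otimes>\<^sub>t)" VV "\<lambda>_. 0" t]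
  by (simp add: subspace_tensor_space tens_in linear_on_def bilinear_on_def
      tens_add_left tens_add_right tens_scale_left tens_scale_right)

text \<open>If \<open>\<phi>\<close> vanished on all products, then \<open>left_integral_antipode\<close> would give \<open>\<phi>(v) S(u) s = 0\<close> for all
\<open>u\<close>, \<open>v\<close> and \<open>s\<close>, and \<open>A\<close> would be zero.\<close>

lemma \<phi>_mul_nonzero: obtains a r where "a \<in> V" "r \<in> V" "\<phi> (a \<cdot> r) \<noteq> 0"
proof (rule ccontr)
  assume "\<not> thesis"
  with that have z: "\<phi> (a \<cdot> r) = 0" if "a \<in> V" "r \<in> V" for a r using that by blast
  obtain c where c: "c \<in> V" "\<phi> c \<noteq> 0" by (rule \<phi>_nonzero)
  have "\<phi> v *\<^sub>C (S u \<cdot> s) = 0" if u: "u \<in> V" "v \<in> V" "s \<in> V" for u v s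
  proof (rule eq_if_eq_on_R[where f = "\<lambda>u v. \<phi> v *\<^sub>C (S u \<cdot> s)" and g = "\<lambda>u v. 0"])
    show "bil (\<lambda>u v. \<phi> v *\<^sub>C (S u \<cdot> s))" by (intro mlin lin_\<phi> u | assumption)+
    show b0: "bil (\<lambda>u v. 0 :: 'a)" by (simp add: bilinear_on_def linear_on_def)
    fix a b assume a: "a \<in> V" "b \<in> V"
    show "sw (R a b) (\<lambda>u v. \<phi> v *\<^sub>C (S u \<cdot> s)) = sw (R a b) (\<lambda>u v. 0)"
      unfolding left_integral_antipode[OF \<phi> a u(3)]
      using a u by (simp add: z sw_zero R_in R'_in cong: tensor_lift_cong)
  qed (use u in auto)
  then have "S c \<cdot> s = 0" if "s \<in> V" for s
    using c that by (metis cvs.scale_eq_0_iff)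
  then have "S c = 0" using eq_0_if_right_mul_0[OF S_in[OF c(1)]] by simp
  then have "c = 0" using T_S[OF c(1)] linear_on_zero[OF T_linear subspace_carrier] by simp
  then show False using c(2) linear_on_zero[OF \<phi>_linear subspace_carrier] by simp
qed

subsection \<open>The counit and the antipode of the dual\<close>

lemma R'_cases:
  assumes "r \<in> V" "s \<in> V"
  obtains n :: nat and c c' where "\<And>i. i < n \<Longrightarrow> c i \<in> V" "\<And>i. i < n \<Longrightarrow> c' i \<in> V"
    "R' r s = (\<Sum>i<n. c i \<otimes>\<^sub>t c' i)"
  using sw_cases[OF R'_in[OF assms]] by blast

lemma \<epsilon>'_linear: "linear_on W \<epsilon>'"
  using counit' by (simp add: is_counit_def alg_hom_def)

lemma sum_apply: "(\<Sum>i\<in>I. f i) a = (\<Sum>i\<in>I. f i a)"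
  by (induction I rule: infinite_finite_induct) simp_all

text \<open>The counit equation of the dual, summed over a decomposition of \<open>R' r s\<close>, says that
\<open>\<epsilon>'(G(s)) G(r)\<close> is the sum of the products \<open>G(c) G(c')\<close>; left invariance identifies this sum with
\<open>\<phi>(s) G(r)\<close>.\<close>

lemma counit_dual:
  assumes s: "s \<in> V"
  shows "\<epsilon>' (G s) = \<phi> s"
proof -
  obtain a r where a: "a \<in> V" "r \<in> V" "\<phi> (a \<cdot> r) \<noteq> 0" by (rule \<phi>_mul_nonzero)
  obtain n :: nat and c c' where c: "\<And>i. i < n \<Longrightarrow> c i \<in> V" "\<And>i. i < n \<Longrightarrow> c' i \<in> V"
    and R: "R' r s = (\<Sum>i<n. c i \<otimes>\<^sub>t c' i)" using R'_cases[OF a(2) s] by blast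
  have f: "bilinear_on W W (\<lambda>p q. \<epsilon>' p *\<^sub>C q)"
    by (intro bilinear_onI linear_on_scaleC_left linear_on_scaleC_right \<epsilon>'_linear linear_on_ident)
  have "\<epsilon>' (G s) *\<^sub>C G r = (\<Sum>i<n. swB (RB (G (c i)) (G (c' i))) (\<lambda>p q. \<epsilon>' p *\<^sub>C q))"
    by (rule dual_galois_R'_lift[OF a(2) s c R f, symmetric])
  also have "\<dots> = (\<Sum>i<n. G (c i) \<cdot>\<^bsub>B\<^esub> G (c' i))"
    using counit' c by (intro sum.cong refl) (simp add: is_counit_def G_in)
  finally have "(\<epsilon>' (G s) *\<^sub>C G r) a = (\<Sum>i<n. G (c i) \<cdot>\<^bsub>B\<^esub> G (c' i)) a"
    by simp
  then have "\<epsilon>' (G s) * \<phi> (a \<cdot> r) = (\<Sum>i<n. (G (c i) \<cdot>\<^bsub>B\<^esub> G (c' i)) a)"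
    using a by (simp add: scaleC_apply G_apply scaleC_complex_def sum_apply)
  also have "\<dots> = (\<Sum>i<n. sw (R' a (c i)) (\<lambda>u v. \<phi> u * \<phi> (v \<cdot> c' i)))"
    using c a by (intro sum.cong refl) (simp add: mul_G_left G_in G_apply cong: tensor_lift_cong)
  also have "\<dots> = sw (R' r s) (\<lambda>c c'. sw (R' a c) (\<lambda>u v. \<phi> u * \<phi> (v \<cdot> c')))"
    unfolding R by (rule sw_sum[symmetric, OF _ c]) (intro lin_\<phi> multilin a | assumption)+
  also have "\<dots> = \<phi> s * \<phi> (a \<cdot> r)"
    by (simp add: sw_R'_R'_integral[OF \<phi>_linear a(1,2) s])
  finally show ?thesis using a(3) by simp
qed

lemma S'_in: "b \<in> W \<Longrightarrow> S' b \<in> W"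
  using S'_bij by (auto simp: bij_betw_def)

text \<open>The antipode equation, summed over a decomposition of \<open>R' r s\<close>, determines the product of \<open>S'(G(s))\<close>
with \<open>G(r)\<close>. By \<open>left_integral_antipode\<close> the value of this product at \<open>a\<close> is that of \<open>(G(s) \<circ> S) \<otimes> \<phi>\<close>
at \<open>R a r\<close>. It is also the value of \<open>S'(G(s)) \<otimes> \<phi>\<close> there, and the elements \<open>R a r\<close> span \<open>A \<otimes> A\<close>.\<close>

lemma antipode_dual:
  assumes b: "b \<in> W" and u: "u \<in> V"
  shows "S' b u = b (S u)"
proof -
  obtain s where s: "s \<in> V" "b = G s" using b by (rule W_cases)
  obtain v where v: "v \<in> V" "\<phi> v \<noteq> 0" by (rule \<phi>_nonzero)
  have f: "bilinear_on W W (\<lambda>p q. S' p \<cdot>\<^bsub>B\<^esub> q)"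
    by (intro bilinear_onI linear_on_compose[OF S'_linear bilinear_on_left[OF dual_mul_bilinear]]
      bilinear_on_right[OF dual_mul_bilinear] S'_in | assumption)+
  have "S' (G s) u * \<phi> v = \<phi> (S u \<cdot> s) * \<phi> v"
  proof (rule eq_if_eq_on_R[where f = "\<lambda>u v. S' (G s) u * \<phi> v" and g = "\<lambda>u v. \<phi> (S u \<cdot> s) * \<phi> v"])
    show "bil (\<lambda>u v. S' (G s) u * \<phi> v)"
      by (intro multilin W_linear S'_in G_in \<phi>_linear s)
    show "bil (\<lambda>u v. \<phi> (S u \<cdot> s) * \<phi> v)"
      by (intro mlin lin_\<phi> s | assumption)+
    fix a r assume a: "a \<in> V" "r \<in> V"
    obtain n :: nat and c c' where c: "\<And>i. i < n \<Longrightarrow> c i \<in> V" "\<And>i. i < n \<Longrightarrow> c' i \<in> V"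
      and R: "R' r s = (\<Sum>i<n. c i \<otimes>\<^sub>t c' i)" using R'_cases[OF a(2) s(1)] by blast
    have l: "lin (\<lambda>v. \<phi> (a \<cdot> v))" by (intro mlin lin_\<phi> a | assumption)+
    have l': "lin (\<lambda>u. \<phi> (u \<cdot> s))" by (intro mlin lin_\<phi> s | assumption)+
    have "S' (G s) \<cdot>\<^bsub>B\<^esub> G r = (\<Sum>i<n. swB (RB (G (c i)) (G (c' i))) (\<lambda>p q. S' p \<cdot>\<^bsub>B\<^esub> q))"
      by (rule dual_galois_R'_lift[OF a(2) s(1) c R f, symmetric])
    also have "\<dots> = (\<Sum>i<n. \<phi> (c i) *\<^sub>C G (c' i))"
      using c by (intro sum.cong refl) (simp add: S'_R G_in counit_dual)
    finally have "(S' (G s) \<cdot>\<^bsub>B\<^esub> G r) a = (\<Sum>i<n. \<phi> (c i) * \<phi> (a \<cdot> c' i))"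
      using a by (simp add: sum_apply scaleC_apply scaleC_complex_def G_apply)
    also have "\<dots> = sw (R' r s) (\<lambda>u v. \<phi> u * \<phi> (a \<cdot> v))"
      unfolding R by (rule sw_sum[symmetric, OF _ c]) (intro lin_\<phi> multilin a | assumption)+
    also have "\<dots> = \<phi> (sw (R' r s) (\<lambda>u v. \<phi> (a \<cdot> v) *\<^sub>C u))"
      by (rule functional_of_slice(1)[symmetric, OF \<phi>_linear l R'_in[OF a(2) s(1)]])
    also have "\<dots> = \<phi> (sw (R a r) (\<lambda>u v. \<phi> v *\<^sub>C (S u \<cdot> s)))"
      by (simp only: left_integral_antipode[OF \<phi> a s(1)])
    also have "\<dots> = sw (R a r) (\<lambda>u v. \<phi> (\<phi> v *\<^sub>C (S u \<cdot> s)))"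
      by (rule sw_out[OF _ \<phi>_linear]) (intro mlin lin_\<phi> a s | assumption)+
    also have "\<dots> = sw (R a r) (\<lambda>u v. \<phi> (S u \<cdot> s) * \<phi> v)"
      using s by (intro tensor_lift_cong)
        (simp add: linear_on_scale[OF \<phi>_linear] mul_in S_in scaleC_complex_def)
    finally show "sw (R a r) (\<lambda>u v. S' (G s) u * \<phi> v) = sw (R a r) (\<lambda>u v. \<phi> (S u \<cdot> s) * \<phi> v)"
      using a s by (simp add: mul_G_right S'_in G_in)
  qed (use u v in auto)
  then show ?thesis using v u s by (simp add: G_apply S_in)
qed

section \<open>The Fourier transform of a coproduct\<close>

text \<open>Write \<open>\<Delta>(x)(1 \<otimes> y)\<close> as a sum of elements \<open>\<Delta>(p)(q \<otimes> 1)\<close> and multiply by \<open>\<Delta>(a)\<close> from the left.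
Applying \<open>\<psi> \<otimes> \<phi>\<close>, the right invariance of \<open>\<psi>\<close> gives \<open>\<psi>(a x) \<phi>(y)\<close> and the left invariance of \<open>\<phi>\<close>
gives the sum of the \<open>\<phi>(a p) \<psi>(q)\<close>, for every \<open>a\<close>.\<close>

lemma translate_right_integral_in:
  assumes \<psi>: "right_integral A \<Delta> \<psi>" and x: "x \<in> V"
  shows "translate A \<psi> x \<in> W"
proof -
  have l: "lin \<psi>" using \<psi> by (simp add: right_integral_def)
  note ms = mlin linear_on_compose[OF _ l] lin_\<phi>
  obtain y where y: "y \<in> V" "\<phi> y \<noteq> 0" by (rule \<phi>_nonzero)
  obtain z where z: "z \<in> VV" "R x y = sw z (\<lambda>p q. R' p q)"
    using R'_onto[OF R_in[OF x y(1)]] by blast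
  define c where "c = sw z (\<lambda>p q. \<psi> q *\<^sub>C p)"
  have c: "c \<in> V" unfolding c_def by (intro sw_in_carrier ms z | assumption)+
  have b: "bil (\<lambda>u v. \<psi> u * \<phi> v)" by (intro multilin l \<phi>_linear)
  \<comment> \<open>\<open>y\<close> with \<open>\<phi>(y) \<noteq> 0\<close> is an auxiliary cover; dividing by \<open>\<phi>(y)\<close> removes it at the end.\<close>
  have key: "\<phi> (a \<cdot> c) = \<psi> (a \<cdot> x) * \<phi> y" if a: "a \<in> V" for a
  proof -
    have "\<psi> (a \<cdot> x) * \<phi> y = \<phi> (sw (R (a \<cdot> x) y) (\<lambda>u v. \<psi> u *\<^sub>C v))"
      using a x y by (simp add: right_invariant[OF \<psi>] mul_in linear_on_scale[OF \<phi>_linear] scaleC_complex_def)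
    also have "\<dots> = sw (R (a \<cdot> x) y) (\<lambda>u v. \<psi> u * \<phi> v)"
      by (rule functional_of_slice(2)[OF l \<phi>_linear R_in]) (intro mul_in a x y)+
    also have "\<dots> = sw (D a (sw z (\<lambda>p q. R' p q))) (\<lambda>u v. \<psi> u * \<phi> v)"
      using a x y by (simp add: R_mul_left z(2))
    also have "\<dots> = sw (sw z (\<lambda>p q. D a (R' p q))) (\<lambda>u v. \<psi> u * \<phi> v)"
      by (subst sw_out[OF R'_bilinear D_multiplier(1)[OF a] R'_in subspace_tensor_space z(1)]) simp_all
    also have "\<dots> = sw (sw z (\<lambda>p q. R' (a \<cdot> p) q)) (\<lambda>u v. \<psi> u * \<phi> v)"
      by (intro arg_cong[where f = "\<lambda>t. sw t _"] tensor_lift_cong R'_mul_left[symmetric] a)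
    also have "\<dots> = sw z (\<lambda>p q. sw (R' (a \<cdot> p) q) (\<lambda>u v. \<psi> u * \<phi> v))"
      by (rule sw_sw) (intro b ms a z(1) | assumption)+
    also have "\<dots> = sw z (\<lambda>p q. \<phi> (a \<cdot> (\<psi> q *\<^sub>C p)))"
      using a by (intro tensor_lift_cong)
        (simp add: integral_R'[OF l] mul_in mul_scale linear_on_scale[OF \<phi>_linear] scaleC_complex_def
          mult.commute[of "\<phi> _" "\<psi> _"])
    also have "\<dots> = \<phi> (a \<cdot> c)"
      unfolding c_def by (rule sw_out[symmetric, where L = "\<lambda>p. \<phi> (a \<cdot> p)" and Z = V])
        (intro ms a z(1) | assumption)+
    finally show ?thesis ..
  qed
  have "translate A \<psi> x = G ((1 / \<phi> y) *\<^sub>C c)"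
    using y(2) c by (auto simp: fun_eq_iff translate_def ext0_def key mul_scale linear_on_scale[OF \<phi>_linear]
      scaleC_complex_def mul_in)
  then show ?thesis by (simp add: G_in scale_in c)
qed

lemma mul_translate_right_integral:
  assumes \<psi>: "right_integral A \<Delta> \<psi>" and x: "x \<in> V" and b: "b \<in> W" and a: "a \<in> V"
  shows "(translate A \<psi> x \<cdot>\<^bsub>B\<^esub> b) a = sw (R' a x) (\<lambda>u v. \<psi> u * b v)"
proof -
  have l: "lin \<psi>" using \<psi> by (simp add: right_integral_def)
  obtain c where c: "c \<in> V" "b = G c" using b by (rule W_cases)
  have "(translate A \<psi> x \<cdot>\<^bsub>B\<^esub> b) a = sw (R a c) (\<lambda>u v. \<psi> (u \<cdot> x) * \<phi> v)"
    unfolding c(2) using c x a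
    by (simp add: mul_G_right translate_right_integral_in[OF \<psi>] translate_apply cong: tensor_lift_cong)
  also have "\<dots> = sw (R' a x) (\<lambda>u v. \<psi> u * \<phi> (v \<cdot> c))"
    by (rule sw_R_R'[where f = "\<lambda>u v. \<psi> u * \<phi> v"]) (intro multilin l \<phi>_linear a x c)+
  also have "\<dots> = sw (R' a x) (\<lambda>u v. \<psi> u * b v)"
    by (intro tensor_lift_cong) (simp add: c G_apply)
  finally show ?thesis .
qed

text \<open>The pairing of \<open>\<Delta>(a)(1 \<otimes> a')\<close> with \<open>b \<otimes> b'\<close> is a product in the dual as soon as \<open>b'(\<cdot> a')\<close> lies
there.\<close>

lemma dual_mul_covered:
  assumes "b \<in> W" "b' \<in> W" "w \<in> W" "a \<in> V" "a' \<in> V" "\<And>v. v \<in> V \<Longrightarrow> w v = b' (v \<cdot> a')"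
  shows "(b \<cdot>\<^bsub>B\<^esub> w) a = sw (R a a') (\<lambda>u v. b u * b' v)"
proof -
  obtain c where c: "c \<in> V" "b = G c" using assms(1) by (rule W_cases)
  have "(b \<cdot>\<^bsub>B\<^esub> w) a = sw (R' a c) (\<lambda>u v. \<phi> u * b' (v \<cdot> a'))"
    unfolding c(2) using c assms by (simp add: mul_G_left cong: tensor_lift_cong)
  also have "\<dots> = sw (R a a') (\<lambda>u v. \<phi> (u \<cdot> c) * b' v)"
    by (rule sw_R_R'[symmetric, where f = "\<lambda>u v. \<phi> u * b' v"])
      (intro multilin \<phi>_linear W_linear assms c)+
  also have "\<dots> = sw (R a a') (\<lambda>u v. b u * b' v)"
    by (intro tensor_lift_cong) (simp add: c G_apply)
  finally show ?thesis .
qed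

text \<open>By the counit equation, a product in the dual is a slice of an element of its tensor square.\<close>

lemma dual_mul_in:
  assumes "b \<in> W" "c \<in> W" shows "b \<cdot>\<^bsub>B\<^esub> c \<in> W"
proof -
  have "swB (RB b c) (\<lambda>p q. \<epsilon>' p *\<^sub>C q) \<in> W"
    by (rule tensor_lift_in[OF subspace_W subspace_W subspace_W _ _ RB_in[OF assms]])
      (intro bilinear_onI linear_on_scaleC_left linear_on_scaleC_right \<epsilon>'_linear linear_on_ident
        cvs.subspace_scale[OF subspace_W] | assumption)+
  then show ?thesis using counit' assms by (simp add: is_counit_def)
qed

lemma fourier_eq:
  assumes \<psi>: "right_integral A \<Delta> \<psi>" and x: "x \<in> V"
  shows "fourier A S \<psi> x = S' (translate A \<psi> x)"
proof
  fix a
  show "fourier A S \<psi> x a = S' (translate A \<psi> x) a"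
    using translate_right_integral_in[OF \<psi> x]
    by (cases "a \<in> V") (simp_all add: antipode_dual S_in W_outside[OF S'_in] fourier_def translate_def ext0_def)
qed

lemma fourier_apply: "a \<in> V \<Longrightarrow> fourier A S \<psi> x a = \<psi> (S a \<cdot> x)"
  by (simp add: fourier_def ext0_def)

lemma fourier_linear:
  assumes \<psi>: "right_integral A \<Delta> \<psi>"
  shows "lin (fourier A S \<psi>)"
proof (rule linear_onI)
  have l: "lin \<psi>" using \<psi> by (simp add: right_integral_def)
  have l': "lin (\<lambda>x. \<psi> (S a \<cdot> x))" if "a \<in> V" for a
    by (intro mlin linear_on_compose[OF _ l] that | assumption)+
  show "fourier A S \<psi> (u + v) = fourier A S \<psi> u + fourier A S \<psi> v" if "u \<in> V" "v \<in> V" for u v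
    using linear_on_add[OF l' that] by (auto simp: fun_eq_iff fourier_def ext0_def)
  show "fourier A S \<psi> (c *\<^sub>C v) = c *\<^sub>C fourier A S \<psi> v" if "v \<in> V" for c v
    using linear_on_scale[OF l' that] by (auto simp: fun_eq_iff fourier_def ext0_def scaleC_fun_def)
qed

text \<open>The left-hand side is \<open>(\<psi>(\<cdot> x) * w)(S\<^sup>2(a))\<close> for the functional \<open>w = \<psi>(S(a') S\<^sup>-\<^sup>1(\<cdot>) x')\<close>, by
\<open>right_integral_antipode\<close>. Moving \<open>S\<^sup>2\<close> to the dual, where \<open>S'\<close> reverses products twice, gives
\<open>(S'\<^sup>2(\<psi>(\<cdot> x)) * S'\<^sup>2(w))(a)\<close>, and \<open>S'\<^sup>2(w)\<close> is the translate \<open>y'(\<cdot> a')\<close> of \<open>y' = \<psi>(S(\<cdot>) x')\<close>.\<close>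

lemma fourier_pairing:
  assumes \<psi>: "right_integral A \<Delta> \<psi>" and x: "x \<in> V" "x' \<in> V" and a: "a \<in> V" "a' \<in> V"
  shows "sw (R x x') (\<lambda>p q. \<psi> (S (S a) \<cdot> p) * \<psi> (S a' \<cdot> q))
    = sw (R a a') (\<lambda>u v. S' (fourier A S \<psi> x) u * fourier A S \<psi> x' v)"
proof -
  have l: "lin \<psi>" using \<psi> by (simp add: right_integral_def)
  note ms = mlin linear_on_compose[OF _ l]
  let ?P = "translate A \<psi>" and ?F = "fourier A S \<psi>"
  have P: "?P y \<in> W" if "y \<in> V" for y by (rule translate_right_integral_in[OF \<psi> that])
  have F: "?F y = S' (?P y)" "?F y \<in> W" if "y \<in> V" for y
    using that by (simp_all add: fourier_eq[OF \<psi>] P S'_in)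
  define f where "f = S (S a)"
  define d where "d = S a'"
  have f: "f \<in> V" and d: "d \<in> V" using a by (simp_all add: f_def d_def S_in)
  obtain b where b: "b \<in> W" "?P x' = S' b"
    using P[OF x(2)] S'_bij by (auto simp: bij_betw_def)
  obtain c where c: "c \<in> V" "b = G c" using b(1) by (rule W_cases)
  \<comment> \<open>This choice of \<open>w\<close> makes it visible that \<open>w\<close> lies in the dual; \<open>wT\<close> below identifies it.\<close>
  define w where "w = G (S d \<cdot> c)"
  have w: "w \<in> W" using c d by (simp add: w_def G_in mul_in S_in)
  have S'w: "S' w v = \<psi> (d \<cdot> v \<cdot> x')" if v: "v \<in> V" for v
  proof -
    have "S' w v = \<phi> (S (d \<cdot> v) \<cdot> c)"
      using v w c d by (simp add: antipode_dual w_def G_apply S_in S_mul mul_assoc mul_in)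
    also have "\<dots> = S' b (d \<cdot> v)"
      using v c d b by (simp add: antipode_dual G_apply S_in mul_in)
    also have "\<dots> = \<psi> (d \<cdot> v \<cdot> x')"
      using v d by (simp add: b(2)[symmetric] translate_apply mul_in)
    finally show ?thesis .
  qed
  have wT: "w v = \<psi> (d \<cdot> T v \<cdot> x')" if v: "v \<in> V" for v
    using S'w[OF T_in[OF v]] antipode_dual[OF w T_in[OF v]] S_T[OF v] by simp
  let ?X = "sw (R' f x) (\<lambda>u v. \<psi> u *\<^sub>C v)"
  have X: "?X \<in> V" by (intro sw_in_carrier ms f x | assumption)+
  have "sw (R x x') (\<lambda>p q. \<psi> (f \<cdot> p) * \<psi> (d \<cdot> q)) = \<psi> (d \<cdot> sw (R x x') (\<lambda>p q. \<psi> (f \<cdot> p) *\<^sub>C q))"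
    by (rule functional_of_slice(2)[symmetric, where \<beta> = "\<lambda>q. \<psi> (d \<cdot> q)"]) (intro ms f d x | assumption)+
  also have "\<dots> = \<psi> (d \<cdot> T ?X \<cdot> x')"
    using X x d by (simp add: right_integral_antipode[OF \<psi> f x] mul_assoc T_in)
  also have "\<dots> = w ?X"
    by (rule wT[OF X, symmetric])
  also have "\<dots> = sw (R' f x) (\<lambda>u v. \<psi> u * w v)"
    by (rule functional_of_slice(2)[OF l W_linear[OF w] R'_in[OF f x(1)]])
  also have "\<dots> = (?P x \<cdot>\<^bsub>B\<^esub> w) f"
    by (rule mul_translate_right_integral[OF \<psi> x(1) w f, symmetric])
  also have "\<dots> = S' (S' (?P x \<cdot>\<^bsub>B\<^esub> w)) a"
    using a P[OF x(1)] w by (simp add: antipode_dual S'_in dual_mul_in S_in f_def)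
  also have "\<dots> = (S' (?F x) \<cdot>\<^bsub>B\<^esub> S' (S' w)) a"
    using P[OF x(1)] w by (simp add: S'_mul S'_in F x)
  also have "\<dots> = sw (R a a') (\<lambda>u v. S' (?F x) u * ?F x' v)"
  proof (rule dual_mul_covered)
    fix v assume v: "v \<in> V"
    show "S' (S' w) v = ?F x' (v \<cdot> a')"
      using v a by (simp add: antipode_dual[OF S'_in[OF w]] S_in S'w fourier_apply mul_in S_mul d_def)
  qed (use x a w in \<open>simp_all add: F P S'_in\<close>)
  finally show ?thesis by (simp add: f_def d_def)
qed

text \<open>Applying \<open>S' \<otimes> \<iota>\<close> to both sides removes its inverse and makes both pairings with \<open>a \<otimes> a'\<close>
computable; they agree by \<open>fourier_pairing\<close>.\<close>

theorem fourier_coproduct: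
  assumes \<psi>: "right_integral A \<Delta> \<psi>" and x: "x \<in> V" "x' \<in> V"
  defines "F \<equiv> fourier A S \<psi>"
  shows "tensor_map V V F F (R x x') = tensor_map W W (inv_into W S') id (LB (S' (F x)) (F x'))"
proof -
  have F_in: "F y \<in> W" if "y \<in> V" for y
    using translate_right_integral_in[OF \<psi> that] that by (simp add: F_def fourier_eq[OF \<psi>] S'_in)
  have F_lin: "lin F" unfolding F_def by (rule fourier_linear[OF \<psi>])
  have bF: "bil (\<lambda>p q. F p \<otimes>\<^sub>t F q)"
    by (intro multilin F_lin)
  define t where "t = tensor_map V V F F (R x x')"
  have t: "t \<in> WW"
    unfolding t_def tensor_map_def
    by (rule tensor_lift_in[OF subspace_carrier subspace_carrier subspace_tensor_space bF _ R_in[OF x]])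
      (intro tens_in F_in)
  have bS: "bilinear_on W W (\<lambda>p q. S' p \<otimes>\<^sub>t q)"
    by (intro bilinear_onI linear_on_tens_left linear_on_tens_right S'_linear linear_on_ident)
  define s where "s = tensor_map W W S' id t"
  have s: "s \<in> WW"
    unfolding s_def tensor_map_def id_apply
    by (rule tensor_lift_in[OF subspace_W subspace_W subspace_tensor_space bS _ t]) (intro tens_in S'_in)
  have "s = LB (S' (F x)) (F x')"
  proof (rule dual_tensor_eqI[OF s LB_in])
    fix a a' assume a: "a \<in> V" "a' \<in> V"
    have b: "bilinear_on W W (\<lambda>p q. S' p a * q a')"
      by (intro bilinear_onI linear_on_mult_left linear_on_mult_right linear_on_compose[OF S'_linear eval_linear[of W]]
        eval_linear S'_in | assumption)+
    have "swB s (\<lambda>p q. p a * q a') = swB t (\<lambda>p q. swB (S' p \<otimes>\<^sub>t q) (\<lambda>p q. p a * q a'))"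
      unfolding s_def tensor_map_def id_apply
      by (rule tensor_lift_out[OF subspace_W subspace_W bS tensor_lift(1)[OF subspace_W subspace_W pair_bil] _
        subspace_tensor_space t]) (intro tens_in S'_in)
    also have "\<dots> = swB t (\<lambda>p q. S' p a * q a')"
      by (intro tensor_lift_cong tensor_lift(2)[OF subspace_W subspace_W pair_bil] S'_in)
    also have "\<dots> = sw (R x x') (\<lambda>p q. swB (F p \<otimes>\<^sub>t F q) (\<lambda>p q. S' p a * q a'))"
      unfolding t_def tensor_map_def
      by (rule sw_out[OF bF tensor_lift(1)[OF subspace_W subspace_W b] _ subspace_tensor_space R_in[OF x]])
        (intro tens_in F_in)
    also have "\<dots> = sw (R x x') (\<lambda>p q. S' (F p) a * F q a')"
      by (intro tensor_lift_cong tensor_lift(2)[OF subspace_W subspace_W b] F_in)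
    also have "\<dots> = sw (R x x') (\<lambda>p q. \<psi> (S (S a) \<cdot> p) * \<psi> (S a' \<cdot> q))"
      using a by (intro tensor_lift_cong) (simp add: antipode_dual F_in S_in, simp add: F_def fourier_apply S_in)
    also have "\<dots> = sw (R a a') (\<lambda>u v. S' (F x) u * F x' v)"
      unfolding F_def by (rule fourier_pairing[OF \<psi> x a])
    also have "\<dots> = swB (LB (S' (F x)) (F x')) (\<lambda>p q. p a * q a')"
      using x a by (intro LB_pairing[symmetric] S'_in F_in)
    finally show "swB s (\<lambda>p q. p a * q a') = swB (LB (S' (F x)) (F x')) (\<lambda>p q. p a * q a')" .
  qed (intro S'_in F_in x)+
  moreover have "tensor_map W W (inv_into W S') id s = t"
  proof -
    have inv_S': "inv_into W S' (S' b) = b" if "b \<in> W" for b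
      using S'_bij that by (simp add: bij_betw_inv_into_left)
    have inv_lin: "linear_on W (inv_into W S')"
      by (rule linear_on_inv_into[OF S'_linear subspace_W S'_bij])
    have bI: "bilinear_on W W (\<lambda>p q. inv_into W S' p \<otimes>\<^sub>t q)"
      by (intro bilinear_onI linear_on_tens_left linear_on_tens_right inv_lin linear_on_ident)
    have "tensor_map W W (inv_into W S') id s
        = swB t (\<lambda>p q. swB (S' p \<otimes>\<^sub>t q) (\<lambda>p q. inv_into W S' p \<otimes>\<^sub>t q))"
      unfolding s_def tensor_map_def id_apply
      by (rule tensor_lift_out[OF subspace_W subspace_W bS tensor_lift(1)[OF subspace_W subspace_W bI] _
        subspace_tensor_space t]) (intro tens_in S'_in)
    also have "\<dots> = swB t (\<lambda>p q. p \<otimes>\<^sub>t q)"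
      by (intro tensor_lift_cong) (simp add: tensor_lift(2)[OF subspace_W subspace_W bI] S'_in inv_S')
    also have "\<dots> = t"
      by (rule tensor_lift_tens[OF subspace_W subspace_W t])
    finally show ?thesis .
  qed
  ultimately show ?thesis by (simp add: t_def)
qed

end

theorem proposition3p21:
  fixes A :: "'a::complex_vector alg"
    and B :: "('a \<Rightarrow> complex) alg"
    and \<Delta> :: "'a comult"
    and \<Delta>' :: "('a \<Rightarrow> complex) comult"
    and S :: "'a \<Rightarrow> 'a"
    and S' :: "('a \<Rightarrow> complex) \<Rightarrow> ('a \<Rightarrow> complex)"
    and \<phi> \<psi> :: "'a \<Rightarrow> complex"
    and F :: "'a \<Rightarrow> 'a \<Rightarrow> complex"
  assumes "algebraic_quantum_group A \<Delta>"
    and "is_antipode A \<Delta> S"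
    and "left_integral A \<Delta> \<phi>"
    and "B = dual_alg A \<Delta> \<phi>"
    and "is_dual_comult A \<Delta> B \<Delta>'"
    and "is_antipode B \<Delta>' S'"
    and "right_integral A \<Delta> \<psi>"
    and "F = fourier A S \<psi>"
    and "x \<in> carr A" and "x' \<in> carr A"
    and "y = F x" and "y' = F x'"
  shows "tensor_map (carr A) (carr A) F F
           (unembed (A \<otimes>\<^sub>a A) (\<Delta> x \<cdot>\<^bsub>mult_alg2 A\<^esub> leg2 A x'))
       = tensor_map (carr B) (carr B) (inv_into (carr B) S') id
           (unembed (B \<otimes>\<^sub>a B) (leg1 B (S' y) \<cdot>\<^bsub>mult_alg2 B\<^esub> \<Delta>' y'))"
proof -
  obtain \<epsilon> where \<epsilon>: "is_counit A \<Delta> \<epsilon>" "\<forall>a\<in>carr A. \<forall>a'\<in>carr A.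
      tensor_lift (carr A) (carr A) (\<lambda>p q. S p \<cdot>\<^bsub>A\<^esub> q) (comult_r A \<Delta> a a') = \<epsilon> a *\<^sub>C a'"
    using assms(2) unfolding is_antipode_def by blast
  obtain \<epsilon>' where \<epsilon>': "is_counit B \<Delta>' \<epsilon>'" "\<forall>b\<in>carr B. \<forall>c\<in>carr B.
      tensor_lift (carr B) (carr B) (\<lambda>p q. S' p \<cdot>\<^bsub>B\<^esub> q) (comult_r B \<Delta>' b c) = \<epsilon>' b *\<^sub>C c"
    using assms(6) unfolding is_antipode_def by blast
  interpret dual_quantum_group A \<Delta> S \<epsilon> \<phi> B \<Delta>' S' \<epsilon>'
  proof
    show "regular_multiplier_hopf_algebra A \<Delta>"
      using assms(1) by (simp add: algebraic_quantum_group_def)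
  qed (use assms(2-6) \<epsilon> \<epsilon>' in \<open>simp_all add: is_antipode_def\<close>)
  show ?thesis
    using fourier_coproduct[OF assms(7,9,10)]
    unfolding assms(8,11,12) comult_r_def comult_l_def .
qed

end
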